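(* Let $\varphi:PG\to\mathbb{R}^{3}$ be a spatial embedding of the Petersen graph $PG$ that is a lift of a plane generic immersion $f:PG\to\mathbb{R}^{2}$, and let $D$ be a diagram of $\varphi$ based on $f(PG)$. Set \[ \mathcal{L}(\varphi)=\sum_{(d,e)\in D_{1}(PG)}\varepsilon(d,e)\,\ell_{D}(d,e), \] where $\varepsilon$ and $\ell_D$ are the functions defined in the context. Then $\mathcal{L}(\varphi)$ is a well-defined ambient isotopy invariant of $\varphi$, and \[ \mathcal{L}(\varphi)\equiv\sum_{(d,e)\in D_{1}(PG)}|f(d)\cap f(e)|\equiv 1\pmod 2. \]
   Context: The Petersen graph $PG$ has vertices $u_i,v_i$ ($i\in\mathbb{Z}/5\mathbb{Z}$) and the $15$ edges $u_iu_{i+1}$, $u_iv_i$, $v_iv_{i+2}$, each oriented from the first written vertex to the second. A graph is regarded as a topological space. A plane generic immersion of a graph $G$ is an immersion $f:G\to\mathbb{R}^2$ (a continuous locally injective, piecewise smooth map) whose multiple points are only finitely many transversal double points (crossings) between edges, i.e. between interior points of edges (possibly of the same edge). A spatial embedding of $G$ is a (tame) embedding $\varphi:G\to\mathbb{R}^3$. With $\pi(x,y,z)=(x,y)$, $\varphi$ is a lift of $f$ if $f=\pi\circ\varphi$; the diagram $D$ of $\varphi$ based on $f(G)$ is $f(G)$ together with the vertex information $f|_{V(G)}$ and the over/under information of $\varphi$ at each crossing. Two embeddings $\varphi,\varphi'$ are ambient isotopic if $\varphi'=h_1\circ\varphi$ for some ambient isotopy $(h_t)$ of $\mathbb{R}^3$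 with $h_0=\mathrm{id}$; an ambient isotopy invariant takes equal values on ambient isotopic embeddings. The distance of two edges is the minimum number of edges of a path joining them, and $D_1(PG)$ is the set of unordered pairs $(d,e)$ of edges of $PG$ at distance $1$ (i.e. $d,e$ are disjoint and some edge is adjacent to both). For distinct oriented edges $d,e$, $\ell_D(d,e)=c_D^{+}(d,e)-c_D^{-}(d,e)$, where $c_D^{\pm}(d,e)$ is the number of positive/negative crossings (with the usual sign convention of knot theory for oriented strands) in $f(d)\cap f(e)$. The map $\varepsilon:D_1(PG)\to\mathbb{Z}$ is given, for all $i,j\in\mathbb{Z}/5\mathbb{Z}$, by: $\varepsilon(u_{i}u_{i+1},u_{i+2}u_{i+3})=1$; $\varepsilon(u_{i}u_{i+1},u_{i-1}v_{i-1})=1$; $\varepsilon(u_{i}u_{i+1},u_{i+2}v_{i+2})=-1$; $\varepsilon(u_{i}u_{i+1},v_{j}v_{j+2})=1$ whenever this pair belongs to $D_1(PG)$ (i.e. $j\neq i+2$); $\varepsilon(u_{i}v_{i},u_{i\pm1}v_{i\pm1})=-1$; $\varepsilon(u_{i}v_{i},u_{i\pm2}v_{i\pm2})=1$; $\varepsilon(u_{i}v_{i},v_{i+1}v_{i+3})=-1$; $\varepsilon(u_{i}v_{i},v_{i+2}v_{i+4})=1$; $\varepsilon(v_{i}v_{i+2},v_{i+1}v_{i+3})=-1$. *)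

theory Defs
  imports
    "HOL-Analysis.Analysis"
    "HOL-Library.Uprod"
    "HOL-Number_Theory.Cong"
begin

section \<open>The Petersen graph\<close>

text \<open>Indices live in the numeral type \<open>5\<close>, whose ring structure is that of the integers
  modulo 5. The edges \<open>UU i\<close>, \<open>UV i\<close>, \<open>VV i\<close> are the oriented edges
  $u_iu_{i+1}$, $u_iv_i$, $v_iv_{i+2}$.\<close>

datatype pg_vertex = U 5 | V 5

datatype pg_edge = UU 5 | UV 5 | VV 5

instance pg_vertex :: finite
proof
  have "(UNIV :: pg_vertex set) = range U \<union> range V"
    by (metis UNIV_eq_I UnCI pg_vertex.exhaust rangeI)
  then show "finite (UNIV :: pg_vertex set)"
    by (metis finite finite_Un finite_imageI)
qed

instance pg_edge :: finite
proof
  have "(UNIV :: pg_edge set) = range UU \<union> range UV \<union> range VV"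
    by (metis UNIV_eq_I UnCI pg_edge.exhaust rangeI)
  then show "finite (UNIV :: pg_edge set)"
    by (metis finite finite_Un finite_imageI)
qed

fun source :: "pg_edge \<Rightarrow> pg_vertex" where
  "source (UU i) = U i"
| "source (UV i) = U i"
| "source (VV i) = V i"

fun target :: "pg_edge \<Rightarrow> pg_vertex" where
  "target (UU i) = U (i + 1)"
| "target (UV i) = V i"
| "target (VV i) = V (i + 2)"

definition ends :: "pg_edge \<Rightarrow> pg_vertex set" where
  "ends e = {source e, target e}"

definition pg_adj :: "pg_vertex \<Rightarrow> pg_vertex \<Rightarrow> bool" where
  "pg_adj x y \<longleftrightarrow> (\<exists>e. ends e = {x, y})"

text \<open>Paths are represented by their vertex sequences; a path with \<open>n\<close> edges has \<open>n + 1\<close>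
  vertices.\<close>

definition pg_path :: "pg_vertex list \<Rightarrow> bool" where
  "pg_path p \<longleftrightarrow> p \<noteq> [] \<and> distinct p \<and> (\<forall>k. Suc k < length p \<longrightarrow> pg_adj (p ! k) (p ! Suc k))"

definition edge_dist :: "pg_edge \<Rightarrow> pg_edge \<Rightarrow> nat" where
  "edge_dist d e =
    (LEAST n. \<exists>p. pg_path p \<and> hd p \<in> ends d \<and> last p \<in> ends e \<and> length p = Suc n)"

definition D1 :: "pg_edge uprod set" where
  "D1 = {Upair d e | d e. edge_dist d e = 1}"

text \<open>The table of values of $\varepsilon$, each pair being listed in the order in which it is
  written in the definition of $\varepsilon$; the value is 0 for pairs not listed in that order.\<close>

fun eps_table :: "pg_edge \<Rightarrow> pg_edge \<Rightarrow> int" where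
  "eps_table (UU i) (UU j) = (if j = i + 2 then 1 else 0)"
| "eps_table (UU i) (UV j) = (if j = i - 1 then 1 else if j = i + 2 then -1 else 0)"
| "eps_table (UU i) (VV j) = (if j \<noteq> i + 2 then 1 else 0)"
| "eps_table (UV i) (UV j) =
    (if j = i + 1 \<or> j = i - 1 then -1 else if j = i + 2 \<or> j = i - 2 then 1 else 0)"
| "eps_table (UV i) (VV j) = (if j = i + 1 then -1 else if j = i + 2 then 1 else 0)"
| "eps_table (VV i) (VV j) = (if j = i + 1 then -1 else 0)"
| "eps_table _ _ = 0"

lemma eps_table_consistent:
  assumes "eps_table d e \<noteq> 0" "eps_table e d \<noteq> 0"
  shows "eps_table d e = eps_table e d"
proof -
  have "(i :: 5) = j + 2 \<Longrightarrow> j = i + 2 \<Longrightarrow> False" for i j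
  proof -
    assume "i = j + 2" "j = i + 2"
    then have "i + 0 = i + 4" by (simp add: algebra_simps)
    then have "(0 :: 5) = 4" unfolding add_left_cancel .
    then show False by simp
  qed
  moreover have "(i :: 5) = j + 1 \<Longrightarrow> j = i + 1 \<Longrightarrow> False" for i j
  proof -
    assume "i = j + 1" "j = i + 1"
    then have "i + 0 = i + 2" by (simp add: algebra_simps)
    then have "(0 :: 5) = 2" unfolding add_left_cancel .
    then show False by simp
  qed
  ultimately show ?thesis
    using assms by (cases d; cases e) (auto split: if_splits simp: algebra_simps)
qed

lift_definition eps :: "pg_edge uprod \<Rightarrow> int"
  is "\<lambda>(d, e). if eps_table d e \<noteq> 0 then eps_table d e else eps_table e d"
  using eps_table_consistent by (auto split: if_splits)

section \<open>The Petersen graph as a topological space\<close>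

text \<open>The geometric realization in the Euclidean space spanned by the vertices: every edge is the
  segment between the corresponding unit vectors.\<close>

type_synonym pg_point = "real ^ pg_vertex"

definition edge_point :: "pg_edge \<Rightarrow> real \<Rightarrow> pg_point" where
  "edge_point e t = (1 - t) *\<^sub>R axis (source e) 1 + t *\<^sub>R axis (target e) 1"

definition edge_set :: "pg_edge \<Rightarrow> pg_point set" where
  "edge_set e = edge_point e ` {0..1}"

definition PG :: "pg_point set" where
  "PG = (\<Union>e. edge_set e)"

section \<open>Plane generic immersions\<close>

text \<open>\<open>g k\<close> is the \<open>k\<close>-th derivative of \<open>\<gamma>\<close>, one-sided at boundary points of \<open>I\<close>.\<close>

definition smooth_curve_on :: "real set \<Rightarrow> (real \<Rightarrow> 'a::real_normed_vector) \<Rightarrow> bool" where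
  "smooth_curve_on I \<gamma> \<longleftrightarrow>
    (\<exists>g :: nat \<Rightarrow> real \<Rightarrow> 'a. (\<forall>t\<in>I. g 0 t = \<gamma> t) \<and>
      (\<forall>k. \<forall>t\<in>I. (g k has_vector_derivative g (Suc k) t) (at t within I)))"

definition piecewise_smooth_curve :: "(real \<Rightarrow> 'a::real_normed_vector) \<Rightarrow> bool" where
  "piecewise_smooth_curve \<gamma> \<longleftrightarrow>
    (\<exists>B. finite B \<and> {0, 1} \<subseteq> B \<and> B \<subseteq> {0..1} \<and>
      (\<forall>a\<in>B. \<forall>b\<in>B. a < b \<and> {a<..<b} \<inter> B = {} \<longrightarrow> smooth_curve_on {a..b} \<gamma>))"

definition locally_injective_on ::
    "'a::topological_space set \<Rightarrow> ('a \<Rightarrow> 'b) \<Rightarrow> bool" where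
  "locally_injective_on S f \<longleftrightarrow> (\<forall>x\<in>S. \<exists>W. open W \<and> x \<in> W \<and> inj_on f (W \<inter> S))"

definition plane_immersion :: "(pg_point \<Rightarrow> real ^ 2) \<Rightarrow> bool" where
  "plane_immersion f \<longleftrightarrow>
    continuous_on PG f \<and> locally_injective_on PG f \<and>
    (\<forall>e. piecewise_smooth_curve (\<lambda>t. f (edge_point e t)))"

definition velocity :: "(pg_point \<Rightarrow> real ^ 2) \<Rightarrow> pg_edge \<Rightarrow> real \<Rightarrow> real ^ 2" where
  "velocity f e t = vector_derivative (\<lambda>s. f (edge_point e s)) (at t)"

text \<open>The strands of \<open>f\<close> through the interior point \<open>s\<close> of \<open>d\<close> and the interior point \<open>t\<close> of \<open>e\<close>
  have tangents there, and these span the plane.\<close>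

definition transversal_at ::
    "(pg_point \<Rightarrow> real ^ 2) \<Rightarrow> pg_edge \<Rightarrow> real \<Rightarrow> pg_edge \<Rightarrow> real \<Rightarrow> bool" where
  "transversal_at f d s e t \<longleftrightarrow>
    (\<lambda>r. f (edge_point d r)) differentiable (at s) \<and>
    (\<lambda>r. f (edge_point e r)) differentiable (at t) \<and>
    span {velocity f d s, velocity f e t} = UNIV"

definition multiple_points :: "(pg_point \<Rightarrow> real ^ 2) \<Rightarrow> (real ^ 2) set" where
  "multiple_points f = {f x | x y. x \<in> PG \<and> y \<in> PG \<and> x \<noteq> y \<and> f x = f y}"

definition plane_generic_immersion :: "(pg_point \<Rightarrow> real ^ 2) \<Rightarrow> bool" where
  "plane_generic_immersion f \<longleftrightarrow>
    plane_immersion f \<and> finite (multiple_points f) \<and>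
    (\<forall>p\<in>multiple_points f. \<exists>d e. \<exists>s\<in>{0<..<1}. \<exists>t\<in>{0<..<1}.
      edge_point d s \<noteq> edge_point e t \<and>
      {x \<in> PG. f x = p} = {edge_point d s, edge_point e t} \<and>
      transversal_at f d s e t)"

section \<open>Spatial embeddings, diagrams and ambient isotopy\<close>

text \<open>Tame: some self-homeomorphism of space makes the set polyhedral.\<close>

definition tame :: "(real ^ 3) set \<Rightarrow> bool" where
  "tame X \<longleftrightarrow>
    (\<exists>h k. homeomorphism UNIV (UNIV :: (real ^ 3) set) h k \<and>
      (\<exists>S. finite S \<and> h ` X = (\<Union>(a, b)\<in>S. closed_segment a b)))"

definition spatial_embedding :: "(pg_point \<Rightarrow> real ^ 3) \<Rightarrow> bool" where
  "spatial_embedding \<phi> \<longleftrightarrow> embedding_map (top_of_set PG) euclidean \<phi> \<and> tame (\<phi> ` PG)"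

definition proj :: "real ^ 3 \<Rightarrow> real ^ 2" where
  "proj p = vector [p $ 1, p $ 2]"

definition is_lift :: "(pg_point \<Rightarrow> real ^ 3) \<Rightarrow> (pg_point \<Rightarrow> real ^ 2) \<Rightarrow> bool" where
  "is_lift \<phi> f \<longleftrightarrow> (\<forall>x\<in>PG. f x = proj (\<phi> x))"

definition ambient_isotopic :: "(pg_point \<Rightarrow> real ^ 3) \<Rightarrow> (pg_point \<Rightarrow> real ^ 3) \<Rightarrow> bool" where
  "ambient_isotopic \<phi> \<phi>' \<longleftrightarrow>
    (\<exists>h :: real \<Rightarrow> real ^ 3 \<Rightarrow> real ^ 3.
      continuous_on ({0..1} \<times> UNIV) (\<lambda>(t, p). h t p) \<and>
      (\<forall>t\<in>{0..1}. \<exists>k. homeomorphism UNIV UNIV (h t) k) \<and>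
      (\<forall>p. h 0 p = p) \<and>
      (\<forall>x\<in>PG. \<phi>' x = h 1 (\<phi> x)))"

text \<open>A diagram is recorded as the plane curve system together with the over/under information
  \<open>over D x y\<close>: at the crossing with preimages \<open>x\<close> and \<open>y\<close>, the strand through \<open>x\<close> is the
  upper one.\<close>

datatype diagram =
  Diagram (shadow: "pg_point \<Rightarrow> real ^ 2") (over: "pg_point \<Rightarrow> pg_point \<Rightarrow> bool")

definition diagram_based_on ::
    "diagram \<Rightarrow> (pg_point \<Rightarrow> real ^ 3) \<Rightarrow> (pg_point \<Rightarrow> real ^ 2) \<Rightarrow> bool" where
  "diagram_based_on D \<phi> f \<longleftrightarrow>
    (\<forall>x\<in>PG. shadow D x = f x) \<and>
    (\<forall>x\<in>PG. \<forall>y\<in>PG. x \<noteq> y \<and> f x = f y \<longrightarrow> (over D x y \<longleftrightarrow> \<phi> y $ 3 < \<phi> x $ 3))"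

text \<open>The crossings in the common image of \<open>d\<close> and \<open>e\<close> at which \<open>d\<close> is the upper strand and whose
  sign is \<open>\<sigma>\<close>: a crossing is positive if the pair (tangent of the upper strand, tangent of the
  lower strand) is a positive basis of the plane.\<close>

definition over_crossings :: "diagram \<Rightarrow> real \<Rightarrow> pg_edge \<Rightarrow> pg_edge \<Rightarrow> (real ^ 2) set" where
  "over_crossings D \<sigma> d e =
    {p. \<exists>s\<in>{0<..<1}. \<exists>t\<in>{0<..<1}.
      shadow D (edge_point d s) = p \<and> shadow D (edge_point e t) = p \<and>
      over D (edge_point d s) (edge_point e t) \<and>
      sgn (det (vector [velocity (shadow D) d s, velocity (shadow D) e t] :: real ^ 2 ^ 2)) = \<sigma>}"

definition signed_crossings :: "diagram \<Rightarrow> real \<Rightarrow> pg_edge \<Rightarrow> pg_edge \<Rightarrow> (real ^ 2) set" where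
  "signed_crossings D \<sigma> d e = over_crossings D \<sigma> d e \<union> over_crossings D \<sigma> e d"

definition c_pos :: "diagram \<Rightarrow> pg_edge \<Rightarrow> pg_edge \<Rightarrow> nat" where
  "c_pos D d e = card (signed_crossings D 1 d e)"

definition c_neg :: "diagram \<Rightarrow> pg_edge \<Rightarrow> pg_edge \<Rightarrow> nat" where
  "c_neg D d e = card (signed_crossings D (-1) d e)"

text \<open>Both quantities below do not depend on the order of the two edges, and are therefore defined
  on unordered pairs.\<close>

lift_definition ell :: "diagram \<Rightarrow> pg_edge uprod \<Rightarrow> int"
  is "\<lambda>D (d, e). int (c_pos D d e) - int (c_neg D d e)"
  by (auto simp: c_pos_def c_neg_def signed_crossings_def Un_commute)

lift_definition num_common_points :: "(pg_point \<Rightarrow> real ^ 2) \<Rightarrow> pg_edge uprod \<Rightarrow> nat"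
  is "\<lambda>f (d, e). card (f ` edge_set d \<inter> f ` edge_set e)"
  by (auto simp: Int_commute)

definition L_inv :: "diagram \<Rightarrow> int" where
  "L_inv D = (\<Sum>P\<in>D1. eps P * ell D P)"

end

theory Submission
  imports Defs
begin

text \<open>For disjoint edges \<open>d\<close>, \<open>e\<close> the map \<open>(x, y) \<mapsto> (\<phi> x - \<phi> y) / \<parallel>\<phi> x - \<phi> y\<parallel>\<close> sends the cell \<open>d \<times> e\<close> to the
  unit sphere, and the crossings of \<open>d\<close> over \<open>e\<close> are the preimages of the north pole. The cells weighted by
  \<open>\<epsilon>\<close> form a closed surface, so \<open>L\<close> is, up to sign, the degree of the resulting map, a homotopy
  invariant. The degree is computed discretely: on a fine grid it is the sum of the Berry phases
  (half the solid angles) of the images of the grid squares, divided by \<open>2 * pi\<close>. This sum is continuous in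
  time, and it is a multiple of \<open>2 * pi\<close> because the phases are holonomies of a line bundle on the sphere,
  whose contributions along the grid edges cancel on a closed surface. Trivializing the bundle away from the north
  pole leaves one winding number for each crossing.

  For the parity, the number of crossings of \<open>d\<close> and \<open>e\<close> is congruent to the winding number of \<open>f x - f y\<close> along the
  boundary of \<open>d \<times> e\<close>. Summed over all pairs, every angle swept out by an edge as seen from a vertex
  occurs an even number of times, so it matters only modulo \<open>2 * pi\<close>, that is, through the directions between
  the vertices. These cancel up to an odd number of half turns.\<close>

section \<open>Principal arguments\<close>

text \<open>An ambient isotopy is merely continuous, so the intermediate embeddings need not have a
  generic projection, and crossings cannot be followed through time. A Berry sum needs no
  regularity: it involves only finitely many values of the direction map. Differentiability enters
  only at the crossings of the given diagrams, where a linear approximation at a single point yields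
  the local winding number. Two levels of precision are needed. At intermediate times each square
  has to match its boundary only modulo 2 * pi, so any choice of spinors over the sphere will do,
  continuous or not. At a diagram the match has to be exact in every square. This requires a frame
  for each hemisphere and a sector around the positive reals in which principal arguments add. The
  degree is taken over ordered pairs \<open>(d, e)\<close> and sees only the crossings with
  \<open>d\<close> above \<open>e\<close>; both orders together see each crossing once. The zeros of
  \<open>a s - b t\<close> on the parameter square describe the crossings of two plane curves with
  or without heights, so one localization serves both the degree and the parity.\<close>

lemma cis_eq_1_int:
  assumes "cis x = 1"
  obtains k :: int where "x = 2 * pi * k"
proof -
  have "cos x = 1" using assms by (metis cis.sel(1) one_complex.sel(1))
  then obtain k :: int where "x = k * (2 * pi)" by (auto simp: cos_one_2pi_int)
  then show ?thesis using that[of k] by simp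
qed

text \<open>Identities between principal arguments are proved in two halves: modulo 2 * pi by
  multiplicativity of \<open>cis\<close>, and then exactly, because the two sides are too close to
  differ by a nonzero multiple of 2 * pi.\<close>

lemma eq_if_cis_eq:
  assumes "cis x = cis y" "\<bar>x - y\<bar> < 2 * pi"
  shows "x = y"
proof -
  have "cis (x - y) = 1" using assms(1) by (simp flip: cis_divide)
  then obtain k :: int where k: "x - y = 2 * pi * k" by (rule cis_eq_1_int)
  then have "2 * pi * \<bar>k\<bar> < 2 * pi * 1" using assms(2) by (simp add: abs_mult)
  then have "k = 0" by (subst (asm) mult_less_cancel_left_pos) auto
  with k show ?thesis by simp
qed

text \<open>The open sector of half-angle pi / 4 around the positive reals: four arguments from it
  add up to less than pi in absolute value. The form with real and imaginary parts is the one that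
  norm estimates deliver.\<close>

definition narrow :: "complex \<Rightarrow> bool" where
  "narrow u \<longleftrightarrow> \<bar>Im u\<bar> < Re u"

lemma narrow_nonzero: "narrow u \<Longrightarrow> u \<noteq> 0"
  by (auto simp: narrow_def)

lemma narrow_near_real:
  assumes "cmod (u - of_real r) \<le> d" "2 * d < r"
  shows "narrow u"
  using assms abs_Re_le_cmod[of "u - of_real r"] abs_Im_le_cmod[of "u - of_real r"]
  by (auto simp: narrow_def)

text \<open>Squaring doubles an argument below pi / 2 and carries the sector into the right half
  plane.\<close>

lemma narrow_Arg: 
  assumes "narrow u"
  shows "\<bar>Arg u\<bar> < pi / 4"
proof -
  have "Re u > 0" using assms by (auto simp: narrow_def)
  then have half: "\<bar>Arg u\<bar> < pi / 2" by (subst Arg_Re_pos) simp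
  have "u \<noteq> 0" using assms by (rule narrow_nonzero)
  then have "Arg (u * u) = 2 * Arg u"
    using half by (subst Arg_times) auto
  moreover have "Re (u * u) > 0"
  proof -
    have "\<bar>Im u\<bar> * \<bar>Im u\<bar> < Re u * Re u"
      using assms by (intro mult_strict_mono') (auto simp: narrow_def)
    then show ?thesis by (simp add: abs_mult_self)
  qed
  then have "\<bar>Arg (u * u)\<bar> < pi / 2" by (subst Arg_Re_pos) simp
  ultimately show ?thesis by simp
qed

lemma cis_Arg_mult: "a \<noteq> 0 \<Longrightarrow> b \<noteq> 0 \<Longrightarrow> cis (Arg (a * b)) = cis (Arg a + Arg b)"
  by (simp add: cis_Arg sgn_mult flip: cis_mult)

text \<open>Stated through \<open>cis\<close> because \<open>Arg\<close> is not odd under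
  conjugation: a negative real and its conjugate both have argument pi.\<close>

lemma cis_Arg_cnj: "a \<noteq> 0 \<Longrightarrow> cis (Arg (cnj a)) = cis (- Arg a)"
  by (auto simp: Arg_cnj Arg_real complex_is_Real_iff complex_eq_iff)

lemma cis_Arg_square:
  assumes "a \<noteq> 0" "b \<noteq> 0" "c \<noteq> 0" "d \<noteq> 0"
  shows "cis (Arg (a * b * cnj c * cnj d)) = cis (Arg a + Arg b - Arg c - Arg d)"
proof -
  have "cis (Arg (a * b * cnj c * cnj d)) = cis (Arg a) * cis (Arg b) * cis (- Arg c) * cis (- Arg d)"
    using assms
    by (simp add: cis_Arg_mult cis_Arg_cnj flip: cis_mult)
  then show ?thesis by (simp add: cis_mult)
qed

lemma Arg_narrow_square:
  assumes "narrow a" "narrow b" "narrow c" "narrow d"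
  shows "Arg (a * b * cnj c * cnj d) = Arg a + Arg b - Arg c - Arg d"
proof (rule eq_if_cis_eq)
  show "cis (Arg (a * b * cnj c * cnj d)) = cis (Arg a + Arg b - Arg c - Arg d)"
    using assms by (intro cis_Arg_square narrow_nonzero)
  have "\<bar>Arg (a * b * cnj c * cnj d)\<bar> \<le> pi" using Arg_bounded[of "a * b * cnj c * cnj d"] by auto
  then show "\<bar>Arg (a * b * cnj c * cnj d) - (Arg a + Arg b - Arg c - Arg d)\<bar> < 2 * pi"
    using assms[THEN narrow_Arg] by linarith
qed

lemma Arg_pos_scale: "r > 0 \<Longrightarrow> Arg (complex_of_real r * u) = Arg u"
  by simp

section \<open>Telescoping over rectangles of a grid\<close>

text \<open>\<open>h i j\<close> and \<open>v i j\<close> are the values of a 1-cochain on the horizontal and the vertical grid edge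
  starting at \<open>(i, j)\<close>; the boundary is traversed counterclockwise.\<close>

definition square_bd :: "(nat \<Rightarrow> nat \<Rightarrow> real) \<Rightarrow> (nat \<Rightarrow> nat \<Rightarrow> real) \<Rightarrow> nat \<Rightarrow> nat \<Rightarrow> real" where
  "square_bd h v i j = h i j + v (Suc i) j - h i (Suc j) - v i j"

definition rect_bd ::
    "(nat \<Rightarrow> nat \<Rightarrow> real) \<Rightarrow> (nat \<Rightarrow> nat \<Rightarrow> real) \<Rightarrow> nat \<Rightarrow> nat \<Rightarrow> nat \<Rightarrow> nat \<Rightarrow> real" where
  "rect_bd h v i1 i2 j1 j2 =
    (\<Sum>i\<in>{i1..<i2}. h i j1) + (\<Sum>j\<in>{j1..<j2}. v i2 j)
    - (\<Sum>i\<in>{i1..<i2}. h i j2) - (\<Sum>j\<in>{j1..<j2}. v i1 j)"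

text \<open>Discrete Green formula: every inner grid edge is traversed once in each
  direction.\<close>

lemma sum_square_bd:
  assumes "i1 \<le> i2" "j1 \<le> j2"
  shows "(\<Sum>(i, j)\<in>{i1..<i2} \<times> {j1..<j2}. square_bd h v i j) = rect_bd h v i1 i2 j1 j2"
proof -
  have H: "(\<Sum>j\<in>{j1..<j2}. h i (Suc j) - h i j) = h i j2 - h i j1" for i
    using assms(2) by (rule sum_Suc_diff')
  have V: "(\<Sum>i\<in>{i1..<i2}. v (Suc i) j - v i j) = v i2 j - v i1 j" for j
    using assms(1) by (rule sum_Suc_diff')
  have "(\<Sum>(i, j)\<in>{i1..<i2} \<times> {j1..<j2}. square_bd h v i j) =
      (\<Sum>i\<in>{i1..<i2}. \<Sum>j\<in>{j1..<j2}. (v (Suc i) j - v i j) - (h i (Suc j) - h i j))"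
    by (simp add: sum.cartesian_product square_bd_def algebra_simps)
  also have "\<dots> = (\<Sum>j\<in>{j1..<j2}. \<Sum>i\<in>{i1..<i2}. v (Suc i) j - v i j)
      - (\<Sum>i\<in>{i1..<i2}. \<Sum>j\<in>{j1..<j2}. h i (Suc j) - h i j)"
    by (subst sum.swap) (simp only: sum_subtractf)
  also have "\<dots> = rect_bd h v i1 i2 j1 j2"
    unfolding H V by (simp add: rect_bd_def sum_subtractf)
  finally show ?thesis .
qed

definition rect :: "nat \<Rightarrow> nat \<Rightarrow> nat \<Rightarrow> nat \<Rightarrow> (nat \<times> nat) set" where
  "rect i1 i2 j1 j2 = {i1..<i2} \<times> {j1..<j2}"

text \<open>A discrete residue theorem. \<open>F\<close> is the curvature of a connection with two
  trivializations, \<open>(h, v)\<close> valid off the boxes and \<open>(h', v')\<close> valid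
  inside them. Each box contributes the discrepancy of the two along its own boundary.\<close>

lemma sum_grid_localized:
  fixes h v h' v' :: "nat \<Rightarrow> nat \<Rightarrow> real"
  assumes fin: "finite K"
    and le: "\<And>k. k \<in> K \<Longrightarrow> i1 k \<le> i2 k \<and> j1 k \<le> j2 k"
    and sub: "\<And>k. k \<in> K \<Longrightarrow> rect (i1 k) (i2 k) (j1 k) (j2 k) \<subseteq> {..<n} \<times> {..<n}"
    and disj: "\<And>k l. k \<in> K \<Longrightarrow> l \<in> K \<Longrightarrow> k \<noteq> l \<Longrightarrow>
      rect (i1 k) (i2 k) (j1 k) (j2 k) \<inter> rect (i1 l) (i2 l) (j1 l) (j2 l) = {}"
    and out: "\<And>i j. i < n \<Longrightarrow> j < n \<Longrightarrow> (\<And>k. k \<in> K \<Longrightarrow> (i, j) \<notin> rect (i1 k) (i2 k) (j1 k) (j2 k)) \<Longrightarrow>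
      F i j = square_bd h v i j"
    and inn: "\<And>k i j. k \<in> K \<Longrightarrow> (i, j) \<in> rect (i1 k) (i2 k) (j1 k) (j2 k) \<Longrightarrow>
      F i j = square_bd h' v' i j"
  shows "(\<Sum>i<n. \<Sum>j<n. F i j) = rect_bd h v 0 n 0 n
    + (\<Sum>k\<in>K. rect_bd h' v' (i1 k) (i2 k) (j1 k) (j2 k) - rect_bd h v (i1 k) (i2 k) (j1 k) (j2 k))"
proof -
  define R where "R k = rect (i1 k) (i2 k) (j1 k) (j2 k)" for k
  define G where "G = {..<n} \<times> {..<n}"
  define g where "g = (\<lambda>(i, j). F i j - square_bd h v i j)"
  have G: "finite G" by (simp add: G_def)
  have RG: "R k \<subseteq> G" if "k \<in> K" for k using sub[OF that] by (simp add: R_def G_def)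
  have "(\<Sum>i<n. \<Sum>j<n. F i j) - rect_bd h v 0 n 0 n = (\<Sum>p\<in>G. g p)"
    using sum_square_bd[of 0 n 0 n h v]
    by (simp add: sum.cartesian_product g_def sum_subtractf G_def case_prod_beta atLeast0LessThan)
  also have "\<dots> = (\<Sum>p\<in>(\<Union>k\<in>K. R k). g p)"
  proof (rule sum.mono_neutral_right)
    show "\<forall>p\<in>G - (\<Union>k\<in>K. R k). g p = 0"
      using out by (auto simp: g_def G_def R_def)
  qed (use RG G in auto)
  also have "\<dots> = (\<Sum>k\<in>K. \<Sum>p\<in>R k. g p)"
  proof (rule sum.UNION_disjoint)
    show "\<forall>k\<in>K. finite (R k)" using RG G by (meson finite_subset)
    show "\<forall>k\<in>K. \<forall>l\<in>K. k \<noteq> l \<longrightarrow> R k \<inter> R l = {}" using disj by (simp add: R_def)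
  qed (rule fin)
  also have "\<dots> = (\<Sum>k\<in>K. rect_bd h' v' (i1 k) (i2 k) (j1 k) (j2 k) - rect_bd h v (i1 k) (i2 k) (j1 k) (j2 k))"
  proof (rule sum.cong[OF refl])
    fix k assume k: "k \<in> K"
    have "(\<Sum>p\<in>R k. g p) = (\<Sum>(i, j)\<in>R k. square_bd h' v' i j - square_bd h v i j)"
      using inn[OF k] by (intro sum.cong) (auto simp: g_def R_def)
    also have "\<dots> = rect_bd h' v' (i1 k) (i2 k) (j1 k) (j2 k) - rect_bd h v (i1 k) (i2 k) (j1 k) (j2 k)"
      using le[OF k] by (simp add: R_def rect_def case_prod_beta sum_subtractf
        sum_square_bd[unfolded case_prod_beta])
    finally show "(\<Sum>p\<in>R k. g p) = \<dots>" .
  qed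
  finally show ?thesis by simp
qed

section \<open>Winding along the boundary of a rectangle\<close>

definition ang :: "complex \<Rightarrow> complex \<Rightarrow> real" where
  "ang p q = Arg (q * cnj p)"

lemma cis_ang: "p \<noteq> 0 \<Longrightarrow> q \<noteq> 0 \<Longrightarrow> cis (ang p q) = sgn q * cnj (sgn p)"
  by (simp add: ang_def cis_Arg sgn_mult sgn_div_norm norm_mult)

lemma sgn_cnj_mult: "(p :: complex) \<noteq> 0 \<Longrightarrow> cnj (sgn p) * sgn p = 1"
  by (metis complex_cnj_cnj complex_norm_square mult.commute norm_sgn of_real_1 power_one)

lemma cis_ang_add:
  assumes "p \<noteq> 0" "q \<noteq> 0" "r \<noteq> 0"
  shows "cis (ang p q + ang q r) = cis (ang p r)"
  using sgn_cnj_mult[of q] assms by (simp add: cis_ang flip: cis_mult) (simp add: algebra_simps)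

lemma Im_sign_nonzero:
  "0 < \<sigma> * Im (q * cnj p) \<Longrightarrow> p \<noteq> 0" "0 < \<sigma> * Im (q * cnj p) \<Longrightarrow> q \<noteq> 0"
  by auto

lemma ang_sign:
  assumes "\<sigma> = 1 \<or> \<sigma> = -1" "0 < \<sigma> * Im (q * cnj p)"
  shows "0 < \<sigma> * ang p q" "\<sigma> * ang p q < pi"
  using assms Arg_lt_pi[of "q * cnj p"] Arg_neg_iff[of "q * cnj p"] mpi_less_Arg[of "q * cnj p"]
  by (auto simp: ang_def)

text \<open>\<open>\<sigma>\<close> is the common sense of rotation. All three angles lie strictly
  between 0 and \<open>\<sigma> * pi\<close>, so no full turn can be lost.\<close>

lemma ang_add:
  assumes "\<sigma> = 1 \<or> \<sigma> = -1"
    and "0 < \<sigma> * Im (q * cnj p)" "0 < \<sigma> * Im (r * cnj q)" "0 < \<sigma> * Im (r * cnj p)"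
  shows "ang p q + ang q r = ang p r"
proof (rule eq_if_cis_eq)
  show "cis (ang p q + ang q r) = cis (ang p r)"
    using assms(2-4) by (intro cis_ang_add) auto
  show "\<bar>ang p q + ang q r - ang p r\<bar> < 2 * pi"
    using assms(1) ang_sign[OF assms(1,2)] ang_sign[OF assms(1,3)] ang_sign[OF assms(1,4)] by auto
qed

text \<open>Points moving along a straight line that misses the origin turn around it in one sense
  only. The hypothesis concerns all pairs of points because the partial sums are angles between
  distant ones.\<close>

lemma sum_ang_side:
  fixes p :: "nat \<Rightarrow> complex"
  assumes "\<sigma> = 1 \<or> \<sigma> = -1" "i1 < i2"
    and "\<And>i j. i1 \<le> i \<Longrightarrow> i < j \<Longrightarrow> j \<le> i2 \<Longrightarrow> 0 < \<sigma> * Im (p j * cnj (p i))"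
  shows "(\<Sum>i\<in>{i1..<i2}. ang (p i) (p (Suc i))) = ang (p i1) (p i2)"
  using assms(2,3)
proof (induction i2)
  case (Suc n)
  show ?case
  proof (cases "i1 = n")
    case True
    then show ?thesis by simp
  next
    case False
    then have lt: "i1 < n" using Suc.prems(1) by simp
    have "(\<Sum>i\<in>{i1..<n}. ang (p i) (p (Suc i))) = ang (p i1) (p n)"
      using lt Suc.prems(2) by (intro Suc.IH) auto
    moreover have "ang (p i1) (p n) + ang (p n) (p (Suc n)) = ang (p i1) (p (Suc n))"
      using lt Suc.prems(2) by (intro ang_add[OF assms(1)]) auto
    ultimately show ?thesis using lt by simp
  qed
qed simp

text \<open>Each of the four sides is seen from the origin under an angle between \<open>0\<close> and \<open>pi\<close>,
  so the total angle is a multiple of \<open>2 * pi\<close> strictly between \<open>0\<close> and \<open>4 * pi\<close>.\<close>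

lemma rect_bd_ang_linear:
  fixes x y :: "nat \<Rightarrow> real" and A C :: complex
  assumes x: "strict_mono x" "x i1 < 0" "0 < x i2"
    and y: "strict_mono y" "y j1 < 0" "0 < y j2"
    and D: "Im (cnj A * C) \<noteq> 0"
  defines "L \<equiv> \<lambda>i j. x i *\<^sub>R A + y j *\<^sub>R C"
  shows "rect_bd (\<lambda>i j. ang (L i j) (L (Suc i) j)) (\<lambda>i j. ang (L i j) (L i (Suc j))) i1 i2 j1 j2
    = 2 * pi * sgn (Im (cnj A * C))"
proof -
  define D where "D = Im (cnj A * C)"
  define \<sigma> where "\<sigma> = sgn D"
  have \<sigma>: "\<sigma> = 1 \<or> \<sigma> = -1" "- \<sigma> = 1 \<or> - \<sigma> = -1" and \<sigma>D: "\<sigma> * D > 0"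
    using D by (auto simp: \<sigma>_def D_def sgn_if)
  have i: "i1 < i2" using x by (meson less_trans strict_mono_less)
  have j: "j1 < j2" using y by (meson less_trans strict_mono_less)
  have h: "Im (L i' j * cnj (L i j)) = - y j * (x i' - x i) * D" for i i' j
    by (simp add: L_def D_def algebra_simps)
  have v: "Im (L i j' * cnj (L i j)) = x i * (y j' - y j) * D" for i j j'
    by (simp add: L_def D_def algebra_simps)
  have dx: "x i' - x i > 0" if "i < i'" for i i' using that x(1) by (simp add: strict_mono_less)
  have dy: "y i' - y i > 0" if "i < i'" for i i' using that y(1) by (simp add: strict_mono_less)
  \<comment> \<open>The bottom and right sides turn in the sense \<open>\<sigma>\<close>, the top
    and left sides in the sense \<open>- \<sigma>\<close>. The latter two are subtracted in the
    boundary, so all four contributions have the sign of \<open>\<sigma>\<close>.\<close>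
  have s1: "0 < \<sigma> * Im (L i' j1 * cnj (L i j1))" if "i < i'" for i i'
  proof -
    have "0 < (- y j1) * (x i' - x i) * (\<sigma> * D)" using dx[OF that] y(2) \<sigma>D by (intro mult_pos_pos[OF mult_pos_pos]) (simp_all only: neg_0_less_iff_less)
    then show ?thesis unfolding h by (simp add: mult_ac)
  qed
  have s2: "0 < \<sigma> * Im (L i2 j' * cnj (L i2 j))" if "j < j'" for j j'
  proof -
    have "0 < x i2 * (y j' - y j) * (\<sigma> * D)" using dy[OF that] x(3) \<sigma>D by (intro mult_pos_pos[OF mult_pos_pos]) (simp_all only: neg_0_less_iff_less)
    then show ?thesis unfolding v by (simp add: mult_ac)
  qed
  have s3: "0 < (- \<sigma>) * Im (L i' j2 * cnj (L i j2))" if "i < i'" for i i'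
  proof -
    have "0 < y j2 * (x i' - x i) * (\<sigma> * D)" using dx[OF that] y(3) \<sigma>D by (intro mult_pos_pos[OF mult_pos_pos]) (simp_all only: neg_0_less_iff_less)
    then show ?thesis unfolding h by (simp add: mult_ac)
  qed
  have s4: "0 < (- \<sigma>) * Im (L i1 j' * cnj (L i1 j))" if "j < j'" for j j'
  proof -
    have "0 < (- x i1) * (y j' - y j) * (\<sigma> * D)" using dy[OF that] x(2) \<sigma>D by (intro mult_pos_pos[OF mult_pos_pos]) (simp_all only: neg_0_less_iff_less)
    then show ?thesis unfolding v by (simp add: mult_ac)
  qed
  let ?S = "rect_bd (\<lambda>i j. ang (L i j) (L (Suc i) j)) (\<lambda>i j. ang (L i j) (L i (Suc j))) i1 i2 j1 j2"
  let ?a = "ang (L i1 j1) (L i2 j1)" and ?b = "ang (L i2 j1) (L i2 j2)"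
    and ?c = "ang (L i1 j2) (L i2 j2)" and ?d = "ang (L i1 j1) (L i1 j2)"
  have S: "?S = ?a + ?b - ?c - ?d"
    unfolding rect_bd_def
    using sum_ang_side[OF \<sigma>(1) i, of "\<lambda>i. L i j1"] sum_ang_side[OF \<sigma>(2) i, of "\<lambda>i. L i j2"]
      sum_ang_side[OF \<sigma>(1) j, of "\<lambda>j. L i2 j"] sum_ang_side[OF \<sigma>(2) j, of "\<lambda>j. L i1 j"] s1 s2 s3 s4
    by simp
  have nz: "L i1 j1 \<noteq> 0" "L i2 j1 \<noteq> 0" "L i1 j2 \<noteq> 0" "L i2 j2 \<noteq> 0"
    using Im_sign_nonzero[OF s1[OF i]] Im_sign_nonzero[OF s3[OF i]] by auto
  have "cis (?a + ?b) = cis (?d + ?c)"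
    using cis_ang_add[OF nz(1,2,4)] cis_ang_add[OF nz(1,3,4)] by simp
  then have "cis (?a + ?b - (?d + ?c)) = 1"
    by (subst cis_divide[symmetric]) auto
  then have "cis ?S = 1" by (simp add: S algebra_simps)
  then obtain k :: int where k: "?S = 2 * pi * k" by (rule cis_eq_1_int)
  have "0 < \<sigma> * ?S" "\<sigma> * ?S < 4 * pi"
    using ang_sign[OF \<sigma>(1) s1[OF i]] ang_sign[OF \<sigma>(1) s2[OF j]]
      ang_sign[OF \<sigma>(2) s3[OF i]] ang_sign[OF \<sigma>(2) s4[OF j]]
    unfolding S by (auto simp: algebra_simps)
  then have "0 < (2 * pi) * (\<sigma> * k)" "(2 * pi) * (\<sigma> * k) < (2 * pi) * 2"
    unfolding k by (simp_all add: algebra_simps)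
  then have "0 < \<sigma> * k" "\<sigma> * k < 2"
    by (simp_all only: zero_less_mult_iff mult_less_cancel_left_pos pi_gt_zero) auto
  have "k = \<sigma>" using \<sigma>(1)
  proof
    assume "\<sigma> = 1"
    then show ?thesis using \<open>0 < \<sigma> * k\<close> \<open>\<sigma> * k < 2\<close> by auto
  next
    assume m: "\<sigma> = -1"
    then have "of_int (- 2) < real_of_int k" "k < 0" using \<open>0 < \<sigma> * k\<close> \<open>\<sigma> * k < 2\<close> by auto
    then have "k = -1" by (simp only: of_int_less_iff)
    then show ?thesis using m by simp
  qed
  then show ?thesis using k by (simp add: \<sigma>_def D_def)
qed

text \<open>A discrete Rouche theorem: the angle \<open>\<beta>\<close> from the model
  \<open>L\<close> to \<open>p\<close> is small and single-valued on the frame, so the differences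
  that it adds along the four sides cancel at the corners.\<close>

lemma rect_bd_ang_perturb:
  fixes p L :: "nat \<Rightarrow> nat \<Rightarrow> complex"
  assumes le: "i1 \<le> i2" "j1 \<le> j2"
    and near: "\<And>i j. i \<in> {i1..i2} \<Longrightarrow> j \<in> {j1..j2} \<Longrightarrow> i \<in> {i1, i2} \<or> j \<in> {j1, j2} \<Longrightarrow>
      narrow (p i j * cnj (L i j))"
    and hor: "\<And>i j. i \<in> {i1..<i2} \<Longrightarrow> j \<in> {j1, j2} \<Longrightarrow> narrow (p (Suc i) j * cnj (p i j))"
    and ver: "\<And>i j. i \<in> {i1, i2} \<Longrightarrow> j \<in> {j1..<j2} \<Longrightarrow> narrow (p i (Suc j) * cnj (p i j))"
  shows "rect_bd (\<lambda>i j. ang (p i j) (p (Suc i) j)) (\<lambda>i j. ang (p i j) (p i (Suc j))) i1 i2 j1 j2 =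
    rect_bd (\<lambda>i j. ang (L i j) (L (Suc i) j)) (\<lambda>i j. ang (L i j) (L i (Suc j))) i1 i2 j1 j2"
proof -
  define \<beta> where "\<beta> i j = Arg (p i j * cnj (L i j))" for i j
  have edge: "ang z z' = ang l l' + (Arg (z' * cnj l') - Arg (z * cnj l))"
    if n: "narrow (z' * cnj z)" "narrow (z * cnj l)" "narrow (z' * cnj l')" for z z' l l'
  proof (rule eq_if_cis_eq)
    have nz: "z \<noteq> 0" "z' \<noteq> 0" "l \<noteq> 0" "l' \<noteq> 0" using n[THEN narrow_nonzero] by auto
    have "cis (ang z z' + ang l z) = cis (ang l z')"
      using cis_ang_add[of l z z'] nz by (simp add: add.commute)
    moreover have "cis (ang l l' + ang l' z') = cis (ang l z')"
      using nz by (simp add: cis_ang_add)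
    ultimately have "cis (ang z z') * cis (ang l z) = cis (ang l l') * cis (ang l' z')"
      by (simp add: cis_mult)
    then have "cis (ang z z') = cis (ang l l') * cis (ang l' z') / cis (ang l z)"
      by (simp add: field_simps)
    then show "cis (ang z z') = cis (ang l l' + (Arg (z' * cnj l') - Arg (z * cnj l)))"
      by (simp add: ang_def cis_mult cis_divide algebra_simps)
    \<comment> \<open>The model angle is only known to be at most pi. The other three are narrow and
      add less than 3 * pi / 4, which keeps the total below 2 * pi.\<close>
    have "\<bar>ang l l'\<bar> \<le> pi"
      using Arg_bounded[of "l' * cnj l"] by (auto simp: ang_def)
    then show "\<bar>ang z z' - (ang l l' + (Arg (z' * cnj l') - Arg (z * cnj l)))\<bar> < 2 * pi"
      using n[THEN narrow_Arg] unfolding ang_def by linarith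
  qed
  have h: "(\<Sum>i\<in>{i1..<i2}. ang (p i j) (p (Suc i) j)) =
      (\<Sum>i\<in>{i1..<i2}. ang (L i j) (L (Suc i) j)) + (\<beta> i2 j - \<beta> i1 j)" if j: "j \<in> {j1, j2}" for j
  proof -
    have "(\<Sum>i\<in>{i1..<i2}. ang (p i j) (p (Suc i) j)) =
        (\<Sum>i\<in>{i1..<i2}. ang (L i j) (L (Suc i) j) + (\<beta> (Suc i) j - \<beta> i j))"
      unfolding \<beta>_def using j le by (intro sum.cong refl edge hor near) auto
    then show ?thesis using sum_Suc_diff'[OF le(1), of "\<lambda>i. \<beta> i j"] by (simp add: sum.distrib)
  qed
  have v: "(\<Sum>j\<in>{j1..<j2}. ang (p i j) (p i (Suc j))) =
      (\<Sum>j\<in>{j1..<j2}. ang (L i j) (L i (Suc j))) + (\<beta> i j2 - \<beta> i j1)" if i: "i \<in> {i1, i2}" for i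
  proof -
    have "(\<Sum>j\<in>{j1..<j2}. ang (p i j) (p i (Suc j))) =
        (\<Sum>j\<in>{j1..<j2}. ang (L i j) (L i (Suc j)) + (\<beta> i (Suc j) - \<beta> i j))"
      unfolding \<beta>_def using i le by (intro sum.cong refl edge ver near) auto
    then show ?thesis using sum_Suc_diff'[OF le(2), of "\<lambda>j. \<beta> i j"] by (simp add: sum.distrib)
  qed
  show ?thesis unfolding rect_bd_def by (simp add: h v)
qed

text \<open>\<open>q * cnj p\<close> lies within a third of \<open>(cmod p)^2\<close> from
  \<open>(cmod p)^2\<close> itself; a third leaves room for the factor 2 in
  \<open>narrow_near_real\<close>.\<close>

lemma narrow_step:
  assumes "cmod p \<ge> m" "cmod (q - p) < m / 3"
  shows "narrow (q * cnj p)"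
proof (rule narrow_near_real)
  have p: "cmod p > 0" using assms norm_ge_zero[of "q - p"] by linarith
  have "q * cnj p - of_real ((cmod p)\<^sup>2) = (q - p) * cnj p"
    by (simp only: complex_norm_square) (simp add: algebra_simps)
  then have "cmod (q * cnj p - of_real ((cmod p)\<^sup>2)) = cmod (q - p) * cmod p" by (simp add: norm_mult)
  also have "\<dots> \<le> (cmod p / 3) * cmod p"
    using assms p by (intro mult_right_mono) auto
  finally show "cmod (q * cnj p - of_real ((cmod p)\<^sup>2)) \<le> (cmod p)\<^sup>2 / 3" by (simp add: power2_eq_square)
  show "2 * ((cmod p)\<^sup>2 / 3) < (cmod p)\<^sup>2" using p by simp
qed

lemma narrow_near:
  assumes "l \<noteq> 0" "cmod (p - l) \<le> cmod l / 4"
  shows "narrow (p * cnj l)"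
  using assms zero_less_norm_iff[of l] by (intro narrow_step[of "cmod l"]) linarith+

section \<open>Localization at the zeros of a difference of two plane curves\<close>

text \<open>The box around a zero is rounded outward to the grid. It thus covers the square of
  radius \<open>\<eta>\<close> and, once \<open>1 / n < \<eta>\<close>, stays within radius
  \<open>2 * \<eta>\<close>. In the uses below \<open>nat\<close> is applied to nonnegative
  numbers.\<close>

definition grid_lo :: "nat \<Rightarrow> real \<Rightarrow> real \<Rightarrow> nat" where
  "grid_lo n \<eta> s = nat \<lfloor>n * (s - \<eta>)\<rfloor>"

definition grid_hi :: "nat \<Rightarrow> real \<Rightarrow> real \<Rightarrow> nat" where
  "grid_hi n \<eta> s = nat \<lceil>n * (s + \<eta>)\<rceil>"

lemma grid_lo_bounds:
  assumes "n > 0" "0 \<le> s - \<eta>"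
  shows "grid_lo n \<eta> s / n \<le> s - \<eta>" "s - \<eta> - 1 / n < grid_lo n \<eta> s / n"
proof -
  have "real (grid_lo n \<eta> s) = of_int \<lfloor>n * (s - \<eta>)\<rfloor>"
    using assms by (simp add: grid_lo_def)
  then have "real (grid_lo n \<eta> s) \<le> n * (s - \<eta>)" "n * (s - \<eta>) < real (grid_lo n \<eta> s) + 1"
    by linarith+
  then have "grid_lo n \<eta> s / n \<le> s - \<eta>" "s - \<eta> < (grid_lo n \<eta> s + 1) / n"
    using assms(1) by (simp_all add: field_simps)
  then show "grid_lo n \<eta> s / n \<le> s - \<eta>" "s - \<eta> - 1 / n < grid_lo n \<eta> s / n"
    by (simp_all add: add_divide_distrib)
qed

lemma grid_hi_bounds:
  assumes "n > 0" "0 \<le> s + \<eta>"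
  shows "s + \<eta> \<le> grid_hi n \<eta> s / n" "grid_hi n \<eta> s / n < s + \<eta> + 1 / n"
proof -
  have "0 \<le> n * (s + \<eta>)" using assms by simp
  then have "0 \<le> \<lceil>n * (s + \<eta>)\<rceil>" by linarith
  then have "real (grid_hi n \<eta> s) = of_int \<lceil>n * (s + \<eta>)\<rceil>"
    by (simp add: grid_hi_def)
  then have "n * (s + \<eta>) \<le> real (grid_hi n \<eta> s)" "real (grid_hi n \<eta> s) < n * (s + \<eta>) + 1"
    by linarith+
  then have "s + \<eta> \<le> grid_hi n \<eta> s / n" "(real (grid_hi n \<eta> s) - 1) / n < s + \<eta>"
    using assms(1) by (simp_all add: field_simps)
  then show "s + \<eta> \<le> grid_hi n \<eta> s / n" "grid_hi n \<eta> s / n < s + \<eta> + 1 / n"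
    by (simp_all add: diff_divide_distrib)
qed

lemma grid_hi_le: "s + \<eta> \<le> 1 \<Longrightarrow> grid_hi n \<eta> s \<le> n"
proof -
  assume "s + \<eta> \<le> 1"
  then have "n * (s + \<eta>) \<le> real n * 1" by (intro mult_left_mono) auto
  then show ?thesis by (simp add: grid_hi_def ceiling_le_iff nat_le_iff)
qed

text \<open>Cramer's rule: the cross products with \<open>A\<close> and \<open>C\<close> isolate the
  two coefficients.\<close>

lemma linear_lower_bound:
  fixes A C :: complex
  assumes "Im (cnj A * C) \<noteq> 0"
  obtains c where "c > 0" "\<And>x y. c * (\<bar>x\<bar> + \<bar>y\<bar>) \<le> cmod (x *\<^sub>R A + y *\<^sub>R C)"
proof
  let ?D = "\<bar>Im (cnj A * C)\<bar>" and ?s = "cmod A + cmod C"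
  have "A \<noteq> 0" using assms by auto
  then have s: "?s > 0" by (simp add: add_pos_nonneg)
  then show "?D / ?s > 0" using assms by simp
  fix x y :: real
  let ?L = "x *\<^sub>R A + y *\<^sub>R C"
  have "Im (cnj A * ?L) = y * Im (cnj A * C)" "Im (cnj C * ?L) = - x * Im (cnj A * C)"
    by (simp_all add: algebra_simps)
  then have "\<bar>y\<bar> * ?D = \<bar>Im (cnj A * ?L)\<bar>" "\<bar>x\<bar> * ?D = \<bar>Im (cnj C * ?L)\<bar>"
    by (simp_all only: abs_mult abs_minus_cancel)
  moreover have "\<bar>Im (cnj A * ?L)\<bar> \<le> cmod A * cmod ?L" "\<bar>Im (cnj C * ?L)\<bar> \<le> cmod C * cmod ?L"
    by (metis abs_Im_le_cmod norm_mult complex_mod_cnj)+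
  ultimately have "?D * (\<bar>x\<bar> + \<bar>y\<bar>) \<le> ?s * cmod ?L" by (simp add: algebra_simps)
  then show "?D / ?s * (\<bar>x\<bar> + \<bar>y\<bar>) \<le> cmod ?L"
    using s by (simp add: field_simps)
qed

text \<open>This supplies the hypothesis of \<open>narrow_near\<close> around a zero. Each curve may
  err by \<open>c / 4\<close> per unit of parameter, with \<open>c\<close> from the lower bound of
  the linear model, so the total error is at most a quarter of that model. Differentiability at the
  single parameters \<open>s0\<close> and \<open>t0\<close> is enough.\<close>

lemma diff_linear_approx:
  fixes a b :: "real \<Rightarrow> complex"
  assumes a: "(a has_vector_derivative A) (at s0)" and b: "(b has_vector_derivative B) (at t0)"
    and eq: "a s0 = b t0" and D: "Im (cnj A * B) \<noteq> 0"
  shows "\<forall>\<^sub>F \<eta> in at_right 0. \<forall>s t. \<bar>s - s0\<bar> < 2 * \<eta> \<and> \<bar>t - t0\<bar> < 2 * \<eta> \<and> (s, t) \<noteq> (s0, t0) \<longrightarrow>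
    (s - s0) *\<^sub>R A + (t - t0) *\<^sub>R (- B) \<noteq> 0 \<and>
    cmod (a s - b t - ((s - s0) *\<^sub>R A + (t - t0) *\<^sub>R (- B)))
      \<le> cmod ((s - s0) *\<^sub>R A + (t - t0) *\<^sub>R (- B)) / 4"
proof -
  obtain c where c: "c > 0" "\<And>x y. c * (\<bar>x\<bar> + \<bar>y\<bar>) \<le> cmod (x *\<^sub>R A + y *\<^sub>R (- B))"
    using linear_lower_bound[of A "- B"] D by auto
  have approx: "\<exists>d>0. \<forall>s. \<bar>s - s0\<bar> < d \<longrightarrow> cmod (a s - a s0 - (s - s0) *\<^sub>R A) \<le> c / 4 * \<bar>s - s0\<bar>"
    if "(a has_vector_derivative A) (at s0)" for a :: "real \<Rightarrow> complex" and A s0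
    using that c(1) unfolding has_vector_derivative_def has_derivative_at_alt
    by (metis real_norm_def zero_less_divide_iff zero_less_numeral)
  obtain d1 where d1: "d1 > 0"
    "\<And>s. \<bar>s - s0\<bar> < d1 \<Longrightarrow> cmod (a s - a s0 - (s - s0) *\<^sub>R A) \<le> c / 4 * \<bar>s - s0\<bar>"
    using approx[OF a] by blast
  obtain d2 where d2: "d2 > 0"
    "\<And>t. \<bar>t - t0\<bar> < d2 \<Longrightarrow> cmod (b t - b t0 - (t - t0) *\<^sub>R B) \<le> c / 4 * \<bar>t - t0\<bar>"
    using approx[OF b] by blast
  have "\<forall>\<^sub>F \<eta> in at_right (0::real). \<eta> < min d1 d2 / 2"
    using d1(1) d2(1) by (intro eventually_at_right_less order_tendstoD) (auto intro: tendsto_eq_intros)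
  then show ?thesis
  proof eventually_elim
    case (elim \<eta>)
    show ?case
    proof (intro allI impI, elim conjE)
      fix s t assume st: "\<bar>s - s0\<bar> < 2 * \<eta>" "\<bar>t - t0\<bar> < 2 * \<eta>" "(s, t) \<noteq> (s0, t0)"
      let ?L = "(s - s0) *\<^sub>R A + (t - t0) *\<^sub>R (- B)"
      have "0 < c * (\<bar>s - s0\<bar> + \<bar>t - t0\<bar>)" using st(3) c(1) by (intro mult_pos_pos) auto
      then have "?L \<noteq> 0" using c(2)[of "s - s0" "t - t0"] by (metis leD norm_zero)
      moreover have "cmod (a s - b t - ?L) \<le> cmod ?L / 4"
      proof -
        have "a s - b t - ?L = (a s - a s0 - (s - s0) *\<^sub>R A) - (b t - b t0 - (t - t0) *\<^sub>R B)"
          using eq by simp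
        also have "cmod \<dots> \<le> c / 4 * \<bar>s - s0\<bar> + c / 4 * \<bar>t - t0\<bar>"
          using st elim
          by (intro order_trans[OF norm_triangle_ineq4] add_mono d1(2) d2(2)) auto
        also have "\<dots> \<le> cmod ?L / 4" using c(2)[of "s - s0" "t - t0"] by (simp add: algebra_simps)
        finally show ?thesis .
      qed
      ultimately show "?L \<noteq> 0 \<and> cmod (a s - b t - ?L) \<le> cmod ?L / 4" ..
    qed
  qed
qed

lemma at_right_0_less: "(c::real) > 0 \<Longrightarrow> \<forall>\<^sub>F \<eta> in at_right 0. \<eta> < c"
  by (auto simp: eventually_at_right_field)

lemma uniform_step:
  fixes a :: "real \<Rightarrow> 'a::real_normed_vector"
  assumes "continuous_on {0..1} a" "\<epsilon> > 0"
  shows "\<forall>\<^sub>F n in sequentially. \<forall>s\<in>{0..1}. \<forall>s'\<in>{0..1}. \<bar>s - s'\<bar> \<le> 1 / real n \<longrightarrow> norm (a s - a s') < \<epsilon>"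
proof -
  have "uniformly_continuous_on {0..1} a"
    using assms(1) by (intro compact_uniformly_continuous) auto
  then obtain d where d: "d > 0" "\<And>s s'. s \<in> {0..1} \<Longrightarrow> s' \<in> {0..1} \<Longrightarrow> dist s s' < d \<Longrightarrow> dist (a s) (a s') < \<epsilon>"
    unfolding uniformly_continuous_on_def using assms(2) by metis
  have "\<forall>\<^sub>F n in sequentially. 1 / real n < d"
    using d(1) by (intro order_tendstoD(2)[OF lim_1_over_n])
  then show ?thesis
    by eventually_elim (use d(2) in \<open>force simp: dist_norm\<close>)
qed

text \<open>To be read as the map sending \<open>(s, t)\<close> to \<open>a s - b t\<close> on the
  unit square, whose zeros \<open>Z\<close> are interior and nondegenerate. For two disjoint edges
  of the projected graph these are the crossings.\<close>

locale curve_pair =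
  fixes a b A B :: "real \<Rightarrow> complex" and Z :: "(real \<times> real) set"
  assumes cont_a: "continuous_on {0..1} a" and cont_b: "continuous_on {0..1} b"
    and finite_Z: "finite Z"
    and zero_iff: "s \<in> {0..1} \<Longrightarrow> t \<in> {0..1} \<Longrightarrow> a s = b t \<longleftrightarrow> (s, t) \<in> Z"
    and interior: "(s, t) \<in> Z \<Longrightarrow> s \<in> {0<..<1} \<and> t \<in> {0<..<1}"
    and deriv_a: "(s, t) \<in> Z \<Longrightarrow> (a has_vector_derivative A s) (at s)"
    and deriv_b: "(s, t) \<in> Z \<Longrightarrow> (b has_vector_derivative B t) (at t)"
    and nondegenerate: "(s, t) \<in> Z \<Longrightarrow> Im (cnj (A s) * B t) \<noteq> 0"
begin

definition W :: "nat \<Rightarrow> nat \<Rightarrow> nat \<Rightarrow> complex" where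
  "W n i j = a (i / n) - b (j / n)"

definition hang :: "nat \<Rightarrow> nat \<Rightarrow> nat \<Rightarrow> real" where
  "hang n i j = ang (W n i j) (W n (Suc i) j)"

definition vang :: "nat \<Rightarrow> nat \<Rightarrow> nat \<Rightarrow> real" where
  "vang n i j = ang (W n i j) (W n i (Suc j))"

definition box_bd ::
    "nat \<Rightarrow> real \<Rightarrow> (nat \<Rightarrow> nat \<Rightarrow> real) \<Rightarrow> (nat \<Rightarrow> nat \<Rightarrow> real) \<Rightarrow> real \<times> real \<Rightarrow> real" where
  "box_bd n \<eta> h v k = rect_bd h v (grid_lo n \<eta> (fst k)) (grid_hi n \<eta> (fst k))
    (grid_lo n \<eta> (snd k)) (grid_hi n \<eta> (snd k))"

definition grid_box :: "nat \<Rightarrow> real \<Rightarrow> real \<times> real \<Rightarrow> (nat \<times> nat) set" where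
  "grid_box n \<eta> k = rect (grid_lo n \<eta> (fst k)) (grid_hi n \<eta> (fst k))
    (grid_lo n \<eta> (snd k)) (grid_hi n \<eta> (snd k))"

definition on_frame :: "nat \<Rightarrow> real \<Rightarrow> real \<times> real \<Rightarrow> nat \<Rightarrow> nat \<Rightarrow> bool" where
  "on_frame n \<eta> k i j \<longleftrightarrow>
    i \<in> {grid_lo n \<eta> (fst k)..grid_hi n \<eta> (fst k)} \<and> j \<in> {grid_lo n \<eta> (snd k)..grid_hi n \<eta> (snd k)} \<and>
    (i \<in> {grid_lo n \<eta> (fst k), grid_hi n \<eta> (fst k)} \<or> j \<in> {grid_lo n \<eta> (snd k), grid_hi n \<eta> (snd k)})"

text \<open>Rounded boxes reach less than \<open>2 * \<eta>\<close> from their zero. Hence the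
  factor 2 in the margins and in the linear approximation, and the separation
  \<open>4 * \<eta>\<close>, which keeps different boxes disjoint.\<close>

definition isolating :: "real \<Rightarrow> real \<Rightarrow> bool" where
  "isolating \<rho> \<eta> \<longleftrightarrow> 0 < \<eta> \<and> 2 * \<eta> < \<rho> \<and>
    (\<forall>(s0, t0)\<in>Z. 2 * \<eta> < s0 \<and> s0 + 2 * \<eta> < 1 \<and> 2 * \<eta> < t0 \<and> t0 + 2 * \<eta> < 1 \<and>
      (\<forall>(s, t)\<in>Z. (s, t) \<noteq> (s0, t0) \<longrightarrow> 4 * \<eta> < max \<bar>s - s0\<bar> \<bar>t - t0\<bar>) \<and>
      (\<forall>s t. \<bar>s - s0\<bar> < 2 * \<eta> \<and> \<bar>t - t0\<bar> < 2 * \<eta> \<and> (s, t) \<noteq> (s0, t0) \<longrightarrow>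
        (s - s0) *\<^sub>R A s0 + (t - t0) *\<^sub>R (- B t0) \<noteq> 0 \<and>
        cmod (a s - b t - ((s - s0) *\<^sub>R A s0 + (t - t0) *\<^sub>R (- B t0)))
          \<le> cmod ((s - s0) *\<^sub>R A s0 + (t - t0) *\<^sub>R (- B t0)) / 4))"

lemma eventually_isolating:
  assumes "\<rho> > 0"
  shows "\<forall>\<^sub>F \<eta> in at_right 0. isolating \<rho> \<eta>"
proof -
  have "\<forall>\<^sub>F \<eta> in at_right 0. \<forall>k\<in>Z. case k of (s0, t0) \<Rightarrow>
      (2 * \<eta> < s0 \<and> s0 + 2 * \<eta> < 1 \<and> 2 * \<eta> < t0 \<and> t0 + 2 * \<eta> < 1) \<and>
      (\<forall>l\<in>Z. case l of (s, t) \<Rightarrow> (s, t) \<noteq> (s0, t0) \<longrightarrow> 4 * \<eta> < max \<bar>s - s0\<bar> \<bar>t - t0\<bar>) \<and>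
      (\<forall>s t. \<bar>s - s0\<bar> < 2 * \<eta> \<and> \<bar>t - t0\<bar> < 2 * \<eta> \<and> (s, t) \<noteq> (s0, t0) \<longrightarrow>
        (s - s0) *\<^sub>R A s0 + (t - t0) *\<^sub>R (- B t0) \<noteq> 0 \<and>
        cmod (a s - b t - ((s - s0) *\<^sub>R A s0 + (t - t0) *\<^sub>R (- B t0)))
          \<le> cmod ((s - s0) *\<^sub>R A s0 + (t - t0) *\<^sub>R (- B t0)) / 4)"
  proof (intro eventually_ball_finite[OF finite_Z] ballI, clarify, intro eventually_conj)
    fix s0 t0 assume k: "(s0, t0) \<in> Z"
    have i: "0 < s0" "s0 < 1" "0 < t0" "t0 < 1" using interior[OF k] by auto
    show "\<forall>\<^sub>F \<eta> in at_right 0. 2 * \<eta> < s0"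
      using at_right_0_less[of "s0 / 2"] i by (auto elim!: eventually_mono)
    show "\<forall>\<^sub>F \<eta> in at_right 0. s0 + 2 * \<eta> < 1"
      using at_right_0_less[of "(1 - s0) / 2"] i by (auto elim!: eventually_mono)
    show "\<forall>\<^sub>F \<eta> in at_right 0. 2 * \<eta> < t0"
      using at_right_0_less[of "t0 / 2"] i by (auto elim!: eventually_mono)
    show "\<forall>\<^sub>F \<eta> in at_right 0. t0 + 2 * \<eta> < 1"
      using at_right_0_less[of "(1 - t0) / 2"] i by (auto elim!: eventually_mono)
    show "\<forall>\<^sub>F \<eta> in at_right 0. \<forall>l\<in>Z. case l of (s, t) \<Rightarrow> (s, t) \<noteq> (s0, t0) \<longrightarrow> 4 * \<eta> < max \<bar>s - s0\<bar> \<bar>t - t0\<bar>"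
    proof (intro eventually_ball_finite[OF finite_Z] ballI, clarify)
      fix s t assume "(s, t) \<in> Z"
      show "\<forall>\<^sub>F \<eta> in at_right 0. (s, t) \<noteq> (s0, t0) \<longrightarrow> 4 * \<eta> < max \<bar>s - s0\<bar> \<bar>t - t0\<bar>"
      proof (cases "(s, t) = (s0, t0)")
        case False
        then have "0 < max \<bar>s - s0\<bar> \<bar>t - t0\<bar> / 4" by auto
        from at_right_0_less[OF this] show ?thesis by eventually_elim auto
      qed simp
    qed
    show "\<forall>\<^sub>F \<eta> in at_right 0. \<forall>s t. \<bar>s - s0\<bar> < 2 * \<eta> \<and> \<bar>t - t0\<bar> < 2 * \<eta> \<and> (s, t) \<noteq> (s0, t0) \<longrightarrow>
        (s - s0) *\<^sub>R A s0 + (t - t0) *\<^sub>R (- B t0) \<noteq> 0 \<and>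
        cmod (a s - b t - ((s - s0) *\<^sub>R A s0 + (t - t0) *\<^sub>R (- B t0)))
          \<le> cmod ((s - s0) *\<^sub>R A s0 + (t - t0) *\<^sub>R (- B t0)) / 4"
      using diff_linear_approx[OF deriv_a[OF k] deriv_b[OF k] _ nondegenerate[OF k]] zero_iff[of s0 t0] i k
      by auto
  qed
  moreover have "\<forall>\<^sub>F \<eta> in at_right 0. 2 * \<eta> < \<rho>"
    using at_right_0_less[of "\<rho> / 2"] assms by (auto elim!: eventually_mono)
  moreover have "\<forall>\<^sub>F \<eta> in at_right (0::real). 0 < \<eta>"
    by (auto simp: eventually_at_right_field intro: exI[of _ 1])
  ultimately show ?thesis
    by eventually_elim (simp add: isolating_def case_prod_beta)
qed

text \<open>The square without open neighbourhoods of the zeros is compact, so the distance of the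
  two curves attains a positive minimum there.\<close>

lemma lower_bound_off_zeros:
  assumes "\<eta> > 0"
  obtains m where "m > 0"
    "\<And>s t. s \<in> {0..1} \<Longrightarrow> t \<in> {0..1} \<Longrightarrow> (\<And>s0 t0. (s0, t0) \<in> Z \<Longrightarrow> \<eta> \<le> \<bar>s - s0\<bar> \<or> \<eta> \<le> \<bar>t - t0\<bar>) \<Longrightarrow>
      m \<le> cmod (a s - b t)"
proof -
  define K where "K = {0..1} \<times> {0..1} - (\<Union>k\<in>Z. ball (fst k) \<eta> \<times> ball (snd k) \<eta>)"
  have K: "compact K" unfolding K_def
    by (intro compact_diff compact_Times) (auto intro: open_Times)
  have KI: "(s, t) \<in> K" if "s \<in> {0..1}" "t \<in> {0..1}"
    "\<And>s0 t0. (s0, t0) \<in> Z \<Longrightarrow> \<eta> \<le> \<bar>s - s0\<bar> \<or> \<eta> \<le> \<bar>t - t0\<bar>" for s t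
    using that by (force simp: K_def dist_real_def abs_minus_commute)
  show ?thesis
  proof (cases "K = {}")
    case True
    then show ?thesis using KI that[of 1] by (metis empty_iff zero_less_one)
  next
    case False
    have cont: "continuous_on K (\<lambda>p. cmod (a (fst p) - b (snd p)))"
      by (intro continuous_intros continuous_on_compose2[OF cont_a] continuous_on_compose2[OF cont_b])
        (auto simp: K_def)
    obtain p where p: "p \<in> K" "\<And>q. q \<in> K \<Longrightarrow> cmod (a (fst p) - b (snd p)) \<le> cmod (a (fst q) - b (snd q))"
      using continuous_attains_inf[OF K False cont] by blast
    obtain s t where st: "p = (s, t)" by (cases p)
    have "(s, t) \<notin> Z" "s \<in> {0..1}" "t \<in> {0..1}"
      using p(1) assms by (auto simp: K_def st)
    then have "cmod (a s - b t) > 0" using zero_iff[of s t] by simp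
    then show ?thesis using that[of "cmod (a s - b t)"] p(2) KI by (force simp: st)
  qed
qed

text \<open>The grid facts shared by the planar count and the count on the sphere. \<open>m\<close>
  bounds the difference from below off the boxes and on their frames; \<open>\<rho>\<close> keeps
  the boxes so close to the zeros that the direction map hardly varies on them. The last clause is
  the local winding number, negative because the derivative of \<open>a s - b t\<close> in
  \<open>t\<close> is \<open>- B t\<close>.\<close>

definition localized :: "nat \<Rightarrow> real \<Rightarrow> real \<Rightarrow> real \<Rightarrow> bool" where
  "localized n \<eta> m \<rho> \<longleftrightarrow>
    (\<forall>k\<in>Z. grid_lo n \<eta> (fst k) \<le> grid_hi n \<eta> (fst k) \<and> grid_lo n \<eta> (snd k) \<le> grid_hi n \<eta> (snd k) \<and>
      grid_hi n \<eta> (fst k) \<le> n \<and> grid_hi n \<eta> (snd k) \<le> n) \<and>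
    (\<forall>k\<in>Z. grid_box n \<eta> k \<subseteq> {..<n} \<times> {..<n}) \<and>
    (\<forall>k\<in>Z. \<forall>l\<in>Z. k \<noteq> l \<longrightarrow> grid_box n \<eta> k \<inter> grid_box n \<eta> l = {}) \<and>
    (\<forall>i<n. \<forall>j<n. (\<forall>k\<in>Z. (i, j) \<notin> grid_box n \<eta> k) \<longrightarrow>
      (\<forall>i'\<in>{i, Suc i}. \<forall>j'\<in>{j, Suc j}. m \<le> cmod (W n i' j'))) \<and>
    (\<forall>k\<in>Z. \<forall>i j. (i, j) \<in> grid_box n \<eta> k \<longrightarrow>
      (\<forall>i'\<in>{i, Suc i}. \<forall>j'\<in>{j, Suc j}. \<bar>i' / n - fst k\<bar> < \<rho> \<and> \<bar>j' / n - snd k\<bar> < \<rho>)) \<and>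
    (\<forall>k\<in>Z. \<forall>i j. on_frame n \<eta> k i j \<longrightarrow>
      m \<le> cmod (W n i j) \<and> \<bar>i / n - fst k\<bar> < \<rho> \<and> \<bar>j / n - snd k\<bar> < \<rho>) \<and>
    (\<forall>k\<in>Z. box_bd n \<eta> (hang n) (vang n) k = - 2 * pi * sgn (Im (cnj (A (fst k)) * B (snd k))))"

lemma localizedI:
  assumes iso: "isolating \<rho> \<eta>" and m: "m > 0"
    and off: "\<And>s t. s \<in> {0..1} \<Longrightarrow> t \<in> {0..1} \<Longrightarrow>
      (\<And>s0 t0. (s0, t0) \<in> Z \<Longrightarrow> \<eta> \<le> \<bar>s - s0\<bar> \<or> \<eta> \<le> \<bar>t - t0\<bar>) \<Longrightarrow> m \<le> cmod (a s - b t)"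
    and n: "n > 0" "1 / n < \<eta>"
    and stepa: "\<forall>s\<in>{0..1}. \<forall>s'\<in>{0..1}. \<bar>s - s'\<bar> \<le> 1 / real n \<longrightarrow> cmod (a s - a s') < m / 3"
    and stepb: "\<forall>s\<in>{0..1}. \<forall>s'\<in>{0..1}. \<bar>s - s'\<bar> \<le> 1 / real n \<longrightarrow> cmod (b s - b s') < m / 3"
  shows "localized n \<eta> m \<rho>"
proof -
  have \<eta>: "0 < \<eta>" "2 * \<eta> < \<rho>" using iso by (simp_all add: isolating_def)
  note all = conjunct2[OF conjunct2[OF iso[unfolded isolating_def]]]
  define lo where "lo = grid_lo n \<eta>"
  define hi where "hi = grid_hi n \<eta>"
  have margin: "2 * \<eta> < s" "s + 2 * \<eta> < 1" "2 * \<eta> < t" "t + 2 * \<eta> < 1" if "(s, t) \<in> Z" for s t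
  proof -
    have "2 * \<eta> < s \<and> s + 2 * \<eta> < 1 \<and> 2 * \<eta> < t \<and> t + 2 * \<eta> < 1"
      using bspec[OF all that] unfolding prod.case by (elim conjE) (intro conjI)
    then show "2 * \<eta> < s" "s + 2 * \<eta> < 1" "2 * \<eta> < t" "t + 2 * \<eta> < 1" by simp_all
  qed
  have sep: "4 * \<eta> < max \<bar>s' - s\<bar> \<bar>t' - t\<bar>" if "(s, t) \<in> Z" "(s', t') \<in> Z" "(s', t') \<noteq> (s, t)" for s t s' t'
  proof -
    have "\<forall>(s', t')\<in>Z. (s', t') \<noteq> (s, t) \<longrightarrow> 4 * \<eta> < max \<bar>s' - s\<bar> \<bar>t' - t\<bar>"
      using bspec[OF all that(1)] unfolding prod.case by (elim conjE)
    from bspec[OF this that(2)] show ?thesis using that(3) by simp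
  qed
  have approx: "(s' - s) *\<^sub>R A s + (t' - t) *\<^sub>R (- B t) \<noteq> 0 \<and>
      cmod (a s' - b t' - ((s' - s) *\<^sub>R A s + (t' - t) *\<^sub>R (- B t)))
        \<le> cmod ((s' - s) *\<^sub>R A s + (t' - t) *\<^sub>R (- B t)) / 4"
    if "(s, t) \<in> Z" "\<bar>s' - s\<bar> < 2 * \<eta>" "\<bar>t' - t\<bar> < 2 * \<eta>" "(s', t') \<noteq> (s, t)" for s t s' t'
  proof -
    have "\<forall>s' t'. \<bar>s' - s\<bar> < 2 * \<eta> \<and> \<bar>t' - t\<bar> < 2 * \<eta> \<and> (s', t') \<noteq> (s, t) \<longrightarrow>
        (s' - s) *\<^sub>R A s + (t' - t) *\<^sub>R (- B t) \<noteq> 0 \<and>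
        cmod (a s' - b t' - ((s' - s) *\<^sub>R A s + (t' - t) *\<^sub>R (- B t)))
          \<le> cmod ((s' - s) *\<^sub>R A s + (t' - t) *\<^sub>R (- B t)) / 4"
      using bspec[OF all that(1)] unfolding prod.case by (elim conjE)
    from this[rule_format, OF conjI, OF that(2) conjI, OF that(3,4)] show ?thesis .
  qed
  have lo: "lo s / n \<le> s - \<eta>" "s - 2 * \<eta> < lo s / n" if "2 * \<eta> < s" for s
  proof -
    have "0 \<le> s - \<eta>" using that \<eta> by linarith
    from grid_lo_bounds[OF n(1) this] n(2) show "lo s / n \<le> s - \<eta>" "s - 2 * \<eta> < lo s / n"
      unfolding lo_def by linarith+
  qed
  have hi: "s + \<eta> \<le> hi s / n" "hi s / n < s + 2 * \<eta>" if "2 * \<eta> < s" for s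
    using grid_hi_bounds[OF n(1), of s \<eta>] that \<eta> n by (auto simp: hi_def)
  have hin: "hi s \<le> n" if "s + 2 * \<eta> < 1" for s
    using grid_hi_le[of s \<eta> n] that \<eta> by (simp add: hi_def)
  have lohi: "lo s < hi s" if "2 * \<eta> < s" for s
  proof (rule ccontr)
    assume "\<not> lo s < hi s"
    then have "real (hi s) / n \<le> real (lo s) / n" by (simp add: divide_right_mono)
    with lo[OF that] hi[OF that] \<eta> show False by linarith
  qed
  have mono: "real i / n \<le> real i' / n" if "i \<le> i'" for i i' using that by (simp add: divide_right_mono)
  have unit: "real i / n \<in> {0..1}" if "i \<le> n" for i using that n by simp
  have near: "\<bar>i / n - s\<bar> < 2 * \<eta>" if "2 * \<eta> < s" "lo s \<le> i" "i \<le> hi s" for i s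
    using lo[OF that(1)] hi[OF that(1)] mono[OF that(2)] mono[OF that(3)] by linarith
  have far: "\<eta> \<le> \<bar>i / n - s\<bar>" if "2 * \<eta> < s" "i \<le> lo s \<or> hi s \<le> i" for i s
    using lo[OF that(1)] hi[OF that(1)] mono[of i "lo s"] mono[of "hi s" i] that(2) by linarith
  have box: "grid_box n \<eta> k = {lo (fst k)..<hi (fst k)} \<times> {lo (snd k)..<hi (snd k)}" for k
    by (simp add: grid_box_def rect_def lo_def hi_def)
  have 2: "\<forall>k\<in>Z. grid_box n \<eta> k \<subseteq> {..<n} \<times> {..<n}"
  proof (intro ballI subsetI)
    fix k p assume k: "k \<in> Z" and p: "p \<in> grid_box n \<eta> k"
    obtain s t where [simp]: "k = (s, t)" by (cases k)
    have "hi s \<le> n" "hi t \<le> n" using hin margin k by auto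
    then show "p \<in> {..<n} \<times> {..<n}" using p by (auto simp: box)
  qed
  have 3: "\<forall>k\<in>Z. \<forall>l\<in>Z. k \<noteq> l \<longrightarrow> grid_box n \<eta> k \<inter> grid_box n \<eta> l = {}"
  proof (intro ballI impI)
    fix k l assume kl: "k \<in> Z" "l \<in> Z" "k \<noteq> l"
    obtain s t s' t' where kl': "k = (s, t)" "l = (s', t')" by (cases k, cases l)
    show "grid_box n \<eta> k \<inter> grid_box n \<eta> l = {}"
    proof (rule ccontr)
      assume "grid_box n \<eta> k \<inter> grid_box n \<eta> l \<noteq> {}"
      then obtain i j where ij: "(i, j) \<in> grid_box n \<eta> k" "(i, j) \<in> grid_box n \<eta> l" by auto
      have "\<bar>i / n - s\<bar> < 2 * \<eta>" "\<bar>i / n - s'\<bar> < 2 * \<eta>" "\<bar>j / n - t\<bar> < 2 * \<eta>" "\<bar>j / n - t'\<bar> < 2 * \<eta>"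
        using ij margin kl by (auto simp: box kl' intro!: near)
      then have "max \<bar>s' - s\<bar> \<bar>t' - t\<bar> < 4 * \<eta>" by linarith
      moreover have "4 * \<eta> < max \<bar>s' - s\<bar> \<bar>t' - t\<bar>"
        using kl by (intro sep) (auto simp: kl')
      ultimately show False by linarith
    qed
  qed
  have 4: "m \<le> cmod (W n i' j')"
    if "i < n" "j < n" "\<forall>k\<in>Z. (i, j) \<notin> grid_box n \<eta> k" "i' \<in> {i, Suc i}" "j' \<in> {j, Suc j}" for i j i' j'
    unfolding W_def
  proof (rule off)
    show "real i' / n \<in> {0..1}" "real j' / n \<in> {0..1}" using that by (auto intro!: unit)
    fix s t assume st: "(s, t) \<in> Z"
    have "i < lo s \<or> hi s \<le> i \<or> j < lo t \<or> hi t \<le> j" using that(3) st by (force simp: box)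
    then have "i' \<le> lo s \<or> hi s \<le> i' \<or> j' \<le> lo t \<or> hi t \<le> j'" using that(4,5) by auto
    then show "\<eta> \<le> \<bar>i' / n - s\<bar> \<or> \<eta> \<le> \<bar>j' / n - t\<bar>" using far margin[OF st] by blast
  qed
  have 5: "\<bar>i' / n - fst k\<bar> < \<rho> \<and> \<bar>j' / n - snd k\<bar> < \<rho>"
    if "k \<in> Z" "(i, j) \<in> grid_box n \<eta> k" "i' \<in> {i, Suc i}" "j' \<in> {j, Suc j}" for i j i' j' k
  proof -
    obtain s t where k: "k = (s, t)" by (cases k)
    have "\<bar>i' / n - s\<bar> < 2 * \<eta>" "\<bar>j' / n - t\<bar> < 2 * \<eta>"
      using that margin by (auto simp: box k intro!: near)
    then show ?thesis using \<eta> k by auto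
  qed
  have frame: "on_frame n \<eta> (s, t) i j \<longleftrightarrow> i \<in> {lo s..hi s} \<and> j \<in> {lo t..hi t} \<and> (i \<in> {lo s, hi s} \<or> j \<in> {lo t, hi t})"
    for s t i j by (simp add: on_frame_def lo_def hi_def)
  have 6: "m \<le> cmod (W n i j)" "\<bar>i / n - s\<bar> < 2 * \<eta>" "\<bar>j / n - t\<bar> < 2 * \<eta>"
    if k: "(s, t) \<in> Z" and f: "on_frame n \<eta> (s, t) i j" for s t i j
  proof -
    show close: "\<bar>i / n - s\<bar> < 2 * \<eta>" "\<bar>j / n - t\<bar> < 2 * \<eta>"
      using f margin[OF k] unfolding frame by (auto intro!: near)
    show "m \<le> cmod (W n i j)" unfolding W_def
    proof (rule off)
      show "real i / n \<in> {0..1}" "real j / n \<in> {0..1}"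
      proof -
        have "i \<le> n" "j \<le> n" using f hin[OF margin(2)[OF k]] hin[OF margin(4)[OF k]]
          unfolding frame by auto
        then show "real i / n \<in> {0..1}" "real j / n \<in> {0..1}" by (auto intro!: unit[simplified])
      qed
      fix s' t' assume k': "(s', t') \<in> Z"
      show "\<eta> \<le> \<bar>i / n - s'\<bar> \<or> \<eta> \<le> \<bar>j / n - t'\<bar>"
      proof (cases "(s', t') = (s, t)")
        case True
        then show ?thesis using f margin[OF k] far unfolding frame by auto
      next
        case False
        then have "4 * \<eta> < max \<bar>s' - s\<bar> \<bar>t' - t\<bar>" using sep k k' by blast
        then show ?thesis using close \<eta> by linarith
      qed
    qed
  qed
  have 7: "box_bd n \<eta> (hang n) (vang n) (s, t) = - 2 * pi * sgn (Im (cnj (A s) * B t))"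
    if k: "(s, t) \<in> Z" for s t
  proof -
    define L where "L i j = (i / n - s) *\<^sub>R A s + (j / n - t) *\<^sub>R (- B t)" for i j :: nat
    have "box_bd n \<eta> (hang n) (vang n) (s, t) =
        rect_bd (\<lambda>i j. ang (W n i j) (W n (Suc i) j)) (\<lambda>i j. ang (W n i j) (W n i (Suc j))) (lo s) (hi s) (lo t) (hi t)"
      by (simp add: box_bd_def hang_def[abs_def] vang_def[abs_def] lo_def hi_def)
    also have "\<dots> = rect_bd (\<lambda>i j. ang (L i j) (L (Suc i) j)) (\<lambda>i j. ang (L i j) (L i (Suc j))) (lo s) (hi s) (lo t) (hi t)"
    proof (rule rect_bd_ang_perturb)
      show "lo s \<le> hi s" "lo t \<le> hi t" using lohi margin[OF k] by (auto intro: less_imp_le)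
      fix i j
      {
        assume "i \<in> {lo s..hi s}" "j \<in> {lo t..hi t}" "i \<in> {lo s, hi s} \<or> j \<in> {lo t, hi t}"
        then have f: "on_frame n \<eta> (s, t) i j" by (simp add: frame)
        have c: "\<bar>i / n - s\<bar> < 2 * \<eta>" "\<bar>j / n - t\<bar> < 2 * \<eta>" using 6[OF k f] by auto
        \<comment> \<open>The linear model vanishes only at the zero itself, and the bound
          \<open>m\<close> keeps the frame away from it.\<close>
        have "(i / n, j / n) \<noteq> (s, t)" using 6(1)[OF k f] m zero_iff[of s t] interior[OF k] k
          by (auto simp: W_def)
        with approx[OF k c] have "L i j \<noteq> 0 \<and> cmod (a (i / n) - b (j / n) - L i j) \<le> cmod (L i j) / 4"
          unfolding L_def by blast
        then show "narrow (W n i j * cnj (L i j))"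
          unfolding W_def by (intro narrow_near) auto
      }
      {
        assume i: "i \<in> {lo s..<hi s}" and j: "j \<in> {lo t, hi t}"
        have "on_frame n \<eta> (s, t) i j" using i j lohi[OF margin(1)[OF k]] lohi[OF margin(3)[OF k]] by (auto simp: frame)
        note m' = 6(1)[OF k this]
        have "i < n" using i hin margin[OF k] by fastforce
        then have "cmod (a (real (Suc i) / n) - a (i / n)) < m / 3"
          by (intro stepa[rule_format] unit) (auto simp: add_divide_distrib)
        then show "narrow (W n (Suc i) j * cnj (W n i j))"
          by (intro narrow_step[OF m']) (simp add: W_def)
      }
      {
        assume i: "i \<in> {lo s, hi s}" and j: "j \<in> {lo t..<hi t}"
        have "on_frame n \<eta> (s, t) i j" using i j lohi[OF margin(1)[OF k]] lohi[OF margin(3)[OF k]] by (auto simp: frame)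
        note m' = 6(1)[OF k this]
        have "j < n" using j hin margin[OF k] by fastforce
        then have "cmod (b (j / n) - b (real (Suc j) / n)) < m / 3"
          by (intro stepb[rule_format] unit) (auto simp: add_divide_distrib)
        then show "narrow (W n i (Suc j) * cnj (W n i j))"
          by (intro narrow_step[OF m']) (simp add: W_def)
      }
    qed
    also have "\<dots> = 2 * pi * sgn (Im (cnj (A s) * - B t))"
      unfolding L_def
    proof (rule rect_bd_ang_linear)
      show "strict_mono (\<lambda>i. real i / n - s)" "strict_mono (\<lambda>i. real i / n - t)"
        using n(1) by (auto intro!: strict_monoI simp: divide_strict_right_mono)
      show "real (lo s) / n - s < 0" "0 < real (hi s) / n - s" "real (lo t) / n - t < 0" "0 < real (hi t) / n - t"
        using lo hi margin[OF k] \<eta> by fastforce+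
      show "Im (cnj (A s) * - B t) \<noteq> 0" using nondegenerate[OF k] by simp
    qed
    also have "Im (cnj (A s) * - B t) = - Im (cnj (A s) * B t)" by simp
    finally show ?thesis by (simp only: sgn_minus mult_minus_left mult_minus_right)
  qed
  show ?thesis
    unfolding localized_def
  proof (intro conjI)
    show "\<forall>k\<in>Z. grid_lo n \<eta> (fst k) \<le> grid_hi n \<eta> (fst k) \<and> grid_lo n \<eta> (snd k) \<le> grid_hi n \<eta> (snd k) \<and>
      grid_hi n \<eta> (fst k) \<le> n \<and> grid_hi n \<eta> (snd k) \<le> n"
      using margin lohi hin by (auto simp: lo_def hi_def intro: less_imp_le)
    show "\<forall>i<n. \<forall>j<n. (\<forall>k\<in>Z. (i, j) \<notin> grid_box n \<eta> k) \<longrightarrow>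
      (\<forall>i'\<in>{i, Suc i}. \<forall>j'\<in>{j, Suc j}. m \<le> cmod (W n i' j'))"
      using 4 by blast
    show "\<forall>k\<in>Z. \<forall>i j. (i, j) \<in> grid_box n \<eta> k \<longrightarrow>
      (\<forall>i'\<in>{i, Suc i}. \<forall>j'\<in>{j, Suc j}. \<bar>i' / n - fst k\<bar> < \<rho> \<and> \<bar>j' / n - snd k\<bar> < \<rho>)"
      using 5 by blast
    show "\<forall>k\<in>Z. \<forall>i j. on_frame n \<eta> k i j \<longrightarrow>
      m \<le> cmod (W n i j) \<and> \<bar>i / n - fst k\<bar> < \<rho> \<and> \<bar>j / n - snd k\<bar> < \<rho>"
      using 6 \<eta> by fastforce
    show "\<forall>k\<in>Z. box_bd n \<eta> (hang n) (vang n) k = - 2 * pi * sgn (Im (cnj (A (fst k)) * B (snd k)))"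
      using 7 by auto
  qed (use 2 3 in blast)+
qed

lemma eventually_localized:
  assumes "\<rho> > 0"
  obtains \<eta> m where "m > 0" "\<forall>\<^sub>F n in sequentially. localized n \<eta> m \<rho>"
proof -
  obtain \<eta> where iso: "isolating \<rho> \<eta>"
    using eventually_happens[OF eventually_isolating[OF assms]] by auto
  then have "\<eta> > 0" by (simp add: isolating_def)
  then obtain m where m: "m > 0" "\<And>s t. s \<in> {0..1} \<Longrightarrow> t \<in> {0..1} \<Longrightarrow>
      (\<And>s0 t0. (s0, t0) \<in> Z \<Longrightarrow> \<eta> \<le> \<bar>s - s0\<bar> \<or> \<eta> \<le> \<bar>t - t0\<bar>) \<Longrightarrow> m \<le> cmod (a s - b t)"
    by (rule lower_bound_off_zeros) blast
  have "\<forall>\<^sub>F n in sequentially. 1 / real n < \<eta>"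
    using \<open>\<eta> > 0\<close> by (intro order_tendstoD(2)[OF lim_1_over_n])
  moreover have "m / 3 > 0" using m(1) by simp
  note uniform_step[OF cont_a this] uniform_step[OF cont_b this]
  ultimately have "\<forall>\<^sub>F n in sequentially. localized n \<eta> m \<rho>"
    using eventually_gt_at_top[of 0]
  proof eventually_elim
    case (elim n)
    show ?case by (rule localizedI[OF iso m]) (assumption | rule elim)+
  qed
  with m(1) show ?thesis by (rule that)
qed

text \<open>The argument principle: around a square off the boxes the angles add up to 0, so the
  outer boundary sees only the boxes.\<close>

theorem eventually_winding:
  "\<forall>\<^sub>F n in sequentially. rect_bd (hang n) (vang n) 0 n 0 n =
    - 2 * pi * (\<Sum>k\<in>Z. sgn (Im (cnj (A (fst k)) * B (snd k))))"
proof -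
  obtain \<eta> m where loc: "m > 0" "\<forall>\<^sub>F n in sequentially. localized n \<eta> m 1"
    using eventually_localized[OF zero_less_one] .
  have "m / 3 > 0" using loc(1) by simp
  note steps = uniform_step[OF cont_a this] uniform_step[OF cont_b this]
  from loc(2) eventually_gt_at_top[of 0] steps show ?thesis
  proof eventually_elim
    case (elim n)
    have unit: "real i / n \<in> {0..1}" if "i \<le> n" for i using that elim(2) by simp
    have narrow_h: "narrow (W n (Suc i) j * cnj (W n i j))" if "i < n" "m \<le> cmod (W n i j)" for i j
    proof (rule narrow_step[OF that(2)])
      show "cmod (W n (Suc i) j - W n i j) < m / 3"
        using elim(3)[rule_format, of "real (Suc i) / n" "i / n"] unit[of i] unit[of "Suc i"] that(1)
        by (auto simp: W_def add_divide_distrib)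
    qed
    have narrow_v: "narrow (W n i (Suc j) * cnj (W n i j))" if "j < n" "m \<le> cmod (W n i j)" for i j
    proof (rule narrow_step[OF that(2)])
      show "cmod (W n i (Suc j) - W n i j) < m / 3"
        using elim(4)[rule_format, of "j / n" "real (Suc j) / n"] unit[of j] unit[of "Suc j"] that(1)
        by (auto simp: W_def add_divide_distrib)
    qed
    note L = elim(1)[unfolded localized_def]
    \<comment> \<open>The localization formula is applied to the zero curvature, with the zero
      cochain as trivialization inside the boxes.\<close>
    have "(\<Sum>i<n. \<Sum>j<n. 0) = rect_bd (hang n) (vang n) 0 n 0 n
        + (\<Sum>k\<in>Z. box_bd n \<eta> (\<lambda>i j. 0) (\<lambda>i j. 0) k - box_bd n \<eta> (hang n) (vang n) k)"
      unfolding box_bd_def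
    proof (rule sum_grid_localized)
      fix k assume k: "k \<in> Z"
      show "grid_lo n \<eta> (fst k) \<le> grid_hi n \<eta> (fst k) \<and> grid_lo n \<eta> (snd k) \<le> grid_hi n \<eta> (snd k)"
        using bspec[OF conjunct1[OF L] k] by simp
      show "rect (grid_lo n \<eta> (fst k)) (grid_hi n \<eta> (fst k)) (grid_lo n \<eta> (snd k)) (grid_hi n \<eta> (snd k)) \<subseteq> {..<n} \<times> {..<n}"
        using L k unfolding grid_box_def by blast
      show "rect (grid_lo n \<eta> (fst k)) (grid_hi n \<eta> (fst k)) (grid_lo n \<eta> (snd k)) (grid_hi n \<eta> (snd k)) \<inter>
          rect (grid_lo n \<eta> (fst l)) (grid_hi n \<eta> (fst l)) (grid_lo n \<eta> (snd l)) (grid_hi n \<eta> (snd l)) = {}"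
        if "l \<in> Z" "k \<noteq> l" for l
        using L k that unfolding grid_box_def by blast
    next
      fix i j assume lt: "i < n" "j < n"
        and out: "\<And>k. k \<in> Z \<Longrightarrow> (i, j) \<notin> rect (grid_lo n \<eta> (fst k)) (grid_hi n \<eta> (fst k)) (grid_lo n \<eta> (snd k)) (grid_hi n \<eta> (snd k))"
      have big: "m \<le> cmod (W n i' j')" if "i' \<in> {i, Suc i}" "j' \<in> {j, Suc j}" for i' j'
        using L lt out that unfolding grid_box_def by blast
      let ?a = "W n (Suc i) j * cnj (W n i j)" and ?b = "W n (Suc i) (Suc j) * cnj (W n (Suc i) j)"
        and ?c = "W n (Suc i) (Suc j) * cnj (W n i (Suc j))" and ?d = "W n i (Suc j) * cnj (W n i j)"
      have "square_bd (hang n) (vang n) i j = Arg ?a + Arg ?b - Arg ?c - Arg ?d"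
        by (simp add: square_bd_def hang_def vang_def ang_def)
      also have "\<dots> = Arg (?a * ?b * cnj ?c * cnj ?d)"
        using lt big by (intro Arg_narrow_square[symmetric] narrow_h narrow_v) auto
      \<comment> \<open>Each of the four corner values meets its own conjugate, so the product is a
        positive real.\<close>
      also have "?a * ?b * cnj ?c * cnj ?d =
          of_real ((cmod (W n i j))\<^sup>2 * (cmod (W n (Suc i) j))\<^sup>2 * (cmod (W n (Suc i) (Suc j)))\<^sup>2 * (cmod (W n i (Suc j)))\<^sup>2)"
        by (simp only: of_real_mult complex_norm_square complex_cnj_mult complex_cnj_cnj mult_ac)
      also have "Arg \<dots> = 0" unfolding Arg_of_real by (simp add: not_less)
      finally show "0 = square_bd (hang n) (vang n) i j" by simp
    qed (simp_all add: finite_Z square_bd_def)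
    then have "rect_bd (hang n) (vang n) 0 n 0 n = (\<Sum>k\<in>Z. box_bd n \<eta> (hang n) (vang n) k)"
      by (simp add: box_bd_def rect_bd_def[of "\<lambda>i j. 0"] sum_negf)
    also have "\<dots> = (\<Sum>k\<in>Z. - 2 * pi * sgn (Im (cnj (A (fst k)) * B (snd k))))"
      using L by (intro sum.cong) auto
    finally show ?case by (simp only: sum_distrib_left)
  qed
qed

end

section \<open>The Berry phase of a small quadrilateral on the sphere\<close>

definition pw :: "real ^ 3 \<Rightarrow> complex" where
  "pw a = Complex (a $ 1) (a $ 2)"

lemma norm_eq_1_pw:
  assumes "norm a = 1"
  shows "(cmod (pw a))\<^sup>2 = (1 + a $ 3) * (1 - a $ 3)"
proof -
  have "1 = a $ 1 * a $ 1 + a $ 2 * a $ 2 + a $ 3 * a $ 3"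
    using assms by (simp add: norm_eq_1 inner_vec_def sum_3)
  then show ?thesis unfolding pw_def cmod_power2 by (simp add: power2_eq_square algebra_simps)
qed

lemma norm_eq_1_bounds: "norm (a :: real ^ 3) = 1 \<Longrightarrow> -1 \<le> a $ 3 \<and> a $ 3 \<le> 1"
  using component_le_norm_cart[of a 3] by (simp add: abs_le_iff)

lemma pw_mult_cnj: "norm a = 1 \<Longrightarrow> pw a * cnj (pw a) = of_real ((1 + a $ 3) * (1 - a $ 3))"
  by (metis complex_norm_square norm_eq_1_pw)

lemma pw_diff: "pw (a - b) = pw a - pw b"
  by (simp add: pw_def complex_eq_iff)

lemma pw_scaleR: "pw (r *\<^sub>R a) = r *\<^sub>R pw a"
  by (simp add: pw_def complex_eq_iff)

lemma cmod_pw_le: "cmod (pw a) \<le> norm a"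
proof -
  have "(cmod (pw a))\<^sup>2 \<le> (norm a)\<^sup>2"
    unfolding pw_def cmod_power2 power2_norm_eq_inner by (simp add: inner_vec_def sum_3 power2_eq_square)
  then show ?thesis by (simp add: power2_le_iff_abs_le)
qed

type_synonym spinor = "complex \<times> complex"

definition bracket :: "spinor \<Rightarrow> spinor \<Rightarrow> complex" where
  "bracket x y = cnj (fst x) * fst y + cnj (snd x) * snd y"

text \<open>The trace of \<open>P a * P b * P c * P d\<close>, where \<open>P a\<close> is twice the projection of \<open>\<complex>\<^sup>2\<close> onto the line
  that corresponds to the point \<open>a\<close> of the Riemann sphere.\<close>

definition bargmann :: "real ^ 3 \<Rightarrow> real ^ 3 \<Rightarrow> real ^ 3 \<Rightarrow> real ^ 3 \<Rightarrow> complex" where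
  "bargmann a b c d =
   (let p = (\<lambda>a. of_real (1 + a $ 3)); q = (\<lambda>a. cnj (pw a)); r = pw; s = (\<lambda>a. of_real (1 - a $ 3)) in
    (p a * p b + q a * r b) * (p c * p d + q c * r d) + (p a * q b + q a * s b) * (r c * p d + s c * r d)
    + (r a * p b + s a * r b) * (p c * q d + q c * s d) + (r a * q b + s a * s b) * (r c * q d + s c * s d))"

text \<open>In matrix form: \<open>P a\<close> is \<open>l\<close> times the product of the column
  \<open>x\<close> with its conjugate transpose. Allowing any positive \<open>l\<close> spares the
  normalization of spinors, and arguments do not see it.\<close>

definition represents :: "spinor \<Rightarrow> real ^ 3 \<Rightarrow> bool" where
  "represents x a \<longleftrightarrow> (\<exists>l>0. of_real (1 + a $ 3) = of_real l * fst x * cnj (fst x) \<and>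
    cnj (pw a) = of_real l * fst x * cnj (snd x) \<and> pw a = of_real l * snd x * cnj (fst x) \<and>
    of_real (1 - a $ 3) = of_real l * snd x * cnj (snd x))"

text \<open>The trace of a product of rank one matrices is the cyclic product of Hermitian products.
  Every spinor occurs once linearly and once conjugated, so its phase cancels. Two factors are
  written as conjugates to match the orientation of \<open>square_bd\<close>.\<close>

lemma bargmann_bracket:
  assumes "represents x a" "represents y b" "represents z c" "represents w d"
  obtains l where "l > 0"
    "bargmann a b c d = of_real l * (bracket x y * bracket y z * cnj (bracket w z) * cnj (bracket x w))"
proof -
  obtain l1 l2 l3 l4 where l: "l1 > 0" "l2 > 0" "l3 > 0" "l4 > 0"
    and e: "of_real (1 + a $ 3) = of_real l1 * fst x * cnj (fst x)"
    "cnj (pw a) = of_real l1 * fst x * cnj (snd x)" "pw a = of_real l1 * snd x * cnj (fst x)"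
    "of_real (1 - a $ 3) = of_real l1 * snd x * cnj (snd x)"
    "of_real (1 + b $ 3) = of_real l2 * fst y * cnj (fst y)"
    "cnj (pw b) = of_real l2 * fst y * cnj (snd y)" "pw b = of_real l2 * snd y * cnj (fst y)"
    "of_real (1 - b $ 3) = of_real l2 * snd y * cnj (snd y)"
    "of_real (1 + c $ 3) = of_real l3 * fst z * cnj (fst z)"
    "cnj (pw c) = of_real l3 * fst z * cnj (snd z)" "pw c = of_real l3 * snd z * cnj (fst z)"
    "of_real (1 - c $ 3) = of_real l3 * snd z * cnj (snd z)"
    "of_real (1 + d $ 3) = of_real l4 * fst w * cnj (fst w)"
    "cnj (pw d) = of_real l4 * fst w * cnj (snd w)" "pw d = of_real l4 * snd w * cnj (fst w)"
    "of_real (1 - d $ 3) = of_real l4 * snd w * cnj (snd w)"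
    using assms unfolding represents_def by blast
  have "bargmann a b c d = of_real (l1 * l2 * l3 * l4) *
      (bracket x y * bracket y z * cnj (bracket w z) * cnj (bracket x w))"
    unfolding bargmann_def Let_def e bracket_def of_real_mult
    by (simp only: complex_cnj_add complex_cnj_mult complex_cnj_cnj complex_cnj_complex_of_real) algebra
  then show ?thesis using l that[of "l1 * l2 * l3 * l4"] by simp
qed

text \<open>The second column of \<open>P a\<close>; the first column is \<open>spin_n\<close>. As
  frames of the line bundle over the sphere, \<open>spin_s\<close> vanishes only at the north pole
  and \<open>spin_n\<close> only at the south pole.\<close>

definition spin_s :: "real ^ 3 \<Rightarrow> spinor" where
  "spin_s a = (cnj (pw a), of_real (1 - a $ 3))"

definition spin_n :: "real ^ 3 \<Rightarrow> spinor" where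
  "spin_n a = (of_real (1 + a $ 3), pw a)"

text \<open>A nowhere vanishing choice over the whole sphere, necessarily discontinuous. It serves
  where phases matter only modulo 2 * pi.\<close>

definition spin :: "real ^ 3 \<Rightarrow> spinor" where
  "spin a = (if a $ 3 = 1 then (1, 0) else spin_s a)"

lemma represents_spin_s:
  assumes "norm a = 1" "a $ 3 < 1"
  shows "represents (spin_s a) a"
  unfolding represents_def
proof (intro exI conjI)
  show "0 < 1 / (1 - a $ 3)" using assms(2) by simp
qed (use assms pw_mult_cnj[OF assms(1)] in \<open>simp_all add: spin_s_def field_simps\<close>)

lemma represents_spin_n:
  assumes "norm a = 1" "-1 < a $ 3"
  shows "represents (spin_n a) a"
  unfolding represents_def
proof (intro exI conjI)
  show "0 < 1 / (1 + a $ 3)" using assms(2) by simp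
  have "1 + complex_of_real (a $ 3) \<noteq> 0"
    using assms(2) by (simp add: complex_eq_iff)
  then show "of_real (1 + a $ 3) = complex_of_real (1 / (1 + a $ 3)) * fst (spin_n a) * cnj (fst (spin_n a))"
    "cnj (pw a) = complex_of_real (1 / (1 + a $ 3)) * fst (spin_n a) * cnj (snd (spin_n a))"
    "pw a = complex_of_real (1 / (1 + a $ 3)) * snd (spin_n a) * cnj (fst (spin_n a))"
    "of_real (1 - a $ 3) = complex_of_real (1 / (1 + a $ 3)) * snd (spin_n a) * cnj (snd (spin_n a))"
    using pw_mult_cnj[OF assms(1)] by (simp_all add: spin_n_def field_simps)
qed

lemma represents_spin:
  assumes "norm a = 1"
  shows "represents (spin a) a"
proof (cases "a $ 3 = 1")
  case True
  then have "pw a = 0" using norm_eq_1_pw[OF assms] by simp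
  with True show ?thesis unfolding represents_def spin_def by (intro exI[of _ 2]) simp
next
  case False
  then show ?thesis using represents_spin_s[OF assms] norm_eq_1_bounds[OF assms] by (auto simp: spin_def)
qed

lemma cis_Arg_bargmann:
  assumes "represents x a" "represents y b" "represents z c" "represents w d" "bargmann a b c d \<noteq> 0"
  shows "cis (Arg (bargmann a b c d)) =
    cis (Arg (bracket x y) + Arg (bracket y z) - Arg (bracket w z) - Arg (bracket x w))"
proof -
  obtain l where "l > 0"
    "bargmann a b c d = of_real l * (bracket x y * bracket y z * cnj (bracket w z) * cnj (bracket x w))"
    using bargmann_bracket[OF assms(1-4)] .
  with assms(5) show ?thesis by (simp add: cis_Arg_square)
qed

lemma Arg_bargmann_narrow:
  assumes "represents x a" "represents y b" "represents z c" "represents w d"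
    and "narrow (bracket x y)" "narrow (bracket y z)" "narrow (bracket w z)" "narrow (bracket x w)"
  shows "Arg (bargmann a b c d) =
    Arg (bracket x y) + Arg (bracket y z) - Arg (bracket w z) - Arg (bracket x w)"
proof -
  obtain l where "l > 0"
    "bargmann a b c d = of_real l * (bracket x y * bracket y z * cnj (bracket w z) * cnj (bracket x w))"
    using bargmann_bracket[OF assms(1-4)] .
  then show ?thesis using assms(5-8) by (simp add: Arg_narrow_square)
qed

text \<open>For \<open>b = a\<close> the bracket equals \<open>2 * (1 - a $ 3)\<close>. The
  deviation is linear in \<open>b - a\<close>, with coefficients at most 1 for the horizontal and 2
  for the vertical part, whence the 3.\<close>

lemma narrow_bracket_spin_s:
  assumes "norm a = 1" "norm b = 1" "3 * norm (b - a) < 1 - a $ 3"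
  shows "narrow (bracket (spin_s a) (spin_s b))"
proof (rule narrow_near_real)
  have "bracket (spin_s a) (spin_s b) - of_real (2 * (1 - a $ 3)) =
      pw a * cnj (pw (b - a)) - of_real (1 - a $ 3) * of_real ((b - a) $ 3)"
    using pw_mult_cnj[OF assms(1)] by (simp add: bracket_def spin_s_def pw_diff algebra_simps)
  also have "cmod \<dots> \<le> cmod (pw a) * cmod (pw (b - a)) + \<bar>1 - a $ 3\<bar> * \<bar>(b - a) $ 3\<bar>"
    by (rule order_trans[OF norm_triangle_ineq4]) (simp only: norm_mult complex_mod_cnj norm_of_real order_refl)
  also have "\<dots> \<le> 1 * norm (b - a) + 2 * norm (b - a)"
    using cmod_pw_le[of a] cmod_pw_le[of "b - a"] component_le_norm_cart[of "b - a" 3]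
      norm_eq_1_bounds[OF assms(1)] assms(1)
    by (intro add_mono mult_mono) auto
  finally show "cmod (bracket (spin_s a) (spin_s b) - of_real (2 * (1 - a $ 3))) \<le> 3 * norm (b - a)" by simp
  show "2 * (3 * norm (b - a)) < 2 * (1 - a $ 3)" using assms(3) by simp
qed

lemma narrow_bracket_spin_n:
  assumes "norm a = 1" "norm b = 1" "3 * norm (b - a) < 1 + a $ 3"
  shows "narrow (bracket (spin_n a) (spin_n b))"
proof (rule narrow_near_real)
  have "bracket (spin_n a) (spin_n b) - of_real (2 * (1 + a $ 3)) =
      cnj (pw a) * pw (b - a) + of_real (1 + a $ 3) * of_real ((b - a) $ 3)"
    using pw_mult_cnj[OF assms(1)] by (simp add: bracket_def spin_n_def pw_diff algebra_simps)
  also have "cmod \<dots> \<le> cmod (pw a) * cmod (pw (b - a)) + \<bar>1 + a $ 3\<bar> * \<bar>(b - a) $ 3\<bar>"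
    by (rule order_trans[OF norm_triangle_ineq]) (simp only: norm_mult complex_mod_cnj norm_of_real order_refl)
  also have "\<dots> \<le> 1 * norm (b - a) + 2 * norm (b - a)"
    using cmod_pw_le[of a] cmod_pw_le[of "b - a"] component_le_norm_cart[of "b - a" 3]
      norm_eq_1_bounds[OF assms(1)] assms(1)
    by (intro add_mono mult_mono) auto
  finally show "cmod (bracket (spin_n a) (spin_n b) - of_real (2 * (1 + a $ 3))) \<le> 3 * norm (b - a)" by simp
  show "2 * (3 * norm (b - a)) < 2 * (1 + a $ 3)" using assms(3) by simp
qed

text \<open>A lower bound for the horizontal part keeps a unit vector at a definite distance from
  the north pole, where \<open>spin_s\<close> degenerates.\<close>

lemma one_minus_height_ge:
  assumes "norm a = 1" "\<mu> \<le> cmod (pw a)" "0 \<le> \<mu>"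
  shows "\<mu>\<^sup>2 / 2 \<le> 1 - a $ 3"
proof -
  have "\<mu>\<^sup>2 \<le> (1 + a $ 3) * (1 - a $ 3)"
    using assms power_mono[of \<mu> "cmod (pw a)" 2] by (simp add: norm_eq_1_pw)
  also have "\<dots> \<le> 2 * (1 - a $ 3)"
    using norm_eq_1_bounds[OF assms(1)] by (intro mult_right_mono) auto
  finally show ?thesis by simp
qed

text \<open>The transition function of the bundle: \<open>pw a\<close> times \<open>spin_s a\<close>
  is \<open>1 - a $ 3\<close> times \<open>spin_n a\<close>. A change of frame therefore adds the
  angle swept out by the horizontal part, and so the winding of the plane difference enters.\<close>

lemma Arg_bracket_change:
  assumes "norm a = 1" "norm b = 1" "pw a \<noteq> 0" "pw b \<noteq> 0"
    and "narrow (bracket (spin_s a) (spin_s b))" "narrow (bracket (spin_n a) (spin_n b))"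
  shows "Arg (bracket (spin_n a) (spin_n b)) = Arg (bracket (spin_s a) (spin_s b)) + ang (pw a) (pw b)"
proof (rule eq_if_cis_eq)
  have lt: "a $ 3 < 1" "b $ 3 < 1"
    using one_minus_height_ge[OF assms(1) order_refl] one_minus_height_ge[OF assms(2) order_refl] assms(3,4)
    by (auto simp: zero_less_mult_iff dest!: order_le_less[THEN iffD1]) (smt (verit) zero_less_norm_iff zero_less_power)+
  define l where "l = (1 - a $ 3) * (1 - b $ 3)"
  have "l > 0" using lt by (simp add: l_def)
  have "of_real l * bracket (spin_n a) (spin_n b) =
      bracket (spin_s a) (spin_s b) * (pw b * cnj (pw a))"
  proof -
    have "bracket (spin_s a) (spin_s b) * (pw b * cnj (pw a)) =
        (pw a * cnj (pw a)) * (pw b * cnj (pw b)) + of_real l * (cnj (pw a) * pw b)"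
      by (simp add: bracket_def spin_s_def l_def algebra_simps)
    also have "\<dots> = of_real l * bracket (spin_n a) (spin_n b)"
      unfolding pw_mult_cnj[OF assms(1)] pw_mult_cnj[OF assms(2)]
      by (simp add: bracket_def spin_n_def l_def algebra_simps)
    finally show ?thesis by simp
  qed
  then have "Arg (bracket (spin_n a) (spin_n b)) = Arg (bracket (spin_s a) (spin_s b) * (pw b * cnj (pw a)))"
    using \<open>l > 0\<close> Arg_pos_scale[of l "bracket (spin_n a) (spin_n b)"] by simp
  then show "cis (Arg (bracket (spin_n a) (spin_n b))) =
      cis (Arg (bracket (spin_s a) (spin_s b)) + ang (pw a) (pw b))"
    using assms(3-5) by (simp add: cis_Arg_mult narrow_nonzero ang_def)
  show "\<bar>Arg (bracket (spin_n a) (spin_n b)) - (Arg (bracket (spin_s a) (spin_s b)) + ang (pw a) (pw b))\<bar> < 2 * pi"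
    using assms(5,6)[THEN narrow_Arg] Arg_bounded[of "pw b * cnj (pw a)"]
    unfolding ang_def by linarith
qed

section \<open>Grid sums of phases, and the change of frame around the north pole\<close>

lemma sum_grid_cis:
  fixes F :: "nat \<Rightarrow> nat \<Rightarrow> real"
  assumes "\<And>i j. i < n \<Longrightarrow> j < n \<Longrightarrow> cis (F i j) = cis (square_bd h v i j)"
  obtains k :: int where "(\<Sum>i<n. \<Sum>j<n. F i j) = rect_bd h v 0 n 0 n + 2 * pi * k"
proof -
  define m where "m i j = (SOME k :: int. F i j - square_bd h v i j = 2 * pi * k)" for i j
  have m: "F i j = square_bd h v i j + 2 * pi * m i j" if "i < n" "j < n" for i j
  proof -
    have "cis (F i j - square_bd h v i j) = 1" using assms[OF that] by (simp flip: cis_divide)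
    then have "\<exists>k :: int. F i j - square_bd h v i j = 2 * pi * k" by (rule cis_eq_1_int) blast
    from someI_ex[OF this] show ?thesis by (simp add: m_def algebra_simps)
  qed
  have "(\<Sum>i<n. \<Sum>j<n. F i j) = (\<Sum>i<n. \<Sum>j<n. square_bd h v i j) + 2 * pi * of_int (\<Sum>i<n. \<Sum>j<n. m i j)"
    by (simp add: m sum.distrib sum_distrib_left)
  also have "(\<Sum>i<n. \<Sum>j<n. square_bd h v i j) = rect_bd h v 0 n 0 n"
    using sum_square_bd[of 0 n 0 n h v] by (simp add: sum.cartesian_product atLeast0LessThan)
  finally show ?thesis by (rule that)
qed

lemma rect_bd_diff_cong:
  assumes "i1 \<le> i2" "j1 \<le> j2"
    and "\<And>i j. i \<in> {i1..<i2} \<Longrightarrow> j \<in> {j1, j2} \<Longrightarrow> h' i j = h i j + h'' i j"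
    and "\<And>i j. i \<in> {i1, i2} \<Longrightarrow> j \<in> {j1..<j2} \<Longrightarrow> v' i j = v i j + v'' i j"
  shows "rect_bd h' v' i1 i2 j1 j2 - rect_bd h v i1 i2 j1 j2 = rect_bd h'' v'' i1 i2 j1 j2"
proof -
  have "(\<Sum>i\<in>{i1..<i2}. h' i j) = (\<Sum>i\<in>{i1..<i2}. h i j) + (\<Sum>i\<in>{i1..<i2}. h'' i j)" if "j \<in> {j1, j2}" for j
    using assms(3) that by (simp add: sum.distrib[symmetric])
  moreover have "(\<Sum>j\<in>{j1..<j2}. v' i j) = (\<Sum>j\<in>{j1..<j2}. v i j) + (\<Sum>j\<in>{j1..<j2}. v'' i j)" if "i \<in> {i1, i2}" for i
    using assms(4) that by (simp add: sum.distrib[symmetric])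
  ultimately show ?thesis by (simp add: rect_bd_def)
qed

lemma uniform_square_step:
  fixes u :: "real \<Rightarrow> real \<Rightarrow> 'a::real_normed_vector"
  assumes "continuous_on ({0..1} \<times> {0..1}) (\<lambda>(s, t). u s t)" "\<epsilon> > 0"
  obtains d where "d > 0" "\<And>s t s' t'. s \<in> {0..1} \<Longrightarrow> t \<in> {0..1} \<Longrightarrow> s' \<in> {0..1} \<Longrightarrow> t' \<in> {0..1} \<Longrightarrow>
    \<bar>s' - s\<bar> < d \<Longrightarrow> \<bar>t' - t\<bar> < d \<Longrightarrow> norm (u s' t' - u s t) < \<epsilon>"
proof -
  have "uniformly_continuous_on ({0..1} \<times> {0..1}) (\<lambda>(s, t). u s t)"
    using assms(1) by (intro compact_uniformly_continuous compact_Times) auto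
  then obtain d where d: "d > 0" "\<And>p q. p \<in> {0..1} \<times> {0..1} \<Longrightarrow> q \<in> {0..1} \<times> {0..1} \<Longrightarrow>
      dist q p < d \<Longrightarrow> dist (case q of (s, t) \<Rightarrow> u s t) (case p of (s, t) \<Rightarrow> u s t) < \<epsilon>"
    unfolding uniformly_continuous_on_def using assms(2) by metis
  show ?thesis
  proof (rule that)
    show "d / 2 > 0" using d(1) by simp
    fix s t s' t' :: real
    assume st: "s \<in> {0..1}" "t \<in> {0..1}" "s' \<in> {0..1}" "t' \<in> {0..1}" "\<bar>s' - s\<bar> < d / 2" "\<bar>t' - t\<bar> < d / 2"
    have "dist (s', t') (s, t) \<le> dist s' s + dist t' t"
      by (simp add: dist_Pair_Pair sqrt_sum_squares_le_sum)
    then have "dist (s', t') (s, t) < d" using st by (simp add: dist_real_def)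
    with d(2)[of "(s, t)" "(s', t')"] st show "norm (u s' t' - u s t) < \<epsilon>" by (simp add: dist_norm)
  qed
qed

definition berry :: "(real \<Rightarrow> real \<Rightarrow> real ^ 3) \<Rightarrow> nat \<Rightarrow> nat \<Rightarrow> nat \<Rightarrow> real" where
  "berry u n i j = Arg (bargmann (u (i / n) (j / n)) (u (Suc i / n) (j / n))
    (u (Suc i / n) (Suc j / n)) (u (i / n) (Suc j / n)))"

definition hbr :: "(real ^ 3 \<Rightarrow> spinor) \<Rightarrow> (real \<Rightarrow> real \<Rightarrow> real ^ 3) \<Rightarrow> nat \<Rightarrow> nat \<Rightarrow> nat \<Rightarrow> real" where
  "hbr g u n i j = Arg (bracket (g (u (i / n) (j / n))) (g (u (Suc i / n) (j / n))))"

definition vbr :: "(real ^ 3 \<Rightarrow> spinor) \<Rightarrow> (real \<Rightarrow> real \<Rightarrow> real ^ 3) \<Rightarrow> nat \<Rightarrow> nat \<Rightarrow> nat \<Rightarrow> real" where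
  "vbr g u n i j = Arg (bracket (g (u (i / n) (j / n))) (g (u (i / n) (Suc j / n))))"

text \<open>\<open>u\<close> is the direction between points of two edges and \<open>r\<close> a
  positive scaling, later the inverse of their distance. By \<open>pw_u\<close> the zeros of the
  plane difference are the points where \<open>u\<close> is a pole; \<open>c\<close> converts lower
  bounds for the difference into distances from the poles.\<close>

locale sphere_cell = curve_pair +
  fixes u :: "real \<Rightarrow> real \<Rightarrow> real ^ 3" and r :: "real \<Rightarrow> real \<Rightarrow> real" and c :: real
  assumes cont_u: "continuous_on ({0..1} \<times> {0..1}) (\<lambda>(s, t). u s t)"
    and norm_u: "s \<in> {0..1} \<Longrightarrow> t \<in> {0..1} \<Longrightarrow> norm (u s t) = 1"
    and pw_u: "s \<in> {0..1} \<Longrightarrow> t \<in> {0..1} \<Longrightarrow> pw (u s t) = r s t *\<^sub>R (a s - b t)"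
    and c_pos: "c > 0" and r_ge: "s \<in> {0..1} \<Longrightarrow> t \<in> {0..1} \<Longrightarrow> c \<le> r s t"
begin

lemma height_zero: "(s, t) \<in> Z \<Longrightarrow> u s t $ 3 = 1 \<or> u s t $ 3 = -1"
proof -
  assume k: "(s, t) \<in> Z"
  then have I: "s \<in> {0..1}" "t \<in> {0..1}" using interior by fastforce+
  then have "pw (u s t) = 0" using pw_u zero_iff k by simp
  then have "(1 + u s t $ 3) * (1 - u s t $ 3) = 0" using norm_eq_1_pw[OF norm_u[OF I]] by simp
  then show ?thesis by auto
qed

text \<open>The frame \<open>spin_s\<close> works except near crossings over the north pole, where
  \<open>spin_n\<close> takes over. The bound 1 / 2 keeps each box in the hemisphere of its pole.
  The step bound ensures that three steps are less than \<open>1 - height\<close>, which is at least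
  \<open>(c * m)^2 / 2\<close> where the difference is at least \<open>m\<close>, and exceeds 1 on
  the southern hemisphere.\<close>

lemma sum_berry_localized:
  assumes loc: "localized n \<eta> m \<rho>" and m: "m > 0" and n: "n > 0"
    and \<rho>: "\<And>s t s' t'. s \<in> {0..1} \<Longrightarrow> t \<in> {0..1} \<Longrightarrow> s' \<in> {0..1} \<Longrightarrow> t' \<in> {0..1} \<Longrightarrow>
      \<bar>s' - s\<bar> < \<rho> \<Longrightarrow> \<bar>t' - t\<bar> < \<rho> \<Longrightarrow> norm (u s' t' - u s t) < 1 / 2"
    and d: "\<And>s t s' t'. s \<in> {0..1} \<Longrightarrow> t \<in> {0..1} \<Longrightarrow> s' \<in> {0..1} \<Longrightarrow> t' \<in> {0..1} \<Longrightarrow>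
      \<bar>s' - s\<bar> \<le> 1 / n \<Longrightarrow> \<bar>t' - t\<bar> \<le> 1 / n \<Longrightarrow> norm (u s' t' - u s t) < min (1 / 12) ((c * m)\<^sup>2 / 6)"
  shows "(\<Sum>i<n. \<Sum>j<n. berry u n i j) = rect_bd (hbr spin_s u n) (vbr spin_s u n) 0 n 0 n
    - 2 * pi * (\<Sum>k\<in>{k \<in> Z. 0 < u (fst k) (snd k) $ 3}. sgn (Im (cnj (A (fst k)) * B (snd k))))"
proof -
  let ?U = "\<lambda>i j :: nat. u (i / n) (j / n)"
  define K where "K = {k \<in> Z. 0 < u (fst k) (snd k) $ 3}"
  have unit: "real i / n \<in> {0..1}" if "i \<le> n" for i using that n by simp
  have nU: "norm (?U i j) = 1" if "i \<le> n" "j \<le> n" for i j using that by (intro norm_u unit)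
  have pU: "pw (?U i j) = r (i / n) (j / n) *\<^sub>R W n i j" if "i \<le> n" "j \<le> n" for i j
    using that unfolding W_def by (intro pw_u unit)
  have step: "norm (?U i' j' - ?U i j) < min (1 / 12) ((c * m)\<^sup>2 / 6)"
    if "i' \<le> n" "j' \<le> n" "i' \<in> {i, Suc i}" "j' \<in> {j, Suc j}" for i j i' j'
    using that n by (intro d unit) (auto simp: add_divide_distrib)
  have steep: "(c * m)\<^sup>2 / 2 \<le> 1 - ?U i j $ 3" if "i \<le> n" "j \<le> n" "m \<le> cmod (W n i j)" for i j
  proof (rule one_minus_height_ge[OF nU[OF that(1,2)]])
    have "c \<le> r (i / n) (j / n)" using that by (intro r_ge unit)
    then show "c * m \<le> cmod (pw (?U i j))"
      using that c_pos m by (simp add: pU mult_mono)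
  qed (use c_pos m in simp)
  have ns: "narrow (bracket (spin_s (?U i j)) (spin_s (?U i' j')))"
    if "i' \<le> n" "j' \<le> n" "i' \<in> {i, Suc i}" "j' \<in> {j, Suc j}" "m \<le> cmod (W n i j) \<or> ?U i j $ 3 < 0" for i j i' j'
  proof (rule narrow_bracket_spin_s)
    show "norm (?U i j) = 1" "norm (?U i' j') = 1" using that by (auto intro!: nU)
    have "i \<le> n" "j \<le> n" using that by auto
    then show "3 * norm (?U i' j' - ?U i j) < 1 - ?U i j $ 3"
      using steep[of i j] step[OF that(1-4)] that(5) by auto
  qed
  have nn: "narrow (bracket (spin_n (?U i j)) (spin_n (?U i' j')))"
    if "i' \<le> n" "j' \<le> n" "i' \<in> {i, Suc i}" "j' \<in> {j, Suc j}" "?U i j $ 3 > 0" for i j i' j'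
  proof (rule narrow_bracket_spin_n)
    show "norm (?U i j) = 1" "norm (?U i' j') = 1" using that by (auto intro!: nU)
    show "3 * norm (?U i' j' - ?U i j) < 1 + ?U i j $ 3"
      using step[OF that(1-4)] that(5) by auto
  qed
  have south: "berry u n i j = square_bd (hbr spin_s u n) (vbr spin_s u n) i j"
    if ij: "i < n" "j < n" and H: "\<And>i' j'. i' \<in> {i, Suc i} \<Longrightarrow> j' \<in> {j, Suc j} \<Longrightarrow> m \<le> cmod (W n i' j') \<or> ?U i' j' $ 3 < 0" for i j
  proof -
    have rep: "represents (spin_s (?U i' j')) (?U i' j')" if "i' \<in> {i, Suc i}" "j' \<in> {j, Suc j}" for i' j'
    proof (rule represents_spin_s)
      have le: "i' \<le> n" "j' \<le> n" using that ij by auto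
      then show "norm (?U i' j') = 1" by (rule nU)
      have "0 < (c * m)\<^sup>2" using c_pos m by simp
      then show "?U i' j' $ 3 < 1" using H[OF that] steep[OF le] by linarith
    qed
    show ?thesis
      unfolding berry_def square_bd_def hbr_def vbr_def
      using ij by (intro Arg_bargmann_narrow rep ns H) auto
  qed
  have north: "berry u n i j = square_bd (hbr spin_n u n) (vbr spin_n u n) i j"
    if ij: "i < n" "j < n" and H: "\<And>i' j'. i' \<in> {i, Suc i} \<Longrightarrow> j' \<in> {j, Suc j} \<Longrightarrow> ?U i' j' $ 3 > 0" for i j
  proof -
    have rep: "represents (spin_n (?U i' j')) (?U i' j')" if "i' \<in> {i, Suc i}" "j' \<in> {j, Suc j}" for i' j'
      using that ij H[OF that] by (intro represents_spin_n nU) auto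
    show ?thesis
      unfolding berry_def square_bd_def hbr_def vbr_def
      using ij by (intro Arg_bargmann_narrow rep nn H) auto
  qed
  have close: "u s t $ 3 - 1 / 2 < ?U i j $ 3" "?U i j $ 3 < u s t $ 3 + 1 / 2"
    if "i \<le> n" "j \<le> n" "(s, t) \<in> Z" "\<bar>i / n - s\<bar> < \<rho>" "\<bar>j / n - t\<bar> < \<rho>" for i j s t
  proof -
    have "norm (?U i j - u s t) < 1 / 2"
      using that interior[OF that(3)] by (intro \<rho> unit) auto
    then have "\<bar>?U i j $ 3 - u s t $ 3\<bar> < 1 / 2"
      using component_le_norm_cart[of "?U i j - u s t" 3] by simp
    then show "u s t $ 3 - 1 / 2 < ?U i j $ 3" "?U i j $ 3 < u s t $ 3 + 1 / 2" by linarith+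
  qed
  note L = loc[unfolded localized_def]
  have Lle: "grid_lo n \<eta> s \<le> grid_hi n \<eta> s" "grid_lo n \<eta> t \<le> grid_hi n \<eta> t"
      "grid_hi n \<eta> s \<le> n" "grid_hi n \<eta> t \<le> n" if "(s, t) \<in> Z" for s t
    using bspec[OF conjunct1[OF L] that] by simp_all
  have Lsub: "grid_box n \<eta> k \<subseteq> {..<n} \<times> {..<n}" if "k \<in> Z" for k using L that by blast
  have Ldisj: "grid_box n \<eta> k \<inter> grid_box n \<eta> l = {}" if "k \<in> Z" "l \<in> Z" "k \<noteq> l" for k l using L that by blast
  have Lout: "m \<le> cmod (W n i' j')" if "i < n" "j < n" "\<forall>k\<in>Z. (i, j) \<notin> grid_box n \<eta> k" "i' \<in> {i, Suc i}" "j' \<in> {j, Suc j}"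
    for i j i' j' using L that by blast
  have Lin: "\<bar>i' / n - fst k\<bar> < \<rho>" "\<bar>j' / n - snd k\<bar> < \<rho>"
    if "k \<in> Z" "(i, j) \<in> grid_box n \<eta> k" "i' \<in> {i, Suc i}" "j' \<in> {j, Suc j}" for k i j i' j' using L that by blast+
  have Lfr: "m \<le> cmod (W n i j)" "\<bar>i / n - fst k\<bar> < \<rho>" "\<bar>j / n - snd k\<bar> < \<rho>"
    if "k \<in> Z" "on_frame n \<eta> k i j" for k i j using L that by blast+
  have Lbd: "box_bd n \<eta> (hang n) (vang n) k = - 2 * pi * sgn (Im (cnj (A (fst k)) * B (snd k)))" if "k \<in> Z" for k
    using L that by blast
  have "(\<Sum>i<n. \<Sum>j<n. berry u n i j) = rect_bd (hbr spin_s u n) (vbr spin_s u n) 0 n 0 n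
      + (\<Sum>k\<in>K. box_bd n \<eta> (hbr spin_n u n) (vbr spin_n u n) k - box_bd n \<eta> (hbr spin_s u n) (vbr spin_s u n) k)"
    unfolding box_bd_def
  proof (rule sum_grid_localized)
    show "finite K" using finite_Z by (simp add: K_def)
    fix k assume k: "k \<in> K"
    then have kZ: "k \<in> Z" by (simp add: K_def)
    show "grid_lo n \<eta> (fst k) \<le> grid_hi n \<eta> (fst k) \<and> grid_lo n \<eta> (snd k) \<le> grid_hi n \<eta> (snd k)"
      using Lle[of "fst k" "snd k"] kZ by simp
    show "rect (grid_lo n \<eta> (fst k)) (grid_hi n \<eta> (fst k)) (grid_lo n \<eta> (snd k)) (grid_hi n \<eta> (snd k)) \<subseteq> {..<n} \<times> {..<n}"
      using Lsub[OF kZ] by (simp add: grid_box_def)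
    show "rect (grid_lo n \<eta> (fst k)) (grid_hi n \<eta> (fst k)) (grid_lo n \<eta> (snd k)) (grid_hi n \<eta> (snd k)) \<inter>
        rect (grid_lo n \<eta> (fst l)) (grid_hi n \<eta> (fst l)) (grid_lo n \<eta> (snd l)) (grid_hi n \<eta> (snd l)) = {}"
      if "l \<in> K" "k \<noteq> l" for l
      using Ldisj[OF kZ _ that(2)] that(1) by (simp add: grid_box_def K_def)
    fix i j assume ij: "(i, j) \<in> rect (grid_lo n \<eta> (fst k)) (grid_hi n \<eta> (fst k)) (grid_lo n \<eta> (snd k)) (grid_hi n \<eta> (snd k))"
    then have box: "(i, j) \<in> grid_box n \<eta> k" by (simp add: grid_box_def)
    have lt: "i < n" "j < n" using Lsub[OF kZ] box by auto
    obtain s t where [simp]: "k = (s, t)" by (cases k)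
    have "u s t $ 3 = 1" using k height_zero[of s t] by (auto simp: K_def)
    show "berry u n i j = square_bd (hbr spin_n u n) (vbr spin_n u n) i j"
    proof (rule north[OF lt])
      fix i' j' assume c: "i' \<in> {i, Suc i}" "j' \<in> {j, Suc j}"
      then have "i' \<le> n" "j' \<le> n" using lt by auto
      then show "?U i' j' $ 3 > 0"
        using close[of i' j' s t] Lin[OF kZ box c] kZ \<open>u s t $ 3 = 1\<close> by fastforce
    qed
  next
    fix i j assume lt: "i < n" "j < n"
      and out: "\<And>k. k \<in> K \<Longrightarrow> (i, j) \<notin> rect (grid_lo n \<eta> (fst k)) (grid_hi n \<eta> (fst k)) (grid_lo n \<eta> (snd k)) (grid_hi n \<eta> (snd k))"
    show "berry u n i j = square_bd (hbr spin_s u n) (vbr spin_s u n) i j"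
    proof (rule south[OF lt])
      fix i' j' assume c: "i' \<in> {i, Suc i}" "j' \<in> {j, Suc j}"
      show "m \<le> cmod (W n i' j') \<or> ?U i' j' $ 3 < 0"
      proof (cases "\<forall>k\<in>Z. (i, j) \<notin> grid_box n \<eta> k")
        case True
        then show ?thesis using Lout[OF lt True c] by simp
      next
        case False
        then obtain s t where k: "(s, t) \<in> Z" "(i, j) \<in> grid_box n \<eta> (s, t)" by auto
        then have "(s, t) \<notin> K" using out by (auto simp: grid_box_def)
        \<comment> \<open>The box of a crossing over the south pole needs no change of frame, since
          \<open>spin_s\<close> is far from vanishing there.\<close>
        then have "u s t $ 3 = -1" using k(1) height_zero[OF k(1)] by (auto simp: K_def)
        moreover have "i' \<le> n" "j' \<le> n" using c lt by auto
        ultimately show ?thesis using close[of i' j' s t] Lin[OF k c] k(1) by fastforce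
      qed
    qed
  qed
  also have "(\<Sum>k\<in>K. box_bd n \<eta> (hbr spin_n u n) (vbr spin_n u n) k - box_bd n \<eta> (hbr spin_s u n) (vbr spin_s u n) k)
      = (\<Sum>k\<in>K. box_bd n \<eta> (hang n) (vang n) k)"
  proof (rule sum.cong[OF refl])
    fix k assume k: "k \<in> K"
    obtain s t where [simp]: "k = (s, t)" by (cases k)
    have kZ: "(s, t) \<in> Z" using k by (simp add: K_def)
    have pos: "u s t $ 3 = 1" using k height_zero[of s t] by (auto simp: K_def)
    have edge: "Arg (bracket (spin_n (?U i j)) (spin_n (?U i' j'))) =
        Arg (bracket (spin_s (?U i j)) (spin_s (?U i' j'))) + ang (W n i j) (W n i' j')"
      if f: "on_frame n \<eta> (s, t) i j" "on_frame n \<eta> (s, t) i' j'" and c: "i' \<in> {i, Suc i}" "j' \<in> {j, Suc j}" for i j i' j'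
    proof -
      have le: "i \<le> n" "j \<le> n" "i' \<le> n" "j' \<le> n" using f Lle[OF kZ] by (auto simp: on_frame_def)
      have rp: "r (i / n) (j / n) > 0" "r (i' / n) (j' / n) > 0"
        using c_pos le by (auto intro!: less_le_trans[OF c_pos r_ge] unit)
      have nz: "W n i j \<noteq> 0" "W n i' j' \<noteq> 0" using Lfr(1)[OF kZ f(1)] Lfr(1)[OF kZ f(2)] m by auto
      have "?U i j $ 3 > 0" using close[OF le(1,2) kZ] Lfr(2,3)[OF kZ f(1)] pos by fastforce
      then have "Arg (bracket (spin_n (?U i j)) (spin_n (?U i' j'))) =
          Arg (bracket (spin_s (?U i j)) (spin_s (?U i' j'))) + ang (pw (?U i j)) (pw (?U i' j'))"
        using le c rp nz Lfr(1)[OF kZ f(1)] by (intro Arg_bracket_change nU ns nn) (simp_all add: pU)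
      also have "ang (pw (?U i j)) (pw (?U i' j')) = ang (W n i j) (W n i' j')"
      proof -
        have "pw (?U i' j') * cnj (pw (?U i j)) =
            of_real (r (i' / n) (j' / n) * r (i / n) (j / n)) * (W n i' j' * cnj (W n i j))"
          by (simp add: pU le scaleR_conv_of_real)
        then show ?thesis unfolding ang_def using rp by (simp only: Arg_pos_scale mult_pos_pos)
      qed
      finally show ?thesis .
    qed
    show "box_bd n \<eta> (hbr spin_n u n) (vbr spin_n u n) k - box_bd n \<eta> (hbr spin_s u n) (vbr spin_s u n) k
        = box_bd n \<eta> (hang n) (vang n) k"
      unfolding box_bd_def
    proof (rule rect_bd_diff_cong)
      fix i j
      show "hbr spin_n u n i j = hbr spin_s u n i j + hang n i j"
        if "i \<in> {grid_lo n \<eta> (fst k)..<grid_hi n \<eta> (fst k)}" "j \<in> {grid_lo n \<eta> (snd k), grid_hi n \<eta> (snd k)}"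
        unfolding hbr_def hang_def using that Lle[OF kZ] by (intro edge) (auto simp: on_frame_def)
      show "vbr spin_n u n i j = vbr spin_s u n i j + vang n i j"
        if "i \<in> {grid_lo n \<eta> (fst k), grid_hi n \<eta> (fst k)}" "j \<in> {grid_lo n \<eta> (snd k)..<grid_hi n \<eta> (snd k)}"
        unfolding vbr_def vang_def using that Lle[OF kZ] by (intro edge) (auto simp: on_frame_def)
    qed (use Lle[OF kZ] in simp_all)
  qed
  also have "\<dots> = - 2 * pi * (\<Sum>k\<in>K. sgn (Im (cnj (A (fst k)) * B (snd k))))"
    unfolding sum_distrib_left by (intro sum.cong refl Lbd) (simp add: K_def)
  finally show ?thesis by (simp add: K_def)
qed

theorem eventually_sum_berry:
  "\<forall>\<^sub>F n in sequentially. (\<Sum>i<n. \<Sum>j<n. berry u n i j) = rect_bd (hbr spin_s u n) (vbr spin_s u n) 0 n 0 n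
    - 2 * pi * (\<Sum>k\<in>{k \<in> Z. 0 < u (fst k) (snd k) $ 3}. sgn (Im (cnj (A (fst k)) * B (snd k))))"
proof -
  obtain \<rho> where \<rho>: "\<rho> > 0" "\<And>s t s' t'. s \<in> {0..1} \<Longrightarrow> t \<in> {0..1} \<Longrightarrow> s' \<in> {0..1} \<Longrightarrow> t' \<in> {0..1} \<Longrightarrow>
      \<bar>s' - s\<bar> < \<rho> \<Longrightarrow> \<bar>t' - t\<bar> < \<rho> \<Longrightarrow> norm (u s' t' - u s t) < 1 / 2"
    using uniform_square_step[OF cont_u, of "1 / 2"] by (metis half_gt_zero_iff zero_less_one)
  obtain \<eta> m where loc: "m > 0" "\<forall>\<^sub>F n in sequentially. localized n \<eta> m \<rho>"
    using eventually_localized[OF \<rho>(1)] .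
  have "min (1 / 12) ((c * m)\<^sup>2 / 6) > 0" using c_pos loc(1) by simp
  then obtain d where d: "d > 0" "\<And>s t s' t'. s \<in> {0..1} \<Longrightarrow> t \<in> {0..1} \<Longrightarrow> s' \<in> {0..1} \<Longrightarrow> t' \<in> {0..1} \<Longrightarrow>
      \<bar>s' - s\<bar> < d \<Longrightarrow> \<bar>t' - t\<bar> < d \<Longrightarrow> norm (u s' t' - u s t) < min (1 / 12) ((c * m)\<^sup>2 / 6)"
    using uniform_square_step[OF cont_u] by metis
  have "\<forall>\<^sub>F n in sequentially. 1 / real n < d"
    using d(1) by (intro order_tendstoD(2)[OF lim_1_over_n])
  with loc(2) eventually_gt_at_top[of 0] show ?thesis
  proof eventually_elim
    case (elim n)
    show ?case
      by (rule sum_berry_localized[OF elim(1) loc(1) elim(2) \<rho>(2) d(2)])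
        (assumption | rule le_less_trans[OF _ elim(3)])+
  qed
qed

end

section \<open>The combinatorics of the Petersen graph\<close>

lemma UNIV_5: "(UNIV :: 5 set) = {0, 1, 2, 3, 4}"
proof -
  have "card {0, 1, 2, 3, 4 :: 5} = card (UNIV :: 5 set)" by simp
  then show ?thesis by (intro card_subset_eq[symmetric]) auto
qed

lemma numeral_5: "(5 :: 5) = 0" "(6 :: 5) = 1" "(7 :: 5) = 2" "(8 :: 5) = 3"
  by simp_all

lemma sum_5: "(\<Sum>i\<in>(UNIV :: 5 set). g i) = g 0 + g 1 + g 2 + g 3 + g 4"
  for g :: "5 \<Rightarrow> 'a::comm_monoid_add"
  unfolding UNIV_5 by (simp add: add.assoc)

lemma ex_5: "(\<exists>i :: 5. P i) \<longleftrightarrow> P 0 \<or> P 1 \<or> P 2 \<or> P 3 \<or> P 4"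
proof -
  have "(\<exists>i. P i) \<longleftrightarrow> (\<exists>i\<in>{0, 1, 2, 3, 4}. P i)" unfolding UNIV_5[symmetric] by simp
  then show ?thesis by simp
qed

lemma all_5: "(\<forall>i :: 5. P i) \<longleftrightarrow> P 0 \<and> P 1 \<and> P 2 \<and> P 3 \<and> P 4"
  using ex_5[of "\<lambda>i. \<not> P i"] by blast

lemma UNIV_pg_edge: "(UNIV :: pg_edge set) = range UU \<union> range UV \<union> range VV"
  by (metis UNIV_eq_I UnCI pg_edge.exhaust rangeI)

lemma sum_pg_edge:
  fixes g :: "pg_edge \<Rightarrow> 'a::comm_monoid_add"
  shows "(\<Sum>e\<in>UNIV. g e) = (\<Sum>i\<in>UNIV. g (UU i)) + (\<Sum>i\<in>UNIV. g (UV i)) + (\<Sum>i\<in>UNIV. g (VV i))"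
proof -
  have "(\<Sum>e\<in>UNIV. g e) = sum g (range UU) + sum g (range UV) + sum g (range VV)"
    unfolding UNIV_pg_edge by (subst sum.union_disjoint, auto)+
  then show ?thesis by (simp add: sum.reindex inj_on_def)
qed

lemma source_neq_target: "source e \<noteq> target e"
  by (cases e) auto

lemma pg_adj_iff:
  "pg_adj (U i) (U j) \<longleftrightarrow> j = i + 1 \<or> i = j + 1"
  "pg_adj (U i) (V j) \<longleftrightarrow> j = i"
  "pg_adj (V i) (U j) \<longleftrightarrow> j = i"
  "pg_adj (V i) (V j) \<longleftrightarrow> j = i + 2 \<or> i = j + 2"
proof -
  have *: "pg_adj x y \<longleftrightarrow> (\<exists>i. ends (UU i) = {x, y}) \<or> (\<exists>i. ends (UV i) = {x, y}) \<or> (\<exists>i. ends (VV i) = {x, y})" for x y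
    unfolding pg_adj_def by (metis pg_edge.exhaust)
  show "pg_adj (U i) (U j) \<longleftrightarrow> j = i + 1 \<or> i = j + 1"
    "pg_adj (U i) (V j) \<longleftrightarrow> j = i"
    "pg_adj (V i) (U j) \<longleftrightarrow> j = i"
    "pg_adj (V i) (V j) \<longleftrightarrow> j = i + 2 \<or> i = j + 2"
    unfolding * ends_def by (auto simp: doubleton_eq_iff)
qed

lemma cases_5:
  fixes i j :: 5
  obtains "j = i" | "j = i + 1" | "j = i + 2" | "j = i + 3" | "j = i + 4"
proof -
  have "j - i \<in> {0, 1, 2, 3, 4}" using UNIV_5 by blast
  then show ?thesis using that by (auto simp: diff_eq_eq add.commute)
qed

text \<open>Guarantees that any two edges are joined by a path; otherwise the \<open>LEAST\<close>
  in \<open>edge_dist\<close> would denote an unspecified number.\<close>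

lemma diameter_le_2: "x = y \<or> pg_adj x y \<or> (\<exists>z. z \<noteq> x \<and> z \<noteq> y \<and> pg_adj x z \<and> pg_adj z y)"
proof -
  have UU: ?thesis if "x = U i" "y = U j" for i j
    using that by (cases rule: cases_5[of j i])
      (auto simp: pg_adj_iff add.assoc intro: exI[of _ "U (i + 1)"] exI[of _ "U (i + 4)"])
  have UV: "pg_adj (U i) (V j) \<or> (\<exists>z. z \<noteq> U i \<and> z \<noteq> V j \<and> pg_adj (U i) z \<and> pg_adj z (V j))" for i j
    by (cases rule: cases_5[of j i])
      (auto simp: pg_adj_iff add.assoc intro: exI[of _ "V i"] exI[of _ "U j"])
  have VV: ?thesis if "x = V i" "y = V j" for i j
    using that by (cases rule: cases_5[of j i])
      (auto simp: pg_adj_iff add.assoc intro: exI[of _ "V (i + 3)"] exI[of _ "V (i + 2)"])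
  have comm: "pg_adj u v \<longleftrightarrow> pg_adj v u" for u v
    by (simp add: pg_adj_def insert_commute)
  show ?thesis
    using UU UV VV UV[unfolded comm[of "U _"] comm[of _ "V _"]] by (cases x; cases y) blast+
qed

text \<open>Once some path is known to exist, only paths with one or two vertices have to be
  examined.\<close>

lemma edge_dist_eq_1_iff:
  "edge_dist d e = 1 \<longleftrightarrow> ends d \<inter> ends e = {} \<and> (\<exists>x\<in>ends d. \<exists>y\<in>ends e. pg_adj x y)"
proof -
  define P where "P n \<longleftrightarrow> (\<exists>p. pg_path p \<and> hd p \<in> ends d \<and> last p \<in> ends e \<and> length p = Suc n)" for n
  have P0: "P 0 \<longleftrightarrow> ends d \<inter> ends e \<noteq> {}"
  proof
    assume "P 0"
    then obtain p where "hd p \<in> ends d" "last p \<in> ends e" "length p = Suc 0" unfolding P_def by blast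
    then show "ends d \<inter> ends e \<noteq> {}" by (auto simp: length_Suc_conv)
  next
    assume "ends d \<inter> ends e \<noteq> {}"
    then obtain x where "x \<in> ends d" "x \<in> ends e" by blast
    then show "P 0" unfolding P_def by (intro exI[of _ "[x]"]) (simp add: pg_path_def)
  qed
  have P1: "P 1 \<longleftrightarrow> (\<exists>x\<in>ends d. \<exists>y\<in>ends e. x \<noteq> y \<and> pg_adj x y)"
  proof
    assume "P 1"
    then obtain p where p: "pg_path p" "hd p \<in> ends d" "last p \<in> ends e" "length p = Suc (Suc 0)"
      unfolding P_def by auto
    then obtain x y where "p = [x, y]" by (auto simp: length_Suc_conv)
    with p show "\<exists>x\<in>ends d. \<exists>y\<in>ends e. x \<noteq> y \<and> pg_adj x y"
      unfolding pg_path_def by auto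
  next
    assume "\<exists>x\<in>ends d. \<exists>y\<in>ends e. x \<noteq> y \<and> pg_adj x y"
    then obtain x y where "x \<in> ends d" "y \<in> ends e" "x \<noteq> y" "pg_adj x y" by blast
    then show "P 1" unfolding P_def by (intro exI[of _ "[x, y]"]) (simp add: pg_path_def)
  qed
  have dist: "edge_dist d e = (LEAST n. P n)" by (simp add: edge_dist_def P_def)
  show ?thesis
  proof
    assume one: "edge_dist d e = 1"
    have "\<not> P 0" using one dist not_less_Least[of 0 P] by simp
    moreover have "\<exists>n. P n"
    proof -
      have "source d = source e \<or> pg_adj (source d) (source e) \<or>
          (\<exists>z. z \<noteq> source d \<and> z \<noteq> source e \<and> pg_adj (source d) z \<and> pg_adj z (source e))"
        by (rule diameter_le_2)
      moreover have "P 0" if "source d = source e"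
        using that unfolding P0 by (auto simp: ends_def)
      moreover have "P 1" if "source d \<noteq> source e" "pg_adj (source d) (source e)"
        using that unfolding P1 by (auto simp: ends_def)
      moreover have "P 2" if "source d \<noteq> source e" "z \<noteq> source d" "z \<noteq> source e" "pg_adj (source d) z" "pg_adj z (source e)" for z
        unfolding P_def using that
        by (intro exI[of _ "[source d, z, source e]"]) (auto simp: pg_path_def ends_def less_Suc_eq)
      ultimately show ?thesis by blast
    qed
    then have "P 1" using one dist by (metis LeastI_ex)
    ultimately show "ends d \<inter> ends e = {} \<and> (\<exists>x\<in>ends d. \<exists>y\<in>ends e. pg_adj x y)"
      using P0 P1 by blast
  next
    assume R: "ends d \<inter> ends e = {} \<and> (\<exists>x\<in>ends d. \<exists>y\<in>ends e. pg_adj x y)"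
    then have "\<not> P 0" by (simp add: P0)
    have "P 1"
    proof -
      obtain x y where xy: "x \<in> ends d" "y \<in> ends e" "pg_adj x y" using R by blast
      moreover have "x \<noteq> y" using R xy by auto
      ultimately show ?thesis unfolding P1 by blast
    qed
    then have "(LEAST n. P n) = 1" using \<open>\<not> P 0\<close>
      by (intro Least_equality) (auto simp: Suc_le_eq intro!: gr0I)
    then show "edge_dist d e = 1" by (simp add: dist)
  qed
qed

lemma eps_Upair: "eps (Upair d e) = (if eps_table d e \<noteq> 0 then eps_table d e else eps_table e d)"
  by transfer simp

lemma all_edge: "(\<forall>e. Q e) \<longleftrightarrow> (\<forall>i. Q (UU i)) \<and> (\<forall>i. Q (UV i)) \<and> (\<forall>i. Q (VV i))"
proof (intro iffI allI)
  fix e assume "(\<forall>i. Q (UU i)) \<and> (\<forall>i. Q (UV i)) \<and> (\<forall>i. Q (VV i))"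
  then show "Q e" by (cases e) auto
qed auto

text \<open>From here on nonvanishing of \<open>eps\<close> replaces the distance condition. For
  edges of given types both sides depend only on the difference of the indices, hence the split by
  \<open>cases_5\<close>.\<close>

lemma edge_dist_eq_1_iff_eps: "edge_dist d e = 1 \<longleftrightarrow> eps (Upair d e) \<noteq> 0"
proof -
  have "edge_dist d e = 1 \<longleftrightarrow> eps (Upair d e) \<noteq> 0" if "d = D i" "e = E j" "D \<in> {UU, UV, VV}" "E \<in> {UU, UV, VV}" for i j D E
    using that unfolding edge_dist_eq_1_iff eps_Upair
    by (cases rule: cases_5[of j i]) (auto simp: ends_def pg_adj_iff add.assoc)
  then show ?thesis by (cases d; cases e) auto
qed

lemma eps_odd: "eps (Upair d e) \<noteq> 0 \<Longrightarrow> odd (eps (Upair d e))"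
  by (cases d; cases e) (auto simp: eps_Upair split: if_splits)

lemma eps_disjoint: "eps (Upair d e) \<noteq> 0 \<Longrightarrow> ends d \<inter> ends e = {}"
  using edge_dist_eq_1_iff[of d e] edge_dist_eq_1_iff_eps[of d e] by simp

text \<open>At every vertex off \<open>d\<close> exactly two edges are at distance 1 from \<open>d\<close>, and their contributions
  cancel: the cells \<open>d \<times> e\<close>, weighted by \<open>\<epsilon>\<close>, form a closed surface.\<close>

lemma eps_closed:
  fixes g :: "pg_vertex \<Rightarrow> real"
  shows "(\<Sum>e\<in>UNIV. of_int (eps (Upair d e)) * (g (target e) - g (source e))) = 0"
proof -
  have "\<forall>d. (\<Sum>e\<in>UNIV. of_int (eps (Upair d e)) * (g (target e) - g (source e))) = 0"
    unfolding eps_Upair all_edge all_5 sum_pg_edge sum_5 by (simp add: numeral_5)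
  then show ?thesis by blast
qed

section \<open>From unordered pairs to ordered pairs and rotation orbits\<close>

lemma Upair_commute: "Upair a b = Upair b a"
  by simp

lemma D1_iff: "Upair d e \<in> D1 \<longleftrightarrow> eps (Upair d e) \<noteq> 0"
proof -
  have "Upair d e \<in> D1 \<longleftrightarrow> edge_dist d e = 1 \<or> edge_dist e d = 1"
    unfolding D1_def by auto
  also have "\<dots> \<longleftrightarrow> eps (Upair d e) \<noteq> 0"
    unfolding edge_dist_eq_1_iff_eps by (simp add: Upair_inject Upair_commute[of e d])
  finally show ?thesis .
qed

lemma sum_D1:
  fixes g :: "pg_edge uprod \<Rightarrow> int"
  shows "2 * (\<Sum>P\<in>D1. g P) = (\<Sum>d\<in>UNIV. \<Sum>e\<in>UNIV. if eps (Upair d e) \<noteq> 0 then g (Upair d e) else 0)"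
proof -
  define up :: "pg_edge \<times> pg_edge \<Rightarrow> pg_edge uprod" where "up p = Upair (fst p) (snd p)" for p
  define S where "S = {p. eps (up p) \<noteq> 0}"
  have img: "up ` S = D1"
  proof (intro equalityI subsetI)
    fix P assume P: "P \<in> D1"
    then obtain d e where "P = up (d, e)" unfolding D1_def up_def by auto
    then show "P \<in> up ` S" using P by (auto simp: S_def up_def D1_iff simp del: Upair_inject intro!: image_eqI[of _ _ "(d, e)"])
  qed (auto simp: S_def up_def D1_iff)
  have "(\<Sum>d\<in>UNIV. \<Sum>e\<in>UNIV. if eps (Upair d e) \<noteq> 0 then g (Upair d e) else 0)
      = (\<Sum>p\<in>UNIV. if eps (up p) \<noteq> 0 then g (up p) else 0)"
    unfolding UNIV_Times_UNIV[symmetric] up_def by (simp add: sum.cartesian_product case_prod_beta)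
  also have "\<dots> = (\<Sum>p\<in>S. g (up p))"
    by (rule sum.mono_neutral_cong_right) (auto simp: S_def)
  also have "\<dots> = (\<Sum>P\<in>D1. \<Sum>p | p \<in> S \<and> up p = P. g (up p))"
    unfolding img[symmetric] by (rule sum.image_gen) simp
  also have "\<dots> = (\<Sum>P\<in>D1. 2 * g P)"
  proof (rule sum.cong[OF refl])
    fix P assume "P \<in> D1"
    then obtain d e where P: "P = Upair d e" "eps (Upair d e) \<noteq> 0"
      using D1_iff unfolding D1_def by blast
    have "d \<noteq> e" using eps_disjoint[OF P(2)] by (auto simp: ends_def)
    moreover have "{p. p \<in> S \<and> up p = P} = {(d, e), (e, d)}"
      using P by (auto simp: S_def up_def Upair_commute[of e d])
    ultimately show "(\<Sum>p | p \<in> S \<and> up p = P. g (up p)) = 2 * g P"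
      using P(1) by (simp add: up_def Upair_commute[of e d])
  qed
  finally show ?thesis by (simp add: sum_distrib_left)
qed

text \<open>One representative of each of the 12 orbits of \<open>D1\<close> under rotation.\<close>

definition orbit_sum :: "(pg_edge \<Rightarrow> pg_edge \<Rightarrow> 'a::comm_ring_1) \<Rightarrow> 5 \<Rightarrow> 'a" where
  "orbit_sum G i = G (UU i) (UU (i + 2)) + G (UU i) (UV (i + 4)) + G (UU i) (UV (i + 2))
    + G (UU i) (VV i) + G (UU i) (VV (i + 1)) + G (UU i) (VV (i + 3)) + G (UU i) (VV (i + 4))
    + G (UV i) (UV (i + 1)) + G (UV i) (UV (i + 2)) + G (UV i) (VV (i + 1)) + G (UV i) (VV (i + 2))
    + G (VV i) (VV (i + 1))"

lemma sum_orbits: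
  fixes G :: "pg_edge \<Rightarrow> pg_edge \<Rightarrow> int"
  assumes "\<And>d e. G d e = G e d"
  shows "(\<Sum>d\<in>UNIV. \<Sum>e\<in>UNIV. if eps (Upair d e) \<noteq> 0 then G d e else 0) = 2 * (\<Sum>i\<in>UNIV. orbit_sum G i)"
proof -
  have c: "G (UV i) (UU j) = G (UU j) (UV i)" "G (VV i) (UU j) = G (UU j) (VV i)"
    "G (VV i) (UV j) = G (UV j) (VV i)" for i j
    by (rule assms)+
  \<comment> \<open>For two edges of the same type the normal form puts the smaller numeral in
    front; rotating an orbit representative can wrap around and reverse that order.\<close>
  have n: "G (UU 2) (UU 0) = G (UU 0) (UU 2)" "G (UU 3) (UU 1) = G (UU 1) (UU 3)" "G (UU 4) (UU 2) = G (UU 2) (UU 4)"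
    "G (UU 3) (UU 0) = G (UU 0) (UU 3)" "G (UU 4) (UU 1) = G (UU 1) (UU 4)"
    "G (UV 1) (UV 0) = G (UV 0) (UV 1)" "G (UV 2) (UV 1) = G (UV 1) (UV 2)" "G (UV 3) (UV 2) = G (UV 2) (UV 3)"
    "G (UV 4) (UV 3) = G (UV 3) (UV 4)" "G (UV 4) (UV 0) = G (UV 0) (UV 4)"
    "G (UV 2) (UV 0) = G (UV 0) (UV 2)" "G (UV 3) (UV 1) = G (UV 1) (UV 3)" "G (UV 4) (UV 2) = G (UV 2) (UV 4)"
    "G (UV 3) (UV 0) = G (UV 0) (UV 3)" "G (UV 4) (UV 1) = G (UV 1) (UV 4)"
    "G (VV 1) (VV 0) = G (VV 0) (VV 1)" "G (VV 2) (VV 1) = G (VV 1) (VV 2)" "G (VV 3) (VV 2) = G (VV 2) (VV 3)"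
    "G (VV 4) (VV 3) = G (VV 3) (VV 4)" "G (VV 4) (VV 0) = G (VV 0) (VV 4)"
    by (rule assms)+
  show ?thesis
    unfolding sum_pg_edge sum_5 eps_Upair orbit_sum_def by (simp add: numeral_5 c n)
qed

text \<open>\<open>\<theta> e v\<close> stands for the angle swept out by the edge \<open>e\<close>
  as seen from \<open>v\<close>, and \<open>\<alpha> x y\<close> for the direction from
  \<open>y\<close> to \<open>x\<close>; exchanging the two vertices adds a half turn.
  \<open>N\<close> is a winding number along the boundary of a cell.\<close>

lemma orbit_sum_odd:
  fixes N :: "pg_edge \<Rightarrow> pg_edge \<Rightarrow> int" and \<theta> :: "pg_edge \<Rightarrow> pg_vertex \<Rightarrow> real"
    and \<alpha> :: "pg_vertex \<Rightarrow> pg_vertex \<Rightarrow> real"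
  assumes N: "\<And>d e. eps (Upair d e) \<noteq> 0 \<Longrightarrow>
      2 * pi * N d e = \<theta> d (source e) + \<theta> e (target d) - \<theta> d (target e) - \<theta> e (source d)"
    and \<theta>: "\<And>e v. v \<notin> ends e \<Longrightarrow> \<exists>m :: int. \<theta> e v = \<alpha> (target e) v - \<alpha> (source e) v + 2 * pi * m"
    and \<alpha>: "\<And>x y. x \<noteq> y \<Longrightarrow> \<exists>k :: int. \<alpha> y x = \<alpha> x y + pi + 2 * pi * k"
  shows "odd (\<Sum>i\<in>UNIV. orbit_sum N i)"
proof -
  define m where "m e v = (SOME m :: int. \<theta> e v = \<alpha> (target e) v - \<alpha> (source e) v + 2 * pi * m)" for e v
  have m: "\<theta> e v = \<alpha> (target e) v - \<alpha> (source e) v + 2 * pi * m e v" if "v \<notin> ends e" for e v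
    using someI_ex[OF \<theta>[OF that]] by (simp add: m_def)
  define k where "k x y = (SOME k :: int. \<alpha> y x = \<alpha> x y + pi + 2 * pi * k)" for x y
  have k: "\<alpha> y x = \<alpha> x y + pi + 2 * pi * k x y" if "x \<noteq> y" for x y
    using someI_ex[OF \<alpha>[OF that]] by (simp add: k_def)
  have kd: "\<alpha> (U (i + 2)) (U i) - \<alpha> (U i) (U (i + 2)) = pi + 2 * pi * k (U i) (U (i + 2))"
    "\<alpha> (U (i + 1)) (U i) - \<alpha> (U i) (U (i + 1)) = pi + 2 * pi * k (U i) (U (i + 1))"
    "\<alpha> (V j) (U i) - \<alpha> (U i) (V j) = pi + 2 * pi * k (U i) (V j)"
    "\<alpha> (V (i + 1)) (V i) - \<alpha> (V i) (V (i + 1)) = pi + 2 * pi * k (V i) (V (i + 1))" for i j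
    using k[of "U i" "U (i + 2)"] k[of "U i" "U (i + 1)"] k[of "U i" "V j"] k[of "V i" "V (i + 1)"] by auto
  have cancel: "2 * pi * of_int x = 2 * pi * of_int y \<Longrightarrow> x = y" for x y :: int
    by simp
  define M where "M i = m (UU i) (U (i + 2)) - m (UU i) (U (i + 3)) + m (UU i) (U (i + 4)) - m (UU i) (V (i + 2))
    + m (UV i) (U (i + 2)) - m (UV i) (U (i + 3)) + m (VV i) (V (i + 1)) - m (VV i) (U (i + 4))" for i
  define K where "K i = 3 * k (U i) (U (i + 2)) - k (U i) (U (i + 1)) + k (U i) (V (i + 1)) - k (U i) (V (i + 2))
    + k (V i) (V (i + 1))" for i
  have shift: "(\<Sum>i\<in>UNIV. g (i + j)) = (\<Sum>i\<in>UNIV. g i)" for g :: "5 \<Rightarrow> real" and j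
    by (rule sum.reindex_bij_witness[of _ "\<lambda>i. i - j" "\<lambda>i. i + j"]) auto
  have "2 * pi * of_int (\<Sum>i\<in>UNIV. orbit_sum N i) = (\<Sum>i\<in>UNIV. orbit_sum (\<lambda>d e. 2 * pi * N d e) i)"
    by (simp add: sum_distrib_left orbit_sum_def distrib_left)
  also have "\<dots> = (\<Sum>i\<in>UNIV. orbit_sum (\<lambda>d e. \<theta> d (source e) + \<theta> e (target d) - \<theta> d (target e) - \<theta> e (source d)) i)"
    unfolding orbit_sum_def
    by (intro sum.cong arg_cong2[where f = "(+)"] refl N) (auto simp: eps_Upair)
  \<comment> \<open>After rotation the surviving angles all have coefficient 2 or -2. Their unknown
    multiples of 2 * pi hence contribute only even integers to the sum of \<open>N\<close>.\<close>
  also have "\<dots> = 2 * (\<Sum>i\<in>UNIV. \<theta> (UU i) (U (i + 2)) - \<theta> (UU i) (U (i + 3)) + \<theta> (UU i) (U (i + 4)) - \<theta> (UU i) (V (i + 2))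
      + \<theta> (UV i) (U (i + 2)) - \<theta> (UV i) (U (i + 3)) + \<theta> (VV i) (V (i + 1)) - \<theta> (VV i) (U (i + 4)))"
    unfolding orbit_sum_def sum_5 by (simp add: numeral_5)
  also have "\<dots> = 2 * (\<Sum>i\<in>UNIV. (\<alpha> (U (i + 1)) (U (i + 2)) - \<alpha> (U i) (U (i + 2)) + 2 * pi * m (UU i) (U (i + 2)))
      - (\<alpha> (U (i + 1)) (U (i + 3)) - \<alpha> (U i) (U (i + 3)) + 2 * pi * m (UU i) (U (i + 3)))
      + (\<alpha> (U (i + 1)) (U (i + 4)) - \<alpha> (U i) (U (i + 4)) + 2 * pi * m (UU i) (U (i + 4)))
      - (\<alpha> (U (i + 1)) (V (i + 2)) - \<alpha> (U i) (V (i + 2)) + 2 * pi * m (UU i) (V (i + 2)))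
      + (\<alpha> (V i) (U (i + 2)) - \<alpha> (U i) (U (i + 2)) + 2 * pi * m (UV i) (U (i + 2)))
      - (\<alpha> (V i) (U (i + 3)) - \<alpha> (U i) (U (i + 3)) + 2 * pi * m (UV i) (U (i + 3)))
      + (\<alpha> (V (i + 2)) (V (i + 1)) - \<alpha> (V i) (V (i + 1)) + 2 * pi * m (VV i) (V (i + 1)))
      - (\<alpha> (V (i + 2)) (U (i + 4)) - \<alpha> (V i) (U (i + 4)) + 2 * pi * m (VV i) (U (i + 4))))"
    by (intro arg_cong2[where f = times] refl sum.cong) (simp add: m ends_def)
  \<comment> \<open>Rotation collects the directions into opposite pairs, each worth a half turn
    modulo 2 * pi. Their coefficients 3, -1, 1, -1, 1 add up to 3, and five indices give the odd
    number 15.\<close>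
  also have "\<dots> = 2 * (\<Sum>i\<in>UNIV. 2 * pi * M i + 3 * (\<alpha> (U (i + 2)) (U i) - \<alpha> (U i) (U (i + 2)))
      - (\<alpha> (U (i + 1)) (U i) - \<alpha> (U i) (U (i + 1))) + (\<alpha> (V (i + 1)) (U i) - \<alpha> (U i) (V (i + 1)))
      - (\<alpha> (V (i + 2)) (U i) - \<alpha> (U i) (V (i + 2))) + (\<alpha> (V (i + 1)) (V i) - \<alpha> (V i) (V (i + 1))))"
    unfolding sum_5 M_def by (simp add: numeral_5 algebra_simps)
  also have "\<dots> = 2 * (\<Sum>i\<in>UNIV. 2 * pi * M i + 3 * (pi + 2 * pi * k (U i) (U (i + 2)))
      - (pi + 2 * pi * k (U i) (U (i + 1))) + (pi + 2 * pi * k (U i) (V (i + 1)))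
      - (pi + 2 * pi * k (U i) (V (i + 2))) + (pi + 2 * pi * k (V i) (V (i + 1))))"
    by (simp only: kd)
  also have "\<dots> = 2 * (\<Sum>i\<in>UNIV. pi * (of_int (2 * M i + 2 * K i + 3)))"
    by (intro arg_cong2[where f = times] refl sum.cong) (simp add: K_def algebra_simps)
  also have "\<dots> = 2 * pi * of_int (\<Sum>i\<in>UNIV. 2 * M i + 2 * K i + 3)"
    by (simp only: of_int_sum sum_distrib_left mult.assoc)
  finally have "(\<Sum>i\<in>UNIV. orbit_sum N i) = (\<Sum>i\<in>UNIV. 2 * M i + 2 * K i + 3)"
    by (rule cancel)
  then show ?thesis by (simp add: sum.distrib sum_distrib_left[symmetric])
qed

section \<open>Crossings of a generic immersion\<close>

text \<open>Different edges with the same ends would be reversed copies of each other, which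
  requires 2 = 0 or 4 = 0 modulo 5.\<close>

lemma ends_inj: "ends d = ends e \<Longrightarrow> d = e"
proof -
  have 1: False if "i = j + 1" "i + 1 = (j :: 5)" for i j
  proof -
    have "i + 2 = i + 0" using that by (metis add.assoc add.right_neutral one_add_one)
    then show False unfolding add_left_cancel by simp
  qed
  have 2: False if "i = j + 2" "i + 2 = (j :: 5)" for i j
  proof -
    have "i + 4 = i + 0" using that by (metis add.assoc add.right_neutral numeral_Bit0)
    then show False unfolding add_left_cancel by simp
  qed
  show "ends d = ends e \<Longrightarrow> d = e"
    by (cases d; cases e) (auto simp: ends_def doubleton_eq_iff dest: 1 2)
qed

lemma edge_point_nth:
  "edge_point e t $ v = (if v = source e then 1 - t else if v = target e then t else 0)"
  using source_neq_target[of e] by (simp add: edge_point_def axis_def)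

lemma edge_point_0 [simp]: "edge_point e 0 = axis (source e) 1"
  and edge_point_1 [simp]: "edge_point e 1 = axis (target e) 1"
  by (simp_all add: edge_point_def)

lemma edge_point_in_PG: "t \<in> {0..1} \<Longrightarrow> edge_point e t \<in> PG"
  unfolding PG_def edge_set_def by blast

text \<open>It suffices that \<open>t\<close> is interior: the two nonzero coordinates of the point
  then reveal both ends of its edge.\<close>

lemma edge_point_eq_interior:
  assumes "edge_point d s = edge_point e t" "s \<in> {0..1}" "t \<in> {0<..<1}"
  shows "d = e \<and> s = t"
proof -
  have eq: "edge_point d s $ v = edge_point e t $ v" for v using assms(1) by simp
  have "source e \<in> ends d" "target e \<in> ends d"
    using eq[of "source e"] eq[of "target e"] assms(3) source_neq_target[of e]
    by (auto simp: edge_point_nth ends_def split: if_splits)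
  then have "ends d = ends e"
    using source_neq_target[of e] by (auto simp: ends_def)
  then have "d = e" by (rule ends_inj)
  then show ?thesis using eq[of "target e"] source_neq_target[of e] by (auto simp: edge_point_nth)
qed

lemma edge_point_inj:
  assumes "edge_point d s = edge_point d t"
  shows "s = t"
  using arg_cong[OF assms, of "\<lambda>x. x $ target d"] source_neq_target[of d] by (auto simp: edge_point_nth)

lemma edge_point_neq:
  assumes "ends d \<inter> ends e = {}" "s \<in> {0..1}" "t \<in> {0..1}"
  shows "edge_point d s \<noteq> edge_point e t"
proof
  assume "edge_point d s = edge_point e t"
  then have eq: "edge_point d s $ v = edge_point e t $ v" for v by simp
  show False
    using eq[of "source d"] eq[of "target d"] assms source_neq_target[of d]
    by (auto simp: edge_point_nth ends_def split: if_splits)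
qed

lemma vertex_not_interior: "t \<in> {0<..<1} \<Longrightarrow> axis v 1 \<noteq> edge_point e t"
proof
  assume t: "t \<in> {0<..<1}" and "axis v 1 = edge_point e t"
  then have eq: "axis v 1 $ w = edge_point e t $ w" for w by simp
  show False using eq[of "source e"] eq[of "target e"] t source_neq_target[of e]
    by (auto simp: edge_point_nth axis_def split: if_splits)
qed

lemma continuous_edge_point: "continuous_on S (edge_point e)"
  unfolding edge_point_def by (intro continuous_intros)

section \<open>Transversal crossings in complex coordinates\<close>

definition pc :: "real ^ 2 \<Rightarrow> complex" where
  "pc x = Complex (x $ 1) (x $ 2)"

lemma bounded_linear_pc: "bounded_linear pc"
proof -
  have "linear pc" by (rule linearI) (auto simp: pc_def complex_eq_iff)
  then show ?thesis by (simp add: linear_conv_bounded_linear)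
qed

lemma pc_eq_iff: "pc x = pc y \<longleftrightarrow> x = y"
  by (auto simp: pc_def vec_eq_iff forall_2)

text \<open>If the determinant vanished, some nonzero vector would be perpendicular to both
  \<open>v\<close> and \<open>w\<close>, hence to their span, hence to itself.\<close>

lemma span_UNIV_imp_det:
  fixes v w :: "real ^ 2"
  assumes "span {v, w} = UNIV"
  shows "det (vector [v, w] :: real ^ 2 ^ 2) \<noteq> 0"
proof
  assume "det (vector [v, w] :: real ^ 2 ^ 2) = 0"
  then have d: "v $ 1 * w $ 2 - v $ 2 * w $ 1 = 0" by (simp add: det_2)
  obtain n :: "real ^ 2" where n: "n \<noteq> 0" "n \<bullet> v = 0" "n \<bullet> w = 0"
  proof (cases "v = 0 \<and> w = 0")
    case True
    then show ?thesis using that[of "axis 1 1"] by (simp add: axis_eq_0_iff)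
  next
    case False
    define x where "x = (if v = 0 then w else v)"
    have x: "x \<noteq> 0" using False by (auto simp: x_def)
    have "(vector [- x $ 2, x $ 1] :: real ^ 2) \<noteq> 0"
      using x by (auto simp: vec_eq_iff forall_2)
    moreover have "vector [- x $ 2, x $ 1] \<bullet> v = 0" "vector [- x $ 2, x $ 1] \<bullet> w = 0"
      using d by (auto simp: x_def inner_vec_def sum_2 algebra_simps)
    ultimately show ?thesis by (rule that)
  qed
  have "n \<in> span {v, w}" using assms by simp
  then have "orthogonal n n"
    by (rule orthogonal_to_span) (use n in \<open>auto simp: orthogonal_def\<close>)
  then show False using n(1) by (simp add: orthogonal_self)
qed

text \<open>Genericity names the two preimages in no particular order; the symmetry of
  transversality lets them be matched with \<open>x\<close> and \<open>y\<close>.\<close>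

lemma multiple_point_cases:
  assumes "plane_generic_immersion f" "x \<in> PG" "y \<in> PG" "x \<noteq> y" "f x = f y"
  obtains d e s t where "s \<in> {0<..<1}" "t \<in> {0<..<1}" "x = edge_point d s" "y = edge_point e t"
    "transversal_at f d s e t" "{z \<in> PG. f z = f x} = {x, y}"
proof -
  have "f x \<in> multiple_points f" using assms(2-5) unfolding multiple_points_def by blast
  then obtain d e s t where *: "s \<in> {0<..<1}" "t \<in> {0<..<1}" "edge_point d s \<noteq> edge_point e t"
    "{z \<in> PG. f z = f x} = {edge_point d s, edge_point e t}" "transversal_at f d s e t"
    using assms(1) unfolding plane_generic_immersion_def by blast
  have "{x, y} \<subseteq> {edge_point d s, edge_point e t}" using assms(2,3,5) *(4) by auto
  then have xy: "x = edge_point d s \<and> y = edge_point e t \<or> x = edge_point e t \<and> y = edge_point d s"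
    using assms(4) by auto
  have sym: "transversal_at f e t d s"
    using *(5) by (simp add: transversal_at_def insert_commute)
  from xy show ?thesis
  proof
    assume "x = edge_point d s \<and> y = edge_point e t"
    then show ?thesis using that[of s t d e] * by simp
  next
    assume "x = edge_point e t \<and> y = edge_point d s"
    then show ?thesis using that[of t s e d] * sym by (simp add: insert_commute)
  qed
qed

definition crossings :: "(pg_point \<Rightarrow> real ^ 2) \<Rightarrow> pg_edge \<Rightarrow> pg_edge \<Rightarrow> (real \<times> real) set" where
  "crossings f d e = {(s, t). s \<in> {0..1} \<and> t \<in> {0..1} \<and> f (edge_point d s) = f (edge_point e t)}"

definition edge_curve :: "(pg_point \<Rightarrow> real ^ 2) \<Rightarrow> pg_edge \<Rightarrow> real \<Rightarrow> complex" where
  "edge_curve f d s = pc (f (edge_point d s))"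

definition edge_velocity :: "(pg_point \<Rightarrow> real ^ 2) \<Rightarrow> pg_edge \<Rightarrow> real \<Rightarrow> complex" where
  "edge_velocity f d s = pc (velocity f d s)"

definition crossing_det :: "(pg_point \<Rightarrow> real ^ 2) \<Rightarrow> pg_edge \<Rightarrow> pg_edge \<Rightarrow> real \<times> real \<Rightarrow> real" where
  "crossing_det f d e k = Im (cnj (edge_velocity f d (fst k)) * edge_velocity f e (snd k))"

lemma det_velocity:
  "det (vector [velocity f d s, velocity f e t] :: real ^ 2 ^ 2) = crossing_det f d e (s, t)"
  by (simp add: crossing_det_def edge_velocity_def pc_def det_2)

locale generic_immersion =
  fixes f :: "pg_point \<Rightarrow> real ^ 2"
  assumes generic: "plane_generic_immersion f"
begin

lemma continuous_f: "continuous_on PG f"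
  using generic by (simp add: plane_generic_immersion_def plane_immersion_def)

lemma continuous_edge: "continuous_on {0..1} (\<lambda>s. f (edge_point d s))"
  by (rule continuous_on_compose2[OF continuous_f continuous_edge_point]) (auto intro: edge_point_in_PG)

lemma crossing_facts:
  assumes "ends d \<inter> ends e = {}" "(s, t) \<in> crossings f d e"
  shows "s \<in> {0<..<1}" "t \<in> {0<..<1}" "transversal_at f d s e t"
    "{z \<in> PG. f z = f (edge_point d s)} = {edge_point d s, edge_point e t}"
proof -
  have I: "s \<in> {0..1}" "t \<in> {0..1}" "f (edge_point d s) = f (edge_point e t)"
    using assms(2) by (auto simp: crossings_def)
  have "edge_point d s \<noteq> edge_point e t" using edge_point_neq[OF assms(1) I(1,2)] .
  then obtain d' e' s' t' where *: "s' \<in> {0<..<1}" "t' \<in> {0<..<1}" "edge_point d s = edge_point d' s'"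
    "edge_point e t = edge_point e' t'" "transversal_at f d' s' e' t'"
    "{z \<in> PG. f z = f (edge_point d s)} = {edge_point d s, edge_point e t}"
    by (rule multiple_point_cases[OF generic edge_point_in_PG[OF I(1)] edge_point_in_PG[OF I(2)] _ I(3)])
  have "d = d' \<and> s = s'" "e = e' \<and> t = t'"
    using edge_point_eq_interior[OF *(3) I(1) *(1)] edge_point_eq_interior[OF *(4) I(2) *(2)] .
  then show "s \<in> {0<..<1}" "t \<in> {0<..<1}" "transversal_at f d s e t"
    "{z \<in> PG. f z = f (edge_point d s)} = {edge_point d s, edge_point e t}"
    using * by auto
qed

text \<open>A multiple point has exactly two preimages, here one on each of two disjoint edges, so
  it determines both parameters. Counting parameter pairs and counting points of the plane thus
  agree.\<close>

lemma inj_on_crossings: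
  assumes "ends d \<inter> ends e = {}"
  shows "inj_on (\<lambda>k. f (edge_point d (fst k))) (crossings f d e)"
proof (rule inj_onI, clarify)
  fix s t s' t' assume k: "(s, t) \<in> crossings f d e" "(s', t') \<in> crossings f d e"
    and eq: "f (edge_point d (fst (s, t))) = f (edge_point d (fst (s', t')))"
  have I: "s \<in> {0..1}" "t \<in> {0..1}" "s' \<in> {0..1}" "t' \<in> {0..1}" using k by (auto simp: crossings_def)
  have "{edge_point d s, edge_point e t} = {edge_point d s', edge_point e t'}"
    using crossing_facts(4)[OF assms k(1)] crossing_facts(4)[OF assms k(2)] eq by simp
  then have "edge_point d s = edge_point d s'" "edge_point e t = edge_point e t'"
    using edge_point_neq[OF assms I(1,4)] edge_point_neq[OF assms I(3,2)] by (auto simp: doubleton_eq_iff)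
  then show "s = s' \<and> t = t'" using edge_point_inj by blast
qed

lemma finite_crossings:
  assumes "ends d \<inter> ends e = {}"
  shows "finite (crossings f d e)"
proof (rule inj_on_finite[OF inj_on_crossings[OF assms]])
  show "finite (multiple_points f)" using generic by (simp add: plane_generic_immersion_def)
  show "(\<lambda>k. f (edge_point d (fst k))) ` crossings f d e \<subseteq> multiple_points f"
  proof clarify
    fix s t assume "(s, t) \<in> crossings f d e"
    then have I: "s \<in> {0..1}" "t \<in> {0..1}" "f (edge_point d s) = f (edge_point e t)" by (auto simp: crossings_def)
    then show "f (edge_point d (fst (s, t))) \<in> multiple_points f"
      using edge_point_neq[OF assms I(1,2)] edge_point_in_PG[OF I(1)] edge_point_in_PG[OF I(2)]
      unfolding multiple_points_def mem_Collect_eq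
      by (intro exI[of _ "edge_point d s"] exI[of _ "edge_point e t"]) simp
  qed
qed

lemma crossing_det_nonzero:
  assumes "ends d \<inter> ends e = {}" "k \<in> crossings f d e"
  shows "crossing_det f d e k \<noteq> 0"
  using crossing_facts(3)[OF assms(1), of "fst k" "snd k"] assms(2)
    span_UNIV_imp_det[of "velocity f d (fst k)" "velocity f e (snd k)"]
  by (auto simp: transversal_at_def det_velocity)

lemma has_edge_velocity:
  assumes "(\<lambda>r. f (edge_point d r)) differentiable (at s)"
  shows "(edge_curve f d has_vector_derivative edge_velocity f d s) (at s)"
  unfolding edge_curve_def[abs_def] edge_velocity_def
  by (rule bounded_linear.has_vector_derivative[OF bounded_linear_pc])
    (use assms vector_derivative_works in \<open>auto simp: velocity_def\<close>)

lemma curve_pair_edges: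
  assumes "ends d \<inter> ends e = {}"
  shows "curve_pair (edge_curve f d) (edge_curve f e) (edge_velocity f d) (edge_velocity f e) (crossings f d e)"
proof
  have cont: "continuous_on {0..1} (edge_curve f c)" for c
    unfolding edge_curve_def[abs_def]
    by (rule bounded_linear.continuous_on[OF bounded_linear_pc continuous_edge])
  then show "continuous_on {0..1} (edge_curve f d)" "continuous_on {0..1} (edge_curve f e)" by auto
  show "finite (crossings f d e)" by (rule finite_crossings[OF assms])
  fix s t
  show "edge_curve f d s = edge_curve f e t \<longleftrightarrow> (s, t) \<in> crossings f d e" if "s \<in> {0..1}" "t \<in> {0..1}"
    using that by (simp add: edge_curve_def pc_eq_iff crossings_def)
  assume k: "(s, t) \<in> crossings f d e"
  show "s \<in> {0<..<1} \<and> t \<in> {0<..<1}" using crossing_facts[OF assms k] by simp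
  show "(edge_curve f d has_vector_derivative edge_velocity f d s) (at s)"
    "(edge_curve f e has_vector_derivative edge_velocity f e t) (at t)"
    using crossing_facts(3)[OF assms k] by (auto intro: has_edge_velocity simp: transversal_at_def)
  show "Im (cnj (edge_velocity f d s) * edge_velocity f e t) \<noteq> 0"
    using crossing_det_nonzero[OF assms k] by (simp add: crossing_det_def)
qed

lemma card_common_points:
  assumes "ends d \<inter> ends e = {}"
  shows "card (f ` edge_set d \<inter> f ` edge_set e) = card (crossings f d e)"
proof -
  have "f ` edge_set d \<inter> f ` edge_set e = (\<lambda>k. f (edge_point d (fst k))) ` crossings f d e"
    by (force simp: edge_set_def crossings_def)
  then show ?thesis by (simp add: card_image[OF inj_on_crossings[OF assms]])
qed

text \<open>Double points have interior preimages only. Hence an angle under which an edge is seen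
  from a vertex off it is well defined.\<close>

lemma vertex_neq:
  assumes "y \<in> PG" "y \<noteq> axis v 1" "axis v 1 \<in> PG"
  shows "f y \<noteq> f (axis v 1)"
proof
  assume "f y = f (axis v 1)"
  then show False
  proof (rule multiple_point_cases[OF generic assms(1,3,2)])
    fix e t assume "t \<in> {0<..<1}" "axis v 1 = edge_point e t"
    then show False using vertex_not_interior by blast
  qed
qed

end

section \<open>Parity of the number of crossings\<close>

lemma cis_eq_int:
  assumes "cis x = cis y"
  obtains k :: int where "x = y + 2 * pi * k"
proof -
  have "cis (x - y) = 1" using assms by (simp flip: cis_divide)
  then obtain k :: int where "x - y = 2 * pi * k" by (rule cis_eq_1_int)
  then show ?thesis by (intro that[of k]) simp
qed

lemma cis_Arg_uminus: "z \<noteq> 0 \<Longrightarrow> cis (Arg (- z)) = cis (Arg z + pi)"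
  by (simp add: cis_Arg sgn_minus flip: cis_mult)

lemma cis_ang_diff: "p \<noteq> 0 \<Longrightarrow> q \<noteq> 0 \<Longrightarrow> cis (ang p q) = cis (Arg q - Arg p)"
  by (simp add: ang_def cis_Arg_mult cis_Arg_cnj flip: cis_mult) (simp add: cis_mult)

lemma sum_ang_mod:
  fixes z :: "nat \<Rightarrow> complex"
  assumes "\<And>i. i \<le> n \<Longrightarrow> z i \<noteq> 0"
  shows "\<exists>m :: int. (\<Sum>i<n. ang (z i) (z (Suc i))) = Arg (z n) - Arg (z 0) + 2 * pi * m"
proof -
  have "cis (\<Sum>i<n. ang (z i) (z (Suc i))) = cis (Arg (z n) - Arg (z 0))"
    using assms
  proof (induction n)
    case (Suc n)
    have "cis (\<Sum>i<Suc n. ang (z i) (z (Suc i))) = cis (Arg (z n) - Arg (z 0)) * cis (Arg (z (Suc n)) - Arg (z n))"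
      using Suc by (simp add: cis_ang_diff flip: cis_mult)
    then show ?case by (simp add: cis_mult)
  qed simp
  then show ?thesis by (rule cis_eq_int) blast
qed

lemma axis_in_PG: "axis v 1 \<in> PG"
proof -
  have "axis (source e) 1 \<in> PG" for e using edge_point_in_PG[of 0 e] by simp
  from this[of "UU i" for i] this[of "VV i" for i] show ?thesis by (cases v) auto
qed

definition vertex_arg :: "(pg_point \<Rightarrow> real ^ 2) \<Rightarrow> pg_vertex \<Rightarrow> pg_vertex \<Rightarrow> real" where
  "vertex_arg f x y = Arg (pc (f (axis x 1)) - pc (f (axis y 1)))"

definition edge_arg :: "(pg_point \<Rightarrow> real ^ 2) \<Rightarrow> nat \<Rightarrow> pg_edge \<Rightarrow> pg_vertex \<Rightarrow> real" where
  "edge_arg f n e v = (\<Sum>i<n. ang (edge_curve f e (i / n) - pc (f (axis v 1)))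
    (edge_curve f e (Suc i / n) - pc (f (axis v 1))))"

text \<open>The signs here come from the tangents in the fixed order \<open>d\<close>,
  \<open>e\<close>, without over/under information. The sum has the parity of the number of
  crossings and is what a winding number computes.\<close>

definition crossing_number :: "(pg_point \<Rightarrow> real ^ 2) \<Rightarrow> pg_edge \<Rightarrow> pg_edge \<Rightarrow> int" where
  "crossing_number f d e = (\<Sum>k\<in>crossings f d e. if crossing_det f d e k > 0 then 1 else -1)"

lemma edge_curve_0: "edge_curve f e 0 = pc (f (axis (source e) 1))"
  and edge_curve_1: "edge_curve f e 1 = pc (f (axis (target e) 1))"
  by (simp_all add: edge_curve_def)

lemma ang_flip: "ang (a - b) (a - c) = ang (b - a) (c - a)"
proof -
  have "(a - c) * cnj (a - b) = (c - a) * cnj (b - a)" by (simp add: algebra_simps)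
  then show ?thesis by (simp only: ang_def)
qed

context generic_immersion
begin

lemma vertex_arg_swap:
  assumes "x \<noteq> y"
  shows "\<exists>k :: int. vertex_arg f y x = vertex_arg f x y + pi + 2 * pi * k"
proof -
  let ?z = "pc (f (axis x 1)) - pc (f (axis y 1))"
  have "axis x 1 \<noteq> (axis y 1 :: pg_point)" using assms by (simp add: axis_eq_axis)
  then have "?z \<noteq> 0" using vertex_neq[OF axis_in_PG _ axis_in_PG] by (simp add: pc_eq_iff)
  then have "cis (Arg (- ?z)) = cis (Arg ?z + pi)" by (rule cis_Arg_uminus)
  then obtain k :: int where "Arg (- ?z) = Arg ?z + pi + 2 * pi * k" by (rule cis_eq_int)
  then show ?thesis by (intro exI[of _ k]) (simp add: vertex_arg_def)
qed

lemma edge_arg_mod: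
  assumes "v \<notin> ends e" "n > 0"
  shows "\<exists>m :: int. edge_arg f n e v = vertex_arg f (target e) v - vertex_arg f (source e) v + 2 * pi * m"
proof -
  define z where "z i = edge_curve f e (i / n) - pc (f (axis v 1))" for i :: nat
  have "z i \<noteq> 0" if "i \<le> n" for i
  proof -
    have I: "real i / n \<in> {0..1}" using that assms(2) by simp
    have "edge_point e (i / n) $ v \<noteq> axis v 1 $ v" using assms(1) by (auto simp: edge_point_nth ends_def)
    then have "edge_point e (i / n) \<noteq> axis v 1" by metis
    from vertex_neq[OF edge_point_in_PG[OF I] this axis_in_PG] show ?thesis
      by (simp add: z_def edge_curve_def pc_eq_iff)
  qed
  from sum_ang_mod[of n z, OF this] show ?thesis
    using assms(2) by (simp add: edge_arg_def vertex_arg_def z_def edge_curve_0 edge_curve_1)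
qed

text \<open>On each side of the parameter square one of the curves rests at a vertex, so the
  boundary winding consists of angles seen from vertices. On the vertical sides the difference has
  the opposite sign, which \<open>ang_flip\<close> absorbs.\<close>

lemma eventually_crossing_number:
  assumes "ends d \<inter> ends e = {}"
  shows "\<forall>\<^sub>F n in sequentially. 2 * pi * crossing_number f d e =
    edge_arg f n d (target e) + edge_arg f n e (source d) - edge_arg f n d (source e) - edge_arg f n e (target d)"
proof -
  interpret curve_pair "edge_curve f d" "edge_curve f e" "edge_velocity f d" "edge_velocity f e" "crossings f d e"
    by (rule curve_pair_edges[OF assms])
  have sgn: "(\<Sum>k\<in>crossings f d e. sgn (Im (cnj (edge_velocity f d (fst k)) * edge_velocity f e (snd k)))) =
      of_int (crossing_number f d e)"
    unfolding crossing_number_def of_int_sum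
  proof (rule sum.cong[OF refl])
    fix k assume "k \<in> crossings f d e"
    then show "sgn (Im (cnj (edge_velocity f d (fst k)) * edge_velocity f e (snd k))) =
        real_of_int (if crossing_det f d e k > 0 then 1 else -1)"
      using crossing_det_nonzero[OF assms, of k] unfolding crossing_det_def[symmetric] by (simp add: sgn_if)
  qed
  from eventually_winding eventually_gt_at_top[of 0] show ?thesis
  proof eventually_elim
    case (elim n)
    have h: "(\<Sum>i<n. hang n i 0) = edge_arg f n d (source e)" "(\<Sum>i<n. hang n i n) = edge_arg f n d (target e)"
      using elim(2) by (simp_all add: hang_def W_def edge_arg_def edge_curve_0 edge_curve_1)
    have v: "(\<Sum>j<n. vang n 0 j) = edge_arg f n e (source d)" "(\<Sum>j<n. vang n n j) = edge_arg f n e (target d)"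
      using elim(2) by (simp_all add: vang_def W_def edge_arg_def edge_curve_0 edge_curve_1 ang_flip[of "pc x" for x])
    show ?case using elim(1) unfolding rect_bd_def atLeast0LessThan h v sgn by simp
  qed
qed

theorem crossings_parity: "odd (\<Sum>P\<in>D1. int (num_common_points f P))"
proof -
  define G where "G d e = int (num_common_points f (Upair d e))" for d e
  \<comment> \<open>The sign is the one expected by \<open>orbit_sum_odd\<close>. Off the support of
    \<open>eps\<close> the value \<open>G d e\<close> makes \<open>G d e - N d e\<close> even for
    all pairs, so the terms of an orbit sum need no separate check.\<close>
  define N where "N d e = (if eps (Upair d e) \<noteq> 0 then - crossing_number f d e else G d e)" for d e
  have G: "G d e = card (crossings f d e)" if "ends d \<inter> ends e = {}" for d e
  proof -
    have "num_common_points f (Upair d e) = card (f ` edge_set d \<inter> f ` edge_set e)" by transfer simp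
    then show ?thesis by (simp add: G_def card_common_points[OF that])
  qed
  have par: "even (G d e - N d e)" for d e
  proof (cases "eps (Upair d e) = 0")
    case False
    have "even (\<Sum>k\<in>crossings f d e. 1 + (if crossing_det f d e k > 0 then 1 else - 1 :: int))"
      by (intro dvd_sum) auto
    then show ?thesis using False G[OF eps_disjoint[OF False]]
      by (simp add: N_def crossing_number_def sum.distrib)
  qed (simp add: N_def)
  have "\<forall>\<^sub>F n in sequentially. \<forall>d\<in>UNIV. \<forall>e\<in>UNIV. eps (Upair d e) \<noteq> 0 \<longrightarrow> 2 * pi * crossing_number f d e =
      edge_arg f n d (target e) + edge_arg f n e (source d) - edge_arg f n d (source e) - edge_arg f n e (target d)"
  proof (intro eventually_ball_finite finite ballI)
    fix d e
    show "\<forall>\<^sub>F n in sequentially. eps (Upair d e) \<noteq> 0 \<longrightarrow> 2 * pi * crossing_number f d e =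
      edge_arg f n d (target e) + edge_arg f n e (source d) - edge_arg f n d (source e) - edge_arg f n e (target d)"
      using eventually_crossing_number[OF eps_disjoint, of d e] by (cases "eps (Upair d e) = 0") auto
  qed
  from eventually_happens[OF eventually_conj[OF this eventually_gt_at_top[of 0]]]
  obtain n where n: "n > 0" "\<And>d e. eps (Upair d e) \<noteq> 0 \<Longrightarrow> 2 * pi * crossing_number f d e =
      edge_arg f n d (target e) + edge_arg f n e (source d) - edge_arg f n d (source e) - edge_arg f n e (target d)"
    by (auto simp: trivial_limit_sequentially)
  have "odd (\<Sum>i\<in>UNIV. orbit_sum N i)"
    using n(2) edge_arg_mod[OF _ n(1)] vertex_arg_swap
    by (intro orbit_sum_odd[of N "edge_arg f n" "vertex_arg f"]) (auto simp: N_def)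
  moreover have "even (\<Sum>i\<in>UNIV. orbit_sum G i - orbit_sum N i)"
  proof (rule dvd_sum)
    fix i
    have "orbit_sum G i - orbit_sum N i = orbit_sum (\<lambda>d e. G d e - N d e) i" by (simp add: orbit_sum_def)
    also have "even \<dots>" unfolding orbit_sum_def by (intro dvd_add par)
    finally show "even (orbit_sum G i - orbit_sum N i)" .
  qed
  moreover have "(\<Sum>P\<in>D1. int (num_common_points f P)) = (\<Sum>i\<in>UNIV. orbit_sum G i)"
  proof -
    have "2 * (\<Sum>P\<in>D1. int (num_common_points f P)) = 2 * (\<Sum>i\<in>UNIV. orbit_sum G i)"
      unfolding sum_D1 G_def[symmetric] by (rule sum_orbits) (simp add: G_def Upair_commute)
    then show ?thesis by simp
  qed
  ultimately show ?thesis by (simp add: sum_subtractf)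
qed

end

section \<open>The invariant of a diagram as a sum of Berry phases\<close>

text \<open>Oriented from the point of \<open>e\<close> to the point of \<open>d\<close>: at a
  crossing it is the north pole precisely when \<open>d\<close> is the upper strand.\<close>

definition direction :: "(pg_point \<Rightarrow> real ^ 3) \<Rightarrow> pg_edge \<Rightarrow> pg_edge \<Rightarrow> real \<Rightarrow> real \<Rightarrow> real ^ 3" where
  "direction \<phi> d e s t = sgn (\<phi> (edge_point d s) - \<phi> (edge_point e t))"

definition berry_sum :: "(pg_point \<Rightarrow> real ^ 3) \<Rightarrow> nat \<Rightarrow> real" where
  "berry_sum \<phi> n = (\<Sum>d\<in>UNIV. \<Sum>e\<in>UNIV. of_int (eps (Upair d e)) * (\<Sum>i<n. \<Sum>j<n. berry (direction \<phi> d e) n i j))"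

text \<open>\<open>eps_closed\<close> is used in each factor separately; the symmetry of
  \<open>eps\<close> reduces the vertical sides to the horizontal case.\<close>

lemma eps_closed_cells:
  fixes H :: "pg_edge \<Rightarrow> pg_vertex \<Rightarrow> real" and V :: "pg_vertex \<Rightarrow> pg_edge \<Rightarrow> real"
  shows "(\<Sum>d\<in>UNIV. \<Sum>e\<in>UNIV. of_int (eps (Upair d e)) *
    (H d (source e) + V (target d) e - H d (target e) - V (source d) e)) = 0"
proof -
  have "(\<Sum>d\<in>UNIV. \<Sum>e\<in>UNIV. of_int (eps (Upair d e)) *
      (H d (source e) + V (target d) e - H d (target e) - V (source d) e)) =
    (\<Sum>d\<in>UNIV. \<Sum>e\<in>UNIV. of_int (eps (Upair d e)) * (V (target d) e - V (source d) e))
    - (\<Sum>d\<in>UNIV. \<Sum>e\<in>UNIV. of_int (eps (Upair d e)) * (H d (target e) - H d (source e)))"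
    unfolding sum_subtractf[symmetric] by (intro sum.cong refl) (simp add: algebra_simps)
  also have "(\<Sum>d\<in>UNIV. \<Sum>e\<in>UNIV. of_int (eps (Upair d e)) * (V (target d) e - V (source d) e))
      = (\<Sum>e\<in>UNIV. \<Sum>d\<in>UNIV. of_int (eps (Upair e d)) * (V (target d) e - V (source d) e))"
  proof (rule trans[OF sum.swap], intro sum.cong refl)
    fix d e
    show "of_int (eps (Upair d e)) * (V (target d) e - V (source d) e)
        = of_int (eps (Upair e d)) * (V (target d) e - V (source d) e)"
      by (subst Upair_commute) (rule refl)
  qed
  also have "\<dots> = 0" by (simp add: eps_closed[of _ "\<lambda>v. V v _"])
  finally show ?thesis by (simp add: eps_closed)
qed

text \<open>A side of the cell \<open>d \<times> e\<close> depends on one edge and one vertex only,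
  so the sides cancel under the weights \<open>eps\<close>. Any frame \<open>g\<close> is allowed:
  \<open>spin_s\<close> is used at a diagram, \<open>spin\<close> at arbitrary times.\<close>

lemma berry_sum_eval:
  fixes g :: "real ^ 3 \<Rightarrow> spinor" and x :: "pg_edge \<Rightarrow> pg_edge \<Rightarrow> real"
  assumes "n > 0"
    and "\<And>d e. eps (Upair d e) \<noteq> 0 \<Longrightarrow> (\<Sum>i<n. \<Sum>j<n. berry (direction \<phi> d e) n i j) =
      rect_bd (hbr g (direction \<phi> d e) n) (vbr g (direction \<phi> d e) n) 0 n 0 n + 2 * pi * x d e"
  shows "berry_sum \<phi> n = 2 * pi * (\<Sum>d\<in>UNIV. \<Sum>e\<in>UNIV. of_int (eps (Upair d e)) * x d e)"
proof -
  define H where "H d v = (\<Sum>i<n. Arg (bracket (g (sgn (\<phi> (edge_point d (i / n)) - \<phi> (axis v 1))))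
      (g (sgn (\<phi> (edge_point d (Suc i / n)) - \<phi> (axis v 1))))))" for d v
  define V where "V v e = (\<Sum>j<n. Arg (bracket (g (sgn (\<phi> (axis v 1) - \<phi> (edge_point e (j / n)))))
      (g (sgn (\<phi> (axis v 1) - \<phi> (edge_point e (Suc j / n)))))))" for e v
  have bd: "rect_bd (hbr g (direction \<phi> d e) n) (vbr g (direction \<phi> d e) n) 0 n 0 n =
      H d (source e) + V (target d) e - H d (target e) - V (source d) e" for d e
    using assms(1) by (simp add: rect_bd_def atLeast0LessThan hbr_def vbr_def direction_def H_def V_def)
  have "berry_sum \<phi> n = (\<Sum>d\<in>UNIV. \<Sum>e\<in>UNIV. of_int (eps (Upair d e)) *
      (H d (source e) + V (target d) e - H d (target e) - V (source d) e) +
      2 * pi * (of_int (eps (Upair d e)) * x d e))"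
    unfolding berry_sum_def
  proof (intro sum.cong refl)
    fix d e
    show "of_int (eps (Upair d e)) * (\<Sum>i<n. \<Sum>j<n. berry (direction \<phi> d e) n i j) =
        of_int (eps (Upair d e)) * (H d (source e) + V (target d) e - H d (target e) - V (source d) e) +
        2 * pi * (of_int (eps (Upair d e)) * x d e)"
    proof (cases "eps (Upair d e) = 0")
      case False
      show ?thesis unfolding assms(2)[OF False] bd by (simp add: algebra_simps)
    qed simp
  qed
  then show ?thesis
    using eps_closed_cells[of H V] by (simp add: sum.distrib sum_distrib_left)
qed

section \<open>Integrality and constancy of the Berry sum along an isotopy\<close>

lemma bargmann_regular:
  assumes "norm a = 1" "norm b = 1" "norm c = 1" "norm d = 1"
    and "norm (b - a) < 1 / 12" "norm (c - a) < 1 / 12" "norm (d - a) < 1 / 12"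
  shows "bargmann a b c d \<notin> \<real>\<^sub>\<le>\<^sub>0"
proof -
  have near: "norm (c - b) < 1 / 6" "norm (c - d) < 1 / 6"
    using norm_triangle_ineq4[of "c - a" "b - a"] norm_triangle_ineq4[of "c - a" "d - a"] assms(5-7) by auto
  have z: "\<bar>b $ 3 - a $ 3\<bar> < 1 / 12" "\<bar>d $ 3 - a $ 3\<bar> < 1 / 12" "\<bar>c $ 3 - a $ 3\<bar> < 1 / 12"
    using component_le_norm_cart[of "b - a" 3] component_le_norm_cart[of "d - a" 3]
      component_le_norm_cart[of "c - a" 3] assms(5-7) by simp_all
  obtain x where x: "represents (x a) a" "represents (x b) b" "represents (x c) c" "represents (x d) d"
    "narrow (bracket (x a) (x b))" "narrow (bracket (x b) (x c))" "narrow (bracket (x d) (x c))"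
    "narrow (bracket (x a) (x d))"
  \<comment> \<open>With the frame of the hemisphere of \<open>a\<close>, the right-hand sides in
    the narrowness conditions exceed 11 / 12, as heights vary by less than 1 / 12, whereas three
    times a side is less than 1 / 2.\<close>
  proof (cases "a $ 3 \<le> 0")
    case True
    then show ?thesis
      by (intro that[of spin_s] represents_spin_s narrow_bracket_spin_s assms(1-4))
        (use assms(5-7) near z in linarith)+
  next
    case False
    then show ?thesis
      by (intro that[of spin_n] represents_spin_n narrow_bracket_spin_n assms(1-4))
        (use assms(5-7) near z in linarith)+
  qed
  obtain l where l: "l > 0" "bargmann a b c d =
      of_real l * (bracket (x a) (x b) * bracket (x b) (x c) * cnj (bracket (x d) (x c)) * cnj (bracket (x a) (x d)))"
    using bargmann_bracket[OF x(1-4)] .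
  then have "bargmann a b c d \<noteq> 0" using x(5-8)[THEN narrow_nonzero] by simp
  \<comment> \<open>Staying off the negative reals is what makes the phase continuous in
    time.\<close>
  moreover have "Arg (bargmann a b c d) \<noteq> pi"
    unfolding Arg_bargmann_narrow[OF x(1-8)] using x(5-8)[THEN narrow_Arg] by linarith
  ultimately show ?thesis
    unfolding Arg_eq_pi complex_nonpos_Reals_iff by (auto simp: complex_eq_iff)
qed

lemma continuous_on_bargmann:
  assumes "continuous_on S a" "continuous_on S b" "continuous_on S c" "continuous_on S d"
  shows "continuous_on S (\<lambda>t. bargmann (a t) (b t) (c t) (d t))"
  unfolding bargmann_def Let_def pw_def by (intro continuous_intros assms)

text \<open>The frame \<open>spin\<close> covers every direction, so each square matches its
  boundary modulo 2 * pi; the boundaries cancel in the weighted sum and the integers remain.\<close>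

lemma berry_sum_integral:
  assumes n: "n > 0"
    and nz: "\<And>d e s t. eps (Upair d e) \<noteq> 0 \<Longrightarrow> s \<in> {0..1} \<Longrightarrow> t \<in> {0..1} \<Longrightarrow> \<phi> (edge_point d s) \<noteq> \<phi> (edge_point e t)"
    and reg: "\<And>d e i j. eps (Upair d e) \<noteq> 0 \<Longrightarrow> i < n \<Longrightarrow> j < n \<Longrightarrow>
      bargmann (direction \<phi> d e (i / n) (j / n)) (direction \<phi> d e (Suc i / n) (j / n))
        (direction \<phi> d e (Suc i / n) (Suc j / n)) (direction \<phi> d e (i / n) (Suc j / n)) \<noteq> 0"
  shows "\<exists>k :: int. berry_sum \<phi> n = 2 * pi * k"
proof -
  define x where "x d e = (SOME k :: int. (\<Sum>i<n. \<Sum>j<n. berry (direction \<phi> d e) n i j) =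
      rect_bd (hbr spin (direction \<phi> d e) n) (vbr spin (direction \<phi> d e) n) 0 n 0 n + 2 * pi * k)" for d e
  have "(\<Sum>i<n. \<Sum>j<n. berry (direction \<phi> d e) n i j) =
      rect_bd (hbr spin (direction \<phi> d e) n) (vbr spin (direction \<phi> d e) n) 0 n 0 n + 2 * pi * x d e"
    if eps: "eps (Upair d e) \<noteq> 0" for d e
  proof -
    let ?u = "\<lambda>i j :: nat. direction \<phi> d e (i / n) (j / n)"
    have rep: "represents (spin (?u i j)) (?u i j)" if "i \<le> n" "j \<le> n" for i j
    proof (rule represents_spin)
      have "real i / n \<in> {0..1}" "real j / n \<in> {0..1}" using that n by auto
      from nz[OF eps this] show "norm (?u i j) = 1" by (simp add: direction_def norm_sgn)
    qed
    have "cis (berry (direction \<phi> d e) n i j) =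
        cis (square_bd (hbr spin (direction \<phi> d e) n) (vbr spin (direction \<phi> d e) n) i j)" if "i < n" "j < n" for i j
      unfolding berry_def square_bd_def hbr_def vbr_def
      using that by (intro cis_Arg_bargmann rep reg[OF eps]) auto
    then have "\<exists>k :: int. (\<Sum>i<n. \<Sum>j<n. berry (direction \<phi> d e) n i j) =
        rect_bd (hbr spin (direction \<phi> d e) n) (vbr spin (direction \<phi> d e) n) 0 n 0 n + 2 * pi * k"
      by (rule sum_grid_cis) blast+
    from someI_ex[OF this] show ?thesis by (simp add: x_def)
  qed
  from berry_sum_eval[OF n this]
  have "berry_sum \<phi> n = 2 * pi * (\<Sum>d\<in>UNIV. \<Sum>e\<in>UNIV. of_int (eps (Upair d e)) * of_int (x d e))" .
  also have "\<dots> = 2 * pi * of_int (\<Sum>d\<in>UNIV. \<Sum>e\<in>UNIV. eps (Upair d e) * x d e)" by simp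
  finally show ?thesis by blast
qed

text \<open>The grid is fixed along the isotopy, so the sum depends continuously on time while it takes
  values in the integer multiples of \<open>2 * pi\<close>.\<close>

theorem eventually_berry_sum_isotopic:
  assumes cont: "continuous_on PG \<phi>" and inj: "inj_on \<phi> PG"
    and h: "continuous_on ({0..1} \<times> UNIV) (\<lambda>(\<tau>, p). h \<tau> p)"
    and hinj: "\<And>\<tau>. \<tau> \<in> {0..1} \<Longrightarrow> inj (h \<tau>)"
  shows "\<forall>\<^sub>F n in sequentially. berry_sum (h (0 :: real) \<circ> \<phi>) n = berry_sum (h 1 \<circ> \<phi>) n"
proof -
  define u where "u d e \<tau> s t = direction (h \<tau> \<circ> \<phi>) d e s t" for d e \<tau> s t
  \<comment> \<open>Time belongs to the compact domain, so a single grid is fine enough during the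
    whole isotopy.\<close>
  define C :: "(real \<times> real \<times> real) set" where "C = {0..1} \<times> {0..1} \<times> {0..1}"
  have nz: "h \<tau> (\<phi> (edge_point d s)) \<noteq> h \<tau> (\<phi> (edge_point e t))"
    if "eps (Upair d e) \<noteq> 0" "\<tau> \<in> {0..1}" "s \<in> {0..1}" "t \<in> {0..1}" for d e \<tau> s t
  proof -
    have "\<phi> (edge_point d s) \<noteq> \<phi> (edge_point e t)"
      using inj_onD[OF inj] edge_point_neq[OF eps_disjoint[OF that(1)] that(3,4)]
        edge_point_in_PG[OF that(3)] edge_point_in_PG[OF that(4)] by metis
    then show ?thesis using hinj[OF that(2)] by (simp add: inj_eq)
  qed
  have norm_u: "norm (u d e \<tau> s t) = 1"
    if "eps (Upair d e) \<noteq> 0" "\<tau> \<in> {0..1}" "s \<in> {0..1}" "t \<in> {0..1}" for d e \<tau> s t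
    using nz[OF that] by (simp add: u_def direction_def norm_sgn)
  have edge_cont: "continuous_on C (\<lambda>p. h (fst p) (\<phi> (edge_point d (g p))))"
    if "continuous_on C g" "g ` C \<subseteq> {0..1}" for g d
  proof -
    have "continuous_on C (\<lambda>p. \<phi> (edge_point d (g p)))"
      using that(2)
      by (intro continuous_on_compose2[OF cont] continuous_on_compose2[OF continuous_edge_point that(1)])
        (auto intro: edge_point_in_PG)
    then have "continuous_on C (\<lambda>p. (fst p, \<phi> (edge_point d (g p))))"
      by (intro continuous_intros)
    then have "continuous_on C (\<lambda>p. case (fst p, \<phi> (edge_point d (g p))) of (\<tau>, x) \<Rightarrow> h \<tau> x)"
      by (rule continuous_on_compose2[OF h]) (auto simp: C_def)
    then show ?thesis by simp
  qed
  have cont_u: "continuous_on C (\<lambda>p. u d e (fst p) (fst (snd p)) (snd (snd p)))" if eps: "eps (Upair d e) \<noteq> 0" for d e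
    unfolding u_def direction_def o_def
  proof (intro continuous_on_sgn continuous_on_diff edge_cont ballI)
    fix p assume "p \<in> C"
    then show "h (fst p) (\<phi> (edge_point d (fst (snd p)))) - h (fst p) (\<phi> (edge_point e (snd (snd p)))) \<noteq> 0"
      using nz[OF eps] by (auto simp: C_def)
  qed (auto simp: C_def intro!: continuous_intros)
  have step: "\<forall>\<^sub>F n in sequentially. \<forall>\<tau>\<in>{0..1}. \<forall>s\<in>{0..1}. \<forall>t\<in>{0..1}. \<forall>s'\<in>{0..1}. \<forall>t'\<in>{0..1}.
      \<bar>s' - s\<bar> \<le> 1 / real n \<and> \<bar>t' - t\<bar> \<le> 1 / real n \<longrightarrow> norm (u d e \<tau> s' t' - u d e \<tau> s t) < 1 / 12"
    if eps: "eps (Upair d e) \<noteq> 0" for d e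
  proof -
    have "uniformly_continuous_on C (\<lambda>p. u d e (fst p) (fst (snd p)) (snd (snd p)))"
      using cont_u[OF eps] unfolding C_def by (intro compact_uniformly_continuous compact_Times) auto
    then obtain \<delta> where \<delta>: "\<delta> > 0" "\<And>p q. p \<in> C \<Longrightarrow> q \<in> C \<Longrightarrow> dist q p < \<delta> \<Longrightarrow>
        dist (u d e (fst q) (fst (snd q)) (snd (snd q))) (u d e (fst p) (fst (snd p)) (snd (snd p))) < 1 / 12"
      unfolding uniformly_continuous_on_def by (metis zero_less_divide_1_iff zero_less_numeral)
    have "\<forall>\<^sub>F n in sequentially. 1 / real n < \<delta> / 2"
      using \<delta>(1) by (intro order_tendstoD(2)[OF lim_1_over_n]) simp
    then show ?thesis
    proof eventually_elim
      case (elim n)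
      show ?case
      proof (intro ballI impI)
        fix \<tau> s t s' t' :: real
        assume I: "\<tau> \<in> {0..1}" "s \<in> {0..1}" "t \<in> {0..1}" "s' \<in> {0..1}" "t' \<in> {0..1}"
          and st: "\<bar>s' - s\<bar> \<le> 1 / real n \<and> \<bar>t' - t\<bar> \<le> 1 / real n"
        have "dist (\<tau>, s', t') (\<tau>, s, t) \<le> \<bar>s' - s\<bar> + \<bar>t' - t\<bar>"
          by (simp add: dist_Pair_Pair dist_real_def sqrt_sum_squares_le_sum_abs)
        also have "\<dots> < \<delta>" using st elim by linarith
        finally show "norm (u d e \<tau> s' t' - u d e \<tau> s t) < 1 / 12"
          using \<delta>(2)[of "(\<tau>, s, t)" "(\<tau>, s', t')"] I by (simp add: C_def dist_norm)
      qed
    qed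
  qed
  have "\<forall>\<^sub>F n in sequentially. \<forall>d\<in>UNIV. \<forall>e\<in>UNIV. eps (Upair d e) \<noteq> 0 \<longrightarrow>
      (\<forall>\<tau>\<in>{0..1}. \<forall>s\<in>{0..1}. \<forall>t\<in>{0..1}. \<forall>s'\<in>{0..1}. \<forall>t'\<in>{0..1}.
      \<bar>s' - s\<bar> \<le> 1 / real n \<and> \<bar>t' - t\<bar> \<le> 1 / real n \<longrightarrow> norm (u d e \<tau> s' t' - u d e \<tau> s t) < 1 / 12)"
  proof (intro eventually_ball_finite finite ballI)
    fix d e
    show "\<forall>\<^sub>F n in sequentially. eps (Upair d e) \<noteq> 0 \<longrightarrow>
      (\<forall>\<tau>\<in>{0..1}. \<forall>s\<in>{0..1}. \<forall>t\<in>{0..1}. \<forall>s'\<in>{0..1}. \<forall>t'\<in>{0..1}.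
      \<bar>s' - s\<bar> \<le> 1 / real n \<and> \<bar>t' - t\<bar> \<le> 1 / real n \<longrightarrow> norm (u d e \<tau> s' t' - u d e \<tau> s t) < 1 / 12)"
      using step[of d e] by (cases "eps (Upair d e) = 0") simp_all
  qed
  with eventually_gt_at_top[of 0] show ?thesis
  proof eventually_elim
    case (elim n)
    have unit: "real i / n \<in> {0..1}" if "i \<le> n" for i using that elim(1) by simp
    have reg: "bargmann (u d e \<tau> (i / n) (j / n)) (u d e \<tau> (Suc i / n) (j / n))
        (u d e \<tau> (Suc i / n) (Suc j / n)) (u d e \<tau> (i / n) (Suc j / n)) \<notin> \<real>\<^sub>\<le>\<^sub>0"
      if "eps (Upair d e) \<noteq> 0" "\<tau> \<in> {0..1}" "i < n" "j < n" for d e \<tau> i j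
    proof -
      have I: "real i / n \<in> {0..1}" "real j / n \<in> {0..1}" "real (Suc i) / n \<in> {0..1}" "real (Suc j) / n \<in> {0..1}"
        using unit[of i] unit[of j] unit[of "Suc i"] unit[of "Suc j"] that by simp_all
      have "\<bar>real (Suc i) / n - real i / n\<bar> \<le> 1 / n" "\<bar>real (Suc j) / n - real j / n\<bar> \<le> 1 / n"
        by (simp_all add: add_divide_distrib)
      then show ?thesis
        using I that elim(2) by (intro bargmann_regular norm_u) (simp_all del: of_nat_Suc)
    qed
    have integral: "\<exists>k :: int. berry_sum (h \<tau> \<circ> \<phi>) n = 2 * pi * k" if \<tau>: "\<tau> \<in> {0..1}" for \<tau>
    proof (rule berry_sum_integral[OF elim(1)])
      show "(h \<tau> \<circ> \<phi>) (edge_point d s) \<noteq> (h \<tau> \<circ> \<phi>) (edge_point e t)"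
        if "eps (Upair d e) \<noteq> 0" "s \<in> {0..1}" "t \<in> {0..1}" for d e s t
        using nz[OF that(1) \<tau> that(2,3)] by simp
      show "bargmann (direction (h \<tau> \<circ> \<phi>) d e (i / n) (j / n)) (direction (h \<tau> \<circ> \<phi>) d e (Suc i / n) (j / n))
        (direction (h \<tau> \<circ> \<phi>) d e (Suc i / n) (Suc j / n)) (direction (h \<tau> \<circ> \<phi>) d e (i / n) (Suc j / n)) \<noteq> 0"
        if "eps (Upair d e) \<noteq> 0" "i < n" "j < n" for d e i j
        using reg[OF that(1) \<tau> that(2,3)] unfolding u_def by force
    qed
    have "continuous_on {0..1} (\<lambda>\<tau>. of_int (eps (Upair d e)) * (\<Sum>i<n. \<Sum>j<n. berry (direction (h \<tau> \<circ> \<phi>) d e) n i j))"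
      for d e
    proof (cases "eps (Upair d e) = 0")
      case False
      have cu: "continuous_on {0..1} (\<lambda>\<tau>. u d e \<tau> s t)" if "s \<in> {0..1}" "t \<in> {0..1}" for s t
      proof -
        have "continuous_on {0..1} (\<lambda>\<tau>. (\<tau>, s, t))" by (intro continuous_intros)
        then have "continuous_on {0..1} (\<lambda>\<tau>. (\<lambda>p. u d e (fst p) (fst (snd p)) (snd (snd p))) (\<tau>, s, t))"
          by (rule continuous_on_compose2[OF cont_u[OF False]]) (use that in \<open>auto simp: C_def\<close>)
        then show ?thesis by simp
      qed
      have "continuous_on {0..1} (\<lambda>\<tau>. berry (direction (h \<tau> \<circ> \<phi>) d e) n i j)" if "i < n" "j < n" for i j
        unfolding berry_def u_def[symmetric]
        using that by (intro continuous_on_Arg' continuous_on_bargmann cu unit reg[OF False]) auto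
      then show ?thesis by (intro continuous_intros) auto
    qed simp
    then have cont_sum: "continuous_on {0..1} (\<lambda>\<tau>. berry_sum (h \<tau> \<circ> \<phi>) n)"
      unfolding berry_sum_def by (intro continuous_on_sum)
    have "(\<lambda>\<tau>. berry_sum (h \<tau> \<circ> \<phi>) n) constant_on {0..1}"
    proof (rule continuous_discrete_range_constant[OF _ cont_sum])
      show "connected {0..1 :: real}" by simp
      fix \<tau> :: real assume \<tau>: "\<tau> \<in> {0..1}"
      show "\<exists>e>0. \<forall>\<tau>'. \<tau>' \<in> {0..1} \<and> berry_sum (h \<tau>' \<circ> \<phi>) n \<noteq> berry_sum (h \<tau> \<circ> \<phi>) n \<longrightarrow>
          e \<le> norm (berry_sum (h \<tau>' \<circ> \<phi>) n - berry_sum (h \<tau> \<circ> \<phi>) n)"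
      proof (intro exI[of _ "2 * pi"] conjI allI impI)
        fix \<tau>' assume \<tau>': "\<tau>' \<in> {0..1} \<and> berry_sum (h \<tau>' \<circ> \<phi>) n \<noteq> berry_sum (h \<tau> \<circ> \<phi>) n"
        obtain k k' :: int where k: "berry_sum (h \<tau> \<circ> \<phi>) n = 2 * pi * k" "berry_sum (h \<tau>' \<circ> \<phi>) n = 2 * pi * k'"
          using integral[OF \<tau>] integral[of \<tau>'] \<tau>' by blast
        then have "1 \<le> \<bar>k' - k\<bar>" using \<tau>' by auto
        then have "2 * pi * 1 \<le> 2 * pi * of_int \<bar>k' - k\<bar>" by (intro mult_left_mono) auto
        also have "\<dots> = \<bar>2 * pi * k' - 2 * pi * k\<bar>" by (simp add: abs_mult flip: right_diff_distrib)
        finally show "2 * pi \<le> norm (berry_sum (h \<tau>' \<circ> \<phi>) n - berry_sum (h \<tau> \<circ> \<phi>) n)" by (simp add: k)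
      qed simp
    qed
    then show ?case unfolding constant_on_def by (metis atLeastAtMost_iff order_refl zero_le_one)
  qed
qed

section \<open>Evaluation of the Berry sum at a diagram\<close>

definition over_set :: "(pg_point \<Rightarrow> real ^ 3) \<Rightarrow> (pg_point \<Rightarrow> real ^ 2) \<Rightarrow> pg_edge \<Rightarrow> pg_edge \<Rightarrow> (real \<times> real) set" where
  "over_set \<phi> f d e = {k \<in> crossings f d e. \<phi> (edge_point e (snd k)) $ 3 < \<phi> (edge_point d (fst k)) $ 3}"

locale generic_diagram = generic_immersion +
  fixes \<phi> :: "pg_point \<Rightarrow> real ^ 3" and D :: diagram
  assumes continuous_phi: "continuous_on PG \<phi>" and inj_phi: "inj_on \<phi> PG"
    and lift: "is_lift \<phi> f" and based: "diagram_based_on D \<phi> f"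
begin

lemma pc_f: "x \<in> PG \<Longrightarrow> pc (f x) = pw (\<phi> x)"
  using lift by (simp add: is_lift_def proj_def pc_def pw_def)

lemma sphere_cell_direction:
  assumes dis: "ends d \<inter> ends e = {}"
  obtains c where "sphere_cell (edge_curve f d) (edge_curve f e) (edge_velocity f d) (edge_velocity f e)
    (crossings f d e) (direction \<phi> d e) (\<lambda>s t. inverse (norm (\<phi> (edge_point d s) - \<phi> (edge_point e t)))) c"
proof -
  let ?Q = "{0..1} \<times> {0..1} :: (real \<times> real) set"
  let ?w = "\<lambda>p. \<phi> (edge_point d (fst p)) - \<phi> (edge_point e (snd p))"
  have nz: "\<phi> (edge_point d s) - \<phi> (edge_point e t) \<noteq> 0" if "s \<in> {0..1}" "t \<in> {0..1}" for s t
    using edge_point_neq[OF dis that] inj_onD[OF inj_phi _ edge_point_in_PG[OF that(1)] edge_point_in_PG[OF that(2)]]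
    by auto
  have cont: "continuous_on ?Q ?w"
    by (intro continuous_on_diff continuous_on_compose2[OF continuous_phi]
        continuous_on_compose2[OF continuous_edge_point[of UNIV]] continuous_intros)
      (auto intro: edge_point_in_PG)
  have "bounded (?w ` ?Q)"
    by (intro compact_imp_bounded compact_continuous_image[OF cont] compact_Times) auto
  \<comment> \<open>An upper bound for the distances of points on the two edges yields the positive
    lower bound \<open>inverse M\<close> for the scaling factor.\<close>
  then obtain M where M: "M > 0" "\<And>p. p \<in> ?Q \<Longrightarrow> norm (?w p) \<le> M"
    unfolding bounded_pos by auto
  show ?thesis
  proof (rule that, intro sphere_cell.intro curve_pair_edges[OF dis] sphere_cell_axioms.intro)
    have "continuous_on ?Q (\<lambda>p. sgn (?w p))"
      by (rule continuous_on_sgn[OF cont]) (use nz in auto)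
    then show "continuous_on ?Q (\<lambda>(s, t). direction \<phi> d e s t)"
      by (simp add: direction_def case_prod_beta)
    show "inverse M > 0" using M(1) by simp
    fix s t :: real assume st: "s \<in> {0..1}" "t \<in> {0..1}"
    show "norm (direction \<phi> d e s t) = 1" using nz[OF st] by (simp add: direction_def norm_sgn)
    show "pw (direction \<phi> d e s t) = inverse (norm (\<phi> (edge_point d s) - \<phi> (edge_point e t))) *\<^sub>R
        (edge_curve f d s - edge_curve f e t)"
      by (simp add: direction_def sgn_div_norm pw_scaleR pw_diff edge_curve_def
          pc_f[OF edge_point_in_PG[OF st(1)]] pc_f[OF edge_point_in_PG[OF st(2)]])
    show "inverse M \<le> inverse (norm (\<phi> (edge_point d s) - \<phi> (edge_point e t)))"
      using M(2)[of "(s, t)"] st nz[OF st] by (intro le_imp_inverse_le) auto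
  qed
qed

lemma eventually_berry_over_set:
  assumes dis: "ends d \<inter> ends e = {}"
  shows "\<forall>\<^sub>F n in sequentially. (\<Sum>i<n. \<Sum>j<n. berry (direction \<phi> d e) n i j) =
    rect_bd (hbr spin_s (direction \<phi> d e) n) (vbr spin_s (direction \<phi> d e) n) 0 n 0 n +
    2 * pi * (- (\<Sum>k\<in>over_set \<phi> f d e. sgn (crossing_det f d e k)))"
proof -
  obtain c where "sphere_cell (edge_curve f d) (edge_curve f e) (edge_velocity f d) (edge_velocity f e)
    (crossings f d e) (direction \<phi> d e) (\<lambda>s t. inverse (norm (\<phi> (edge_point d s) - \<phi> (edge_point e t)))) c"
    using sphere_cell_direction[OF dis] .
  then interpret sphere_cell "edge_curve f d" "edge_curve f e" "edge_velocity f d" "edge_velocity f e"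
    "crossings f d e" "direction \<phi> d e" "\<lambda>s t. inverse (norm (\<phi> (edge_point d s) - \<phi> (edge_point e t)))" c .
  have "{k \<in> crossings f d e. 0 < direction \<phi> d e (fst k) (snd k) $ 3} = over_set \<phi> f d e"
    unfolding over_set_def
  proof (intro Collect_cong conj_cong refl)
    fix k assume "k \<in> crossings f d e"
    then have st: "fst k \<in> {0..1}" "snd k \<in> {0..1}" by (auto simp: crossings_def)
    have "0 < inverse (norm (\<phi> (edge_point d (fst k)) - \<phi> (edge_point e (snd k))))"
      using r_ge[OF st] c_pos by linarith
    then show "0 < direction \<phi> d e (fst k) (snd k) $ 3 \<longleftrightarrow>
        \<phi> (edge_point e (snd k)) $ 3 < \<phi> (edge_point d (fst k)) $ 3"
      by (simp add: direction_def sgn_div_norm zero_less_mult_iff)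
  qed
  with eventually_sum_berry show ?thesis by (simp add: crossing_det_def)
qed

text \<open>The shadow agrees with \<open>f\<close> only on \<open>PG\<close>, but a derivative at
  an interior parameter is local and ignores parameters beyond the ends of the edge.\<close>

lemma shadow_velocity:
  assumes "s \<in> {0<..<1}"
  shows "velocity (shadow D) e s = velocity f e s"
proof -
  have eq: "shadow D (edge_point e r) = f (edge_point e r)" if "r \<in> {0<..<1}" for r
    using based that edge_point_in_PG[of r e] by (auto simp: diagram_based_on_def)
  have "((\<lambda>r. shadow D (edge_point e r)) has_vector_derivative x) (at s) \<longleftrightarrow>
      ((\<lambda>r. f (edge_point e r)) has_vector_derivative x) (at s)" for x
    using eq has_vector_derivative_transform_within_open[of _ x s "{0<..<1}"] assms
    by (metis open_greaterThanLessThan)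
  then show ?thesis by (simp add: velocity_def vector_derivative_def)
qed

lemma over_crossings_eq:
  assumes dis: "ends d \<inter> ends e = {}"
  shows "over_crossings D \<sigma> d e =
    (\<lambda>k. f (edge_point d (fst k))) ` {k \<in> over_set \<phi> f d e. sgn (crossing_det f d e k) = \<sigma>}"
proof -
  have sh: "shadow D (edge_point c s) = f (edge_point c s)" if "s \<in> {0<..<1}" for c s
    using based that edge_point_in_PG[of s c] by (auto simp: diagram_based_on_def)
  have ov: "over D (edge_point d s) (edge_point e t) \<longleftrightarrow> \<phi> (edge_point e t) $ 3 < \<phi> (edge_point d s) $ 3"
    if "(s, t) \<in> crossings f d e" for s t
  proof -
    have st: "s \<in> {0..1}" "t \<in> {0..1}" "f (edge_point d s) = f (edge_point e t)"
      using that by (auto simp: crossings_def)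
    show ?thesis
      using based edge_point_in_PG[OF st(1)] edge_point_in_PG[OF st(2)] edge_point_neq[OF dis st(1,2)] st(3)
      by (simp add: diagram_based_on_def)
  qed
  show ?thesis
  proof (intro equalityI subsetI)
    fix p assume "p \<in> over_crossings D \<sigma> d e"
    then obtain s t where st: "s \<in> {0<..<1}" "t \<in> {0<..<1}" "f (edge_point d s) = p" "f (edge_point e t) = p"
      "over D (edge_point d s) (edge_point e t)" "sgn (crossing_det f d e (s, t)) = \<sigma>"
      unfolding over_crossings_def by (auto simp: sh shadow_velocity det_velocity)
    then have k: "(s, t) \<in> crossings f d e" by (auto simp: crossings_def)
    then have "(s, t) \<in> {k \<in> over_set \<phi> f d e. sgn (crossing_det f d e k) = \<sigma>}"
      using st ov[OF k] by (simp add: over_set_def)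
    then show "p \<in> (\<lambda>k. f (edge_point d (fst k))) ` {k \<in> over_set \<phi> f d e. sgn (crossing_det f d e k) = \<sigma>}"
      using st(3) by (intro image_eqI[of _ _ "(s, t)"]) auto
  next
    fix p assume "p \<in> (\<lambda>k. f (edge_point d (fst k))) ` {k \<in> over_set \<phi> f d e. sgn (crossing_det f d e k) = \<sigma>}"
    then obtain s t where k: "(s, t) \<in> crossings f d e" "\<phi> (edge_point e t) $ 3 < \<phi> (edge_point d s) $ 3"
      "sgn (crossing_det f d e (s, t)) = \<sigma>" "p = f (edge_point d s)"
      by (auto simp: over_set_def)
    have st: "s \<in> {0<..<1}" "t \<in> {0<..<1}" "f (edge_point d s) = f (edge_point e t)"
      using crossing_facts(1,2)[OF dis k(1)] k(1) by (auto simp: crossings_def)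
    show "p \<in> over_crossings D \<sigma> d e"
      unfolding over_crossings_def mem_Collect_eq
      using st k ov[OF k(1)]
      by (intro bexI[of _ s] bexI[of _ t]) (simp_all add: sh shadow_velocity det_velocity)
  qed
qed

lemma finite_over_set: "ends d \<inter> ends e = {} \<Longrightarrow> finite (over_set \<phi> f d e)"
  using finite_crossings by (simp add: over_set_def)

lemma card_over_crossings:
  assumes dis: "ends d \<inter> ends e = {}"
  shows "card (over_crossings D \<sigma> d e) = card {k \<in> over_set \<phi> f d e. sgn (crossing_det f d e k) = \<sigma>}"
  unfolding over_crossings_eq[OF dis]
  by (intro card_image inj_on_subset[OF inj_on_crossings[OF dis]]) (auto simp: over_set_def)

text \<open>A common point would have one and the same pair of preimages in both sets, with each
  preimage above the other.\<close>

lemma over_crossings_disjoint: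
  assumes dis: "ends d \<inter> ends e = {}"
  shows "over_crossings D \<sigma> d e \<inter> over_crossings D \<sigma> e d = {}"
proof (rule ccontr)
  assume "over_crossings D \<sigma> d e \<inter> over_crossings D \<sigma> e d \<noteq> {}"
  then obtain p where p: "p \<in> over_crossings D \<sigma> d e" "p \<in> over_crossings D \<sigma> e d" by blast
  obtain s t where k: "(s, t) \<in> over_set \<phi> f d e" "p = f (edge_point d s)"
    using p(1) unfolding over_crossings_eq[OF dis] by auto
  have dis': "ends e \<inter> ends d = {}" using dis by auto
  obtain t' s' where k': "(t', s') \<in> over_set \<phi> f e d" "p = f (edge_point e t')"
    using p(2) unfolding over_crossings_eq[OF dis'] by auto
  have c: "(s, t) \<in> crossings f d e" "(s', t') \<in> crossings f d e"
    and p': "f (edge_point d s') = p"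
    using k k' by (auto simp: over_set_def crossings_def)
  have "f (edge_point d s) = f (edge_point d s')" by (rule trans[OF k(2)[symmetric] p'[symmetric]])
  then have "(s, t) = (s', t')" by (intro inj_onD[OF inj_on_crossings[OF dis] _ c]) simp
  then show False using k(1) k'(1) by (auto simp: over_set_def)
qed

definition over_sum :: "pg_edge \<Rightarrow> pg_edge \<Rightarrow> int" where
  "over_sum d e = int (card (over_crossings D 1 d e)) - int (card (over_crossings D (-1) d e))"

lemma over_set_split:
  assumes dis: "ends d \<inter> ends e = {}"
  shows "over_set \<phi> f d e = {k \<in> over_set \<phi> f d e. sgn (crossing_det f d e k) = 1} \<union>
    {k \<in> over_set \<phi> f d e. sgn (crossing_det f d e k) = -1}"
  using crossing_det_nonzero[OF dis] by (auto simp: over_set_def sgn_if)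

lemma over_sum_eq:
  assumes dis: "ends d \<inter> ends e = {}"
  shows "of_int (over_sum d e) = (\<Sum>k\<in>over_set \<phi> f d e. sgn (crossing_det f d e k))"
proof -
  have "(\<Sum>k\<in>over_set \<phi> f d e. sgn (crossing_det f d e k)) =
      (\<Sum>k\<in>{k \<in> over_set \<phi> f d e. sgn (crossing_det f d e k) = 1}. sgn (crossing_det f d e k)) +
      (\<Sum>k\<in>{k \<in> over_set \<phi> f d e. sgn (crossing_det f d e k) = -1}. sgn (crossing_det f d e k))"
    using finite_over_set[OF dis]
    by (subst over_set_split[OF dis], intro sum.union_disjoint) auto
  also have "\<dots> = real (card {k \<in> over_set \<phi> f d e. sgn (crossing_det f d e k) = 1})
      - real (card {k \<in> over_set \<phi> f d e. sgn (crossing_det f d e k) = -1})"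
    by simp
  finally show ?thesis by (simp add: over_sum_def card_over_crossings[OF dis])
qed

lemma over_sum_parity:
  assumes dis: "ends d \<inter> ends e = {}"
  shows "even (over_sum d e - int (card (over_set \<phi> f d e)))"
proof -
  have "card (over_set \<phi> f d e) = card (over_crossings D 1 d e) + card (over_crossings D (-1) d e)"
    unfolding card_over_crossings[OF dis] using finite_over_set[OF dis]
    by (subst over_set_split[OF dis], intro card_Un_disjoint) auto
  then show ?thesis by (simp add: over_sum_def)
qed

lemma ell_over_sum:
  assumes dis: "ends d \<inter> ends e = {}"
  shows "ell D (Upair d e) = over_sum d e + over_sum e d"
proof -
  have dis': "ends e \<inter> ends d = {}" using dis by auto
  have fin: "finite (over_crossings D \<sigma> d e)" "finite (over_crossings D \<sigma> e d)" for \<sigma>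
    unfolding over_crossings_eq[OF dis] over_crossings_eq[OF dis']
    using finite_over_set[OF dis] finite_over_set[OF dis'] by auto
  have card: "card (signed_crossings D \<sigma> d e) = card (over_crossings D \<sigma> d e) + card (over_crossings D \<sigma> e d)" for \<sigma>
    unfolding signed_crossings_def by (intro card_Un_disjoint fin over_crossings_disjoint[OF dis])
  have "ell D (Upair d e) = int (c_pos D d e) - int (c_neg D d e)" by transfer simp
  then show ?thesis by (simp add: c_pos_def c_neg_def card over_sum_def)
qed

text \<open>Injectivity of \<open>\<phi>\<close> excludes equal heights, so each crossing is counted
  for exactly one order of the two edges; its sign does not affect parity.\<close>

lemma ell_parity:
  assumes dis: "ends d \<inter> ends e = {}"
  shows "even (ell D (Upair d e) - int (num_common_points f (Upair d e)))"
proof -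
  have dis': "ends e \<inter> ends d = {}" using dis by auto
  have heights: "\<phi> (edge_point e t) $ 3 \<noteq> \<phi> (edge_point d s) $ 3" if "(s, t) \<in> crossings f d e" for s t
  proof
    have st: "s \<in> {0..1}" "t \<in> {0..1}" "f (edge_point d s) = f (edge_point e t)"
      using that by (auto simp: crossings_def)
    note P = edge_point_in_PG[OF st(1), of d] edge_point_in_PG[OF st(2), of e]
    assume "\<phi> (edge_point e t) $ 3 = \<phi> (edge_point d s) $ 3"
    moreover have "pw (\<phi> (edge_point e t)) = pw (\<phi> (edge_point d s))"
      using pc_f[OF P(1)] pc_f[OF P(2)] st(3) by simp
    ultimately have "\<phi> (edge_point d s) = \<phi> (edge_point e t)"
      by (simp add: pw_def vec_eq_iff forall_3)
    then show False using inj_onD[OF inj_phi _ P] edge_point_neq[OF dis st(1,2)] by blast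
  qed
  have "crossings f d e = over_set \<phi> f d e \<union> prod.swap ` over_set \<phi> f e d"
    using heights by (fastforce simp: over_set_def crossings_def image_iff)
  moreover have "over_set \<phi> f d e \<inter> prod.swap ` over_set \<phi> f e d = {}"
    by (auto simp: over_set_def)
  ultimately have "card (crossings f d e) = card (over_set \<phi> f d e) + card (over_set \<phi> f e d)"
    using finite_over_set[OF dis] finite_over_set[OF dis']
    by (simp add: card_Un_disjoint card_image)
  moreover have "num_common_points f (Upair d e) = card (f ` edge_set d \<inter> f ` edge_set e)" by transfer simp
  ultimately have "int (num_common_points f (Upair d e)) = int (card (over_set \<phi> f d e)) + int (card (over_set \<phi> f e d))"
    by (simp add: card_common_points[OF dis])
  then have "ell D (Upair d e) - int (num_common_points f (Upair d e)) =
      (over_sum d e - int (card (over_set \<phi> f d e))) + (over_sum e d - int (card (over_set \<phi> f e d)))"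
    by (simp add: ell_over_sum[OF dis])
  then show ?thesis using over_sum_parity[OF dis] over_sum_parity[OF dis'] by simp
qed

text \<open>Each unordered pair has two orders and \<open>ell\<close> splits into two over-counts,
  so the factors 2 cancel. The right-hand side has the shape of a degree: only crossings with the
  first edge on top count.\<close>

lemma L_inv_eq: "L_inv D = (\<Sum>d\<in>UNIV. \<Sum>e\<in>UNIV. eps (Upair d e) * over_sum d e)"
proof -
  have "2 * L_inv D = (\<Sum>d\<in>UNIV. \<Sum>e\<in>UNIV. eps (Upair d e) * over_sum d e + eps (Upair d e) * over_sum e d)"
    unfolding L_inv_def sum_D1
  proof (intro sum.cong refl)
    fix d e
    show "(if eps (Upair d e) \<noteq> 0 then eps (Upair d e) * ell D (Upair d e) else 0) =
        eps (Upair d e) * over_sum d e + eps (Upair d e) * over_sum e d"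
      using ell_over_sum[OF eps_disjoint, of d e] by (simp add: distrib_left)
  qed
  also have "\<dots> = (\<Sum>d\<in>UNIV. \<Sum>e\<in>UNIV. eps (Upair d e) * over_sum d e)
      + (\<Sum>d\<in>UNIV. \<Sum>e\<in>UNIV. eps (Upair d e) * over_sum e d)"
    by (simp add: sum.distrib)
  also have "(\<Sum>d\<in>UNIV. \<Sum>e\<in>UNIV. eps (Upair d e) * over_sum e d) =
      (\<Sum>d\<in>UNIV. \<Sum>e\<in>UNIV. eps (Upair d e) * over_sum d e)"
  proof (rule trans[OF sum.swap], intro sum.cong refl)
    fix d e show "eps (Upair e d) * over_sum d e = eps (Upair d e) * over_sum d e"
      by (subst Upair_commute) (rule refl)
  qed
  finally show ?thesis by simp
qed

theorem eventually_berry_sum: "\<forall>\<^sub>F n in sequentially. berry_sum \<phi> n = - 2 * pi * of_int (L_inv D)"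
proof -
  have "\<forall>\<^sub>F n in sequentially. \<forall>d\<in>UNIV. \<forall>e\<in>UNIV. eps (Upair d e) \<noteq> 0 \<longrightarrow>
      (\<Sum>i<n. \<Sum>j<n. berry (direction \<phi> d e) n i j) =
      rect_bd (hbr spin_s (direction \<phi> d e) n) (vbr spin_s (direction \<phi> d e) n) 0 n 0 n +
      2 * pi * (- (\<Sum>k\<in>over_set \<phi> f d e. sgn (crossing_det f d e k)))"
  proof (intro eventually_ball_finite finite ballI)
    fix d e
    show "\<forall>\<^sub>F n in sequentially. eps (Upair d e) \<noteq> 0 \<longrightarrow>
      (\<Sum>i<n. \<Sum>j<n. berry (direction \<phi> d e) n i j) =
      rect_bd (hbr spin_s (direction \<phi> d e) n) (vbr spin_s (direction \<phi> d e) n) 0 n 0 n +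
      2 * pi * (- (\<Sum>k\<in>over_set \<phi> f d e. sgn (crossing_det f d e k)))"
      using eventually_berry_over_set[OF eps_disjoint, of d e] by (cases "eps (Upair d e) = 0") simp_all
  qed
  with eventually_gt_at_top[of 0] show ?thesis
  proof eventually_elim
    case (elim n)
    have "berry_sum \<phi> n = 2 * pi * (\<Sum>d\<in>UNIV. \<Sum>e\<in>UNIV. of_int (eps (Upair d e)) *
        (- (\<Sum>k\<in>over_set \<phi> f d e. sgn (crossing_det f d e k))))"
      by (rule berry_sum_eval[OF elim(1)]) (use elim(2) in blast)
    also have "(\<Sum>d\<in>UNIV. \<Sum>e\<in>UNIV. of_int (eps (Upair d e)) *
        (- (\<Sum>k\<in>over_set \<phi> f d e. sgn (crossing_det f d e k)))) =
        (\<Sum>d\<in>UNIV. \<Sum>e\<in>UNIV. - of_int (eps (Upair d e) * over_sum d e))"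
    proof (intro sum.cong refl)
      fix d e
      show "of_int (eps (Upair d e)) * (- (\<Sum>k\<in>over_set \<phi> f d e. sgn (crossing_det f d e k))) =
          - real_of_int (eps (Upair d e) * over_sum d e)"
        using over_sum_eq[OF eps_disjoint, of d e] by (cases "eps (Upair d e) = 0") simp_all
    qed
    also have "\<dots> = - of_int (L_inv D)" by (simp add: L_inv_eq sum_negf)
    finally show ?case by simp
  qed
qed

text \<open>The values of \<open>eps\<close> on \<open>D1\<close> are odd, so the weights disappear
  modulo 2.\<close>

lemma L_inv_parity: "even (L_inv D - (\<Sum>P\<in>D1. int (num_common_points f P)))"
  unfolding L_inv_def sum_subtractf[symmetric]
proof (rule dvd_sum)
  fix P assume "P \<in> D1"
  then obtain d e where P: "P = Upair d e" "eps (Upair d e) \<noteq> 0"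
    using D1_iff unfolding D1_def by blast
  have "even (ell D P - int (num_common_points f P))" "odd (eps P)"
    using ell_parity[OF eps_disjoint[OF P(2)]] eps_odd[OF P(2)] P(1) by auto
  then show "even (eps P * ell D P - int (num_common_points f P))" by simp
qed

end

lemma generic_diagramI:
  assumes "spatial_embedding \<phi>" "plane_generic_immersion f" "is_lift \<phi> f" "diagram_based_on D \<phi> f"
  shows "generic_diagram f \<phi> D"
proof
  have emb: "homeomorphic_map (top_of_set PG) (subtopology euclidean (\<phi> ` topspace (top_of_set PG))) \<phi>"
    using assms(1) by (simp add: spatial_embedding_def embedding_map_def)
  from homeomorphic_imp_continuous_map[OF this] show "continuous_on PG \<phi>"
    by (simp add: continuous_map_in_subtopology)
  from homeomorphic_imp_injective_map[OF emb] show "inj_on \<phi> PG" by simp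
qed (use assms in auto)

text \<open>Three statements hold on all fine grids: the evaluation at each of the two diagrams and
  constancy along the isotopy. A common grid links them, and the diagrams are never compared
  directly.\<close>

lemma L_inv_isotopic:
  assumes G: "generic_diagram f \<phi> D" and G': "generic_diagram f' \<phi>' D'" and iso: "ambient_isotopic \<phi> \<phi>'"
  shows "L_inv D' = L_inv D"
proof -
  interpret G: generic_diagram f \<phi> D by (rule G)
  interpret G': generic_diagram f' \<phi>' D' by (rule G')
  obtain h :: "real \<Rightarrow> real ^ 3 \<Rightarrow> real ^ 3" where h: "continuous_on ({0..1} \<times> UNIV) (\<lambda>(t, p). h t p)"
    "\<forall>t\<in>{0..1}. \<exists>k. homeomorphism UNIV UNIV (h t) k" "\<forall>p. h 0 p = p" "\<forall>x\<in>PG. \<phi>' x = h 1 (\<phi> x)"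
    using iso unfolding ambient_isotopic_def by blast
  have inj: "inj (h t)" if "t \<in> {0..1}" for t
    using h(2) that unfolding homeomorphism_def by (metis UNIV_I inj_on_def)
  have iso: "\<forall>\<^sub>F n in sequentially. berry_sum (h 0 \<circ> \<phi>) n = berry_sum (h 1 \<circ> \<phi>) n"
    by (rule eventually_berry_sum_isotopic[OF G.continuous_phi G.inj_phi h(1) inj])
  have h0: "h 0 \<circ> \<phi> = \<phi>" using h(3) by (auto simp: fun_eq_iff)
  \<comment> \<open>The isotopy prescribes \<open>\<phi>'\<close> only on \<open>PG\<close>, so the
    two sums are compared through their grid points.\<close>
  have h1: "berry_sum (h 1 \<circ> \<phi>) n = berry_sum \<phi>' n" for n
  proof (cases "n = 0")
    case False
    have dir: "direction (h 1 \<circ> \<phi>) d e s t = direction \<phi>' d e s t" if "s \<in> {0..1}" "t \<in> {0..1}" for d e s t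
      using h(4) edge_point_in_PG[OF that(1)] edge_point_in_PG[OF that(2)] by (simp add: direction_def)
    have "berry (direction (h 1 \<circ> \<phi>) d e) n i j = berry (direction \<phi>' d e) n i j" if "i < n" "j < n" for d e i j
    proof -
      have "real i / n \<in> {0..1}" "real (Suc i) / n \<in> {0..1}" "real j / n \<in> {0..1}" "real (Suc j) / n \<in> {0..1}"
        using that by simp_all
      then show ?thesis unfolding berry_def by (simp only: dir)
    qed
    then show ?thesis by (simp add: berry_sum_def)
  qed (simp add: berry_sum_def)
  have "\<forall>\<^sub>F n in sequentially. - 2 * pi * of_int (L_inv D') = - 2 * pi * of_int (L_inv D)"
    using iso G.eventually_berry_sum G'.eventually_berry_sum
    by eventually_elim (simp add: h0 h1)
  then show ?thesis by simp
qed

text \<open>The constant isotopy reduces well-definedness, which compares two diagrams of one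
  embedding, to invariance.\<close>

lemma ambient_isotopic_refl: "ambient_isotopic \<phi> \<phi>"
  unfolding ambient_isotopic_def
proof (intro exI[of _ "\<lambda>t p. p"] conjI ballI allI)
  show "continuous_on ({0..1} \<times> UNIV) (\<lambda>(t :: real, p :: real ^ 3). p)"
    by (simp add: case_prod_beta continuous_on_snd)
  show "\<exists>k. homeomorphism UNIV UNIV (\<lambda>p :: real ^ 3. p) k"
    by (rule exI[of _ "\<lambda>p. p"]) (simp add: homeomorphism_def)
qed auto

theorem theorem1p4:
  fixes \<phi> :: "pg_point \<Rightarrow> real ^ 3" and f :: "pg_point \<Rightarrow> real ^ 2" and D :: diagram
  assumes "spatial_embedding \<phi>"
    and "plane_generic_immersion f"
    and "is_lift \<phi> f"
    and "diagram_based_on D \<phi> f"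
  shows "(\<forall>f' D'. plane_generic_immersion f' \<and> is_lift \<phi> f' \<and> diagram_based_on D' \<phi> f'
            \<longrightarrow> L_inv D' = L_inv D)
    \<and> (\<forall>\<phi>' f' D'. spatial_embedding \<phi>' \<and> plane_generic_immersion f' \<and> is_lift \<phi>' f' \<and>
            diagram_based_on D' \<phi>' f' \<and> ambient_isotopic \<phi> \<phi>'
            \<longrightarrow> L_inv D' = L_inv D)
    \<and> [L_inv D = (\<Sum>P\<in>D1. int (num_common_points f P))] (mod 2)
    \<and> [(\<Sum>P\<in>D1. int (num_common_points f P)) = 1] (mod 2)"
proof (intro conjI allI impI, goal_cases)
  case (1 f' D')
  then show ?case
    using L_inv_isotopic[OF generic_diagramI[OF assms] generic_diagramI[OF assms(1)] ambient_isotopic_refl] by blast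
next
  case (2 \<phi>' f' D')
  then show ?case
    using L_inv_isotopic[OF generic_diagramI[OF assms] generic_diagramI] by blast
next
  case 3
  interpret generic_diagram f \<phi> D by (rule generic_diagramI[OF assms])
  show ?case using L_inv_parity by (simp add: cong_iff_dvd_diff)
next
  case 4
  interpret generic_immersion f by unfold_locales (rule assms(2))
  show ?case using crossings_parity by (simp add: cong_iff_dvd_diff)
qed

end
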